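(* Let $a\in\mathbb Z$ and $k\ge1$. Among the three types of moves on arrow diagrams in the disk, namely $\Omega^a_\infty$-moves, $\Omega^{a+k}_\infty$-moves and $k$-moves, any two generate the third (in the presence of the moves $\Omega_1,\dots,\Omega_5$). Moreover, $\Omega^a_\infty$-moves and $k$-moves (together with $\Omega_1,\dots,\Omega_5$) generate the $\Omega^{a+kb}_\infty$-moves for every $b\in\mathbb Z$.
   Context: An arrow diagram is a generic immersion of closed curves in the interior of an oriented closed disk $B$, with over/under information at the double points (crossings), together with finitely many arrows placed on the curves away from crossings, each pointing along the curve in one of its two directions. Diagrams are considered up to planar isotopy. Moves. $\Omega_1,\Omega_2,\Omega_3$: the classical Reidemeister moves, performed in a small disk containing no arrows. $\Omega_4$: creation or cancellation of two adjacent arrows of opposite directions on a strand (in either order). $\Omega_5$: if an arrow lies on a strand $\alpha$ next to a crossing of $\alpha$ with a strand $\beta$, points toward the crossing, and $\alpha$ passes under $\beta$, then the arrow may be pushed along $\alpha$ past the crossing, after which $\alpha$ passes over $\beta$; and the inverse of this. $\Omega^p_\infty$ ($p\in\mathbb Z$): a short arc, without arrows and crossings, running next to $\partial B$ (adjacent to the region containing $\partial B$) is replaced by the complementary arc with the same endpoints that runs once around parallel to $\partial B$ the other way, has no crossings with the rest of the diagram, and carries $p$ arrows pointing clockwise with respect to $\partial B$ (if $p<0$: $|p|$ counterclockwise arrows); and the inverse of this. (Arrow diagrams modulo $\Omega_1,\dots,\Omega_5,\Omega^p_\infty$ represent links in the lens space $L_{p,1}$ up to isotopy, with $L_{1,1}=S^3$.)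 A $k$-move: addition or removal of $k$ arrows lying on one strand with no crossing between them, all pointing in the same direction. A set of moves generates a move if the latter can be realized by a finite sequence of moves from the set. *)

theory Defs
  imports "HOL-Complex_Analysis.Winding_Numbers"
begin

section \<open>Arrow diagrams in the disk\<close>

text \<open>
  The disk \<open>B\<close> is the closed unit disk of the complex plane with its standard orientation, so that
  clockwise has its usual meaning.  Curves and ambient isotopies are of class \<open>C\<^sup>1\<close>.
\<close>

abbreviation B :: "complex set" where
  "B \<equiv> cball 0 1"

text \<open>
  The curves of a diagram are unoriented, so a diagram is stored without parametrization:
  \<open>shadow\<close> is the union of the curves, \<open>overs\<close> contains \<open>(c, u)\<close> for each crossing \<open>c\<close> and both unit
  vectors \<open>u\<close> tangent at \<open>c\<close> to the branch passing over, and \<open>arrows\<close> contains \<open>(q, u)\<close> for each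
  arrow located at \<open>q\<close> and pointing in the unit direction \<open>u\<close>.
\<close>

record diagram =
  shadow :: "complex set"
  overs :: "(complex \<times> complex) set"
  arrows :: "(complex \<times> complex) set"

definition crossings :: "diagram \<Rightarrow> complex set" where
  "crossings D = fst ` overs D"

definition arrow_points :: "diagram \<Rightarrow> complex set" where
  "arrow_points D = fst ` arrows D"

definition dir :: "(real \<Rightarrow> complex) \<Rightarrow> real \<Rightarrow> complex" where
  "dir g t = sgn (vector_derivative g (at t))"

subsection \<open>Generic immersions of finitely many circles\<close>

definition immersed_circle :: "(real \<Rightarrow> complex) \<Rightarrow> bool" where
  "immersed_circle g \<longleftrightarrow>
     (\<forall>t. g (t + 1) = g t) \<and> g C1_differentiable_on UNIV \<and>
     (\<forall>t. vector_derivative g (at t) \<noteq> 0)"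

text \<open>The disjoint union of \<open>n\<close> circles, each circle being parametrized by \<open>[0,1)\<close>.\<close>

definition params :: "nat \<Rightarrow> (nat \<times> real) set" where
  "params n = {..<n} \<times> {0..<1}"

definition pos :: "(nat \<Rightarrow> real \<Rightarrow> complex) \<Rightarrow> nat \<times> real \<Rightarrow> complex" where
  "pos \<gamma> x = \<gamma> (fst x) (snd x)"

definition pdir :: "(nat \<Rightarrow> real \<Rightarrow> complex) \<Rightarrow> nat \<times> real \<Rightarrow> complex" where
  "pdir \<gamma> x = dir (\<gamma> (fst x)) (snd x)"

definition double_params :: "nat \<Rightarrow> (nat \<Rightarrow> real \<Rightarrow> complex) \<Rightarrow> (nat \<times> real) set" where
  "double_params n \<gamma> = {x \<in> params n. \<exists>y \<in> params n. y \<noteq> x \<and> pos \<gamma> y = pos \<gamma> x}"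

text \<open>
  The only singularities are finitely many double points, at which the two branches are transverse:
  \<open>Im (cnj u * w)\<close> is the determinant of \<open>u\<close> and \<open>w\<close>.
\<close>

definition generic_immersion :: "nat \<Rightarrow> (nat \<Rightarrow> real \<Rightarrow> complex) \<Rightarrow> bool" where
  "generic_immersion n \<gamma> \<longleftrightarrow>
     (\<forall>i<n. immersed_circle (\<gamma> i)) \<and>
     finite (double_params n \<gamma>) \<and>
     (\<forall>x \<in> params n. \<forall>y \<in> params n. \<forall>z \<in> params n.
        pos \<gamma> x = pos \<gamma> y \<and> pos \<gamma> y = pos \<gamma> z \<longrightarrow> x = y \<or> y = z \<or> x = z) \<and>
     (\<forall>x \<in> params n. \<forall>y \<in> params n.
        x \<noteq> y \<and> pos \<gamma> x = pos \<gamma> y \<longrightarrow> Im (cnj (pdir \<gamma> x) * pdir \<gamma> y) \<noteq> 0)"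

text \<open>\<open>U\<close> is the set of parameters of the branches passing over at the crossings.\<close>

definition arrow_diagram :: "diagram \<Rightarrow> bool" where
  "arrow_diagram D \<longleftrightarrow> (\<exists>n \<gamma> U.
     generic_immersion n \<gamma> \<and>
     shadow D = pos \<gamma> ` params n \<and> shadow D \<subseteq> interior B \<and>
     U \<subseteq> double_params n \<gamma> \<and>
     (\<forall>x \<in> params n. \<forall>y \<in> params n. x \<noteq> y \<and> pos \<gamma> x = pos \<gamma> y \<longrightarrow> (x \<in> U \<longleftrightarrow> y \<notin> U)) \<and>
     overs D = {(pos \<gamma> x, u) | x u. x \<in> U \<and> u \<in> {pdir \<gamma> x, - pdir \<gamma> x}} \<and>
     finite (arrows D) \<and> inj_on fst (arrows D) \<and>
     (\<forall>(q, u) \<in> arrows D. \<exists>x \<in> params n - double_params n \<gamma>.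
        q = pos \<gamma> x \<and> u \<in> {pdir \<gamma> x, - pdir \<gamma> x}))"

subsection \<open>Planar isotopy\<close>

text \<open>\<open>f' z\<close> is the derivative of \<open>f\<close> at \<open>z\<close>.\<close>

definition map_diagram ::
  "(complex \<Rightarrow> complex) \<Rightarrow> (complex \<Rightarrow> complex \<Rightarrow> complex) \<Rightarrow> diagram \<Rightarrow> diagram" where
  "map_diagram f f' D =
     \<lparr>shadow = f ` shadow D,
      overs = (\<lambda>(q, u). (f q, sgn (f' q u))) ` overs D,
      arrows = (\<lambda>(q, u). (f q, sgn (f' q u))) ` arrows D\<rparr>"

definition ambient_isotopy ::
  "(real \<Rightarrow> complex \<Rightarrow> complex) \<Rightarrow> (real \<Rightarrow> complex \<Rightarrow> complex \<Rightarrow> complex) \<Rightarrow> bool" where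
  "ambient_isotopy H H' \<longleftrightarrow>
     (\<forall>z \<in> B. H 0 z = z) \<and>
     (\<forall>t \<in> {0..1}. bij_betw (H t) B B) \<and>
     (\<forall>t \<in> {0..1}. \<forall>z \<in> B. (H t has_derivative H' t z) (at z within B) \<and> inj (H' t z)) \<and>
     continuous_on ({0..1} \<times> B) (\<lambda>(t, z). H t z) \<and>
     (\<forall>w. continuous_on ({0..1} \<times> B) (\<lambda>(t, z). H' t z w))"

definition planar_isotopic :: "diagram \<Rightarrow> diagram \<Rightarrow> bool" where
  "planar_isotopic D D' \<longleftrightarrow> arrow_diagram D \<and> arrow_diagram D' \<and>
     (\<exists>H H'. ambient_isotopy H H' \<and> D' = map_diagram (H 1) (H' 1) D)"

section \<open>Moves\<close>

text \<open>
  Each move below is given in one direction; inverses are supplied by the equivalence closure in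
  \<open>generates\<close>.
\<close>

type_synonym move = "diagram \<Rightarrow> diagram \<Rightarrow> bool"

definition immersed_path :: "(real \<Rightarrow> complex) \<Rightarrow> bool" where
  "immersed_path g \<longleftrightarrow> g C1_differentiable_on {0..1} \<and>
     (\<forall>t \<in> {0..1}. vector_derivative g (at t) \<noteq> 0)"

definition embedded_path :: "(real \<Rightarrow> complex) \<Rightarrow> bool" where
  "embedded_path g \<longleftrightarrow> immersed_path g \<and> inj_on g {0..1}"

definition same_ends :: "(real \<Rightarrow> complex) \<Rightarrow> (real \<Rightarrow> complex) \<Rightarrow> bool" where
  "same_ends g h \<longleftrightarrow> pathstart g = pathstart h \<and> pathfinish g = pathfinish h"

subsection \<open>Reidemeister moves\<close>

text \<open>\<open>D\<close> and \<open>D'\<close> differ only inside the disk \<open>K\<close>, which contains no arrows.\<close>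

definition local_change :: "complex set \<Rightarrow> move" where
  "local_change K D D' \<longleftrightarrow> arrow_diagram D \<and> arrow_diagram D' \<and>
     K homeomorphic (cball 0 1 :: complex set) \<and> K \<subseteq> interior B \<and>
     shadow D - interior K = shadow D' - interior K \<and>
     {x \<in> overs D. fst x \<notin> interior K} = {x \<in> overs D'. fst x \<notin> interior K} \<and>
     arrows D = arrows D' \<and>
     crossings D \<inter> frontier K = {} \<and> arrow_points D \<inter> K = {}"

definition proper_path :: "complex set \<Rightarrow> (real \<Rightarrow> complex) \<Rightarrow> bool" where
  "proper_path K g \<longleftrightarrow> immersed_path g \<and>
     pathstart g \<in> frontier K \<and> pathfinish g \<in> frontier K \<and> g ` {0<..<1} \<subseteq> interior K"

definition proper_arc :: "complex set \<Rightarrow> (real \<Rightarrow> complex) \<Rightarrow> bool" where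
  "proper_arc K g \<longleftrightarrow> proper_path K g \<and> inj_on g {0..1}"

definition passes_over :: "diagram \<Rightarrow> (real \<Rightarrow> complex) \<Rightarrow> (real \<Rightarrow> complex) \<Rightarrow> bool" where
  "passes_over D g h \<longleftrightarrow> (\<forall>t \<in> {0..1}. g t \<in> path_image h \<longrightarrow> (g t, dir g t) \<in> overs D)"

text \<open>The path \<open>h\<close> has one self-crossing; both kinks and both crossing types are allowed.\<close>

definition Omega1 :: move where
  "Omega1 D D' \<longleftrightarrow> (\<exists>K g h. local_change K D D' \<and>
     proper_arc K g \<and> shadow D \<inter> K = path_image g \<and>
     proper_path K h \<and> shadow D' \<inter> K = path_image h \<and> same_ends g h \<and>
     (\<exists>s t. 0 < s \<and> s < t \<and> t < 1 \<and> h s = h t \<and>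
        (\<forall>x \<in> {0..1}. \<forall>y \<in> {0..1}. x < y \<and> h x = h y \<longrightarrow> x = s \<and> y = t)))"

definition Omega2 :: move where
  "Omega2 D D' \<longleftrightarrow> (\<exists>K g1 g2 h1 h2. local_change K D D' \<and>
     proper_arc K g1 \<and> proper_arc K g2 \<and> shadow D \<inter> K = path_image g1 \<union> path_image g2 \<and>
     path_image g1 \<inter> path_image g2 = {} \<and>
     proper_arc K h1 \<and> proper_arc K h2 \<and> shadow D' \<inter> K = path_image h1 \<union> path_image h2 \<and>
     card (path_image h1 \<inter> path_image h2) = 2 \<and> passes_over D' h1 h2 \<and>
     same_ends g1 h1 \<and> same_ends g2 h2)"

definition three_strands ::
  "complex set \<Rightarrow> diagram \<Rightarrow> (real \<Rightarrow> complex) \<Rightarrow> (real \<Rightarrow> complex) \<Rightarrow> (real \<Rightarrow> complex) \<Rightarrow> bool" where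
  "three_strands K D g1 g2 g3 \<longleftrightarrow>
     proper_arc K g1 \<and> proper_arc K g2 \<and> proper_arc K g3 \<and>
     shadow D \<inter> K = path_image g1 \<union> path_image g2 \<union> path_image g3 \<and>
     is_singleton (path_image g1 \<inter> path_image g2) \<and>
     is_singleton (path_image g1 \<inter> path_image g3) \<and>
     is_singleton (path_image g2 \<inter> path_image g3) \<and>
     passes_over D g1 g2 \<and> passes_over D g1 g3 \<and> passes_over D g2 g3"

text \<open>
  The top, middle and bottom strands are \<open>g1, g2, g3\<close> before and \<open>h1, h2, h3\<close> after the move.  The
  last clause says that the triangle is reversed: along the top strand the other two strands are met
  in the opposite order.
\<close>

definition Omega3 :: move where
  "Omega3 D D' \<longleftrightarrow> (\<exists>K g1 g2 g3 h1 h2 h3. local_change K D D' \<and>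
     three_strands K D g1 g2 g3 \<and> three_strands K D' h1 h2 h3 \<and>
     same_ends g1 h1 \<and> same_ends g2 h2 \<and> same_ends g3 h3 \<and>
     (\<exists>s \<in> {0..1}. \<exists>t \<in> {0..1}. \<exists>s' \<in> {0..1}. \<exists>t' \<in> {0..1}.
        g1 s \<in> path_image g2 \<and> g1 t \<in> path_image g3 \<and>
        h1 s' \<in> path_image h2 \<and> h1 t' \<in> path_image h3 \<and> (s < t \<longleftrightarrow> t' < s')))"

subsection \<open>Moves with arrows\<close>

text \<open>\<open>e\<close> distinguishes the two orders of the arrows: facing each other or facing away.\<close>

definition Omega4 :: move where
  "Omega4 D D' \<longleftrightarrow> arrow_diagram D \<and> arrow_diagram D' \<and>
     shadow D' = shadow D \<and> overs D' = overs D \<and>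
     (\<exists>g s t e. embedded_path g \<and> path_image g \<subseteq> shadow D \<and>
        path_image g \<inter> crossings D = {} \<and> path_image g \<inter> arrow_points D = {} \<and>
        0 < s \<and> s < t \<and> t < 1 \<and> e \<in> {1, -1} \<and>
        arrows D' = arrows D \<union> {(g s, e * dir g s), (g t, - e * dir g t)})"

text \<open>
  The strand \<open>\<alpha>\<close> of the move is \<open>g\<close>, directed like the arrow; \<open>g r\<close> is the crossing and \<open>A\<close> is the
  set of all other arrows.
\<close>

definition Omega5 :: move where
  "Omega5 D D' \<longleftrightarrow> arrow_diagram D \<and> arrow_diagram D' \<and> shadow D' = shadow D \<and>
     (\<exists>g s r t A. embedded_path g \<and> path_image g \<subseteq> shadow D \<and>
        0 < s \<and> s < r \<and> r < t \<and> t < 1 \<and>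
        path_image g \<inter> crossings D = {g r} \<and> path_image g \<inter> fst ` A = {} \<and>
        arrows D = insert (g s, dir g s) A \<and> arrows D' = insert (g t, dir g t) A \<and>
        {x \<in> overs D. fst x \<noteq> g r} = {x \<in> overs D'. fst x \<noteq> g r} \<and>
        (g r, dir g r) \<notin> overs D \<and> (g r, dir g r) \<in> overs D')"

text \<open>
  The arc \<open>g\<close> is replaced by \<open>h\<close>, and \<open>Z\<close> is the unchanged part of the curves.  The arcs \<open>g\<close> and
  \<open>h\<close> together form a simple closed curve enclosing \<open>Z\<close>.  This says both that \<open>g\<close> is adjacent to the
  region of the diagram containing the boundary of \<open>B\<close>, and that \<open>h\<close> runs around parallel to the
  boundary on the other side.  By the winding number condition \<open>h\<close> is directed clockwise, which is
  no restriction as \<open>g\<close> and \<open>h\<close> may both be reversed.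
\<close>

definition Omega_inf :: "int \<Rightarrow> move" where
  "Omega_inf p D D' \<longleftrightarrow> arrow_diagram D \<and> arrow_diagram D' \<and> overs D' = overs D \<and>
     (\<exists>Z g h T. embedded_path g \<and> embedded_path h \<and> same_ends g h \<and>
        shadow D = Z \<union> path_image g \<and> shadow D' = Z \<union> path_image h \<and>
        Z \<inter> path_image g = {pathstart g, pathfinish g} \<and>
        Z \<inter> path_image h = {pathstart g, pathfinish g} \<and>
        path_image g \<inter> path_image h = {pathstart g, pathfinish g} \<and>
        path_image g \<inter> crossings D = {} \<and> path_image g \<inter> arrow_points D = {} \<and>
        Z - {pathstart g, pathfinish g} \<subseteq> inside (path_image g \<union> path_image h) \<and>
        (\<forall>z \<in> inside (path_image g \<union> path_image h).
           winding_number (h +++ reversepath g) z = -1) \<and>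
        T \<subseteq> {0<..<1} \<and> finite T \<and> card T = nat \<bar>p\<bar> \<and>
        arrows D' = arrows D \<union> (\<lambda>t. (h t, if p \<ge> 0 then dir h t else - dir h t)) ` T)"

text \<open>The common direction of the new arrows is that of the path \<open>g\<close>.\<close>

definition k_move :: "nat \<Rightarrow> move" where
  "k_move k D D' \<longleftrightarrow> arrow_diagram D \<and> arrow_diagram D' \<and>
     shadow D' = shadow D \<and> overs D' = overs D \<and>
     (\<exists>g T. embedded_path g \<and> path_image g \<subseteq> shadow D \<and> path_image g \<inter> crossings D = {} \<and>
        T \<subseteq> {0<..<1} \<and> finite T \<and> card T = k \<and> g ` T \<inter> arrow_points D = {} \<and>
        arrows D' = arrows D \<union> (\<lambda>t. (g t, dir g t)) ` T)"

subsection \<open>Generation\<close>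

definition step :: "move set \<Rightarrow> move" where
  "step M D D' \<longleftrightarrow> planar_isotopic D D' \<or> (\<exists>m \<in> M. m D D')"

definition generates :: "move set \<Rightarrow> move \<Rightarrow> bool" where
  "generates M m \<longleftrightarrow> (\<forall>D D'. m D D' \<longrightarrow> equivclp (step M) D D')"

definition Omega_finite :: "move set" where
  "Omega_finite = {Omega1, Omega2, Omega3, Omega4, Omega5}"

end

(*
  An Omega4-move creates an opposite pair of arrows, one of which can be cancelled against a third:
  arrows slide along a strand without crossings, and only their signed number on it matters.
  Hence k-moves change the number of arrows carried by the new arc of an Omega_inf-move by any
  multiple of k, which gives the generation of Omega_inf-moves.

  For the k-move, follow a generic ray, provided by Sard's theorem, from a point of the strand to the
  boundary of the disk.  If nothing else meets the ray, replace a short piece of the strand by an arc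
  around everything with Omega^(a+k), slide k arrows off this arc past its end, and return
  with the inverse of Omega^a.  Otherwise perform Omega^a at the outermost point of the ray on the
  diagram: the new arc leaves the ray on one side, goes around everything and comes back on the other
  side, so the ray has one intersection less.  Create the arrows inductively and undo this move.
  No Reidemeister move and no planar isotopy is needed.
*)
theory Submission
  imports Defs
begin

section \<open>Parametrized diagrams\<close>

text \<open>A diagram is a set of points with marked directions, so the path of a move must be
  compared with a parametrization of the circles; at a simple point, position and tangent direction
  up to sign agree. Signs shape the argument: arrows of an Omega_inf-move are clockwise, those of a
  k-move follow a path, and a strand may cross the ray either way. The sign \<open>\<sigma>\<close>
  records the crossing, and with it the order in which \<open>a\<close> and \<open>a + k\<close> are
  used.

  The arc around everything is built in coordinates \<open>q0 + exp p\<close>: rays become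
  horizontal lines, clockwise means decreasing \<open>Im p\<close>, and enclosing is read off from a
  lift that ends \<open>2 * pi\<close> lower. Being of class C1, the arc has to leave along the
  strand, towards the ray, and yet run off clockwise; hence legs that double back. An Omega_inf-move
  is provided for all arrow sets off the exchanged arc, so that the same arc can be removed after
  arrows were created elsewhere. The recursion closes up because the new arc avoids the whole ray
  and all crossings keep their parameters.\<close>

definition parametrizes ::
  "nat \<Rightarrow> (nat \<Rightarrow> real \<Rightarrow> complex) \<Rightarrow> (nat \<times> real) set \<Rightarrow> diagram \<Rightarrow> bool" where
  "parametrizes n \<gamma> U D \<longleftrightarrow>
     generic_immersion n \<gamma> \<and>
     shadow D = pos \<gamma> ` params n \<and> shadow D \<subseteq> interior B \<and>
     U \<subseteq> double_params n \<gamma> \<and>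
     (\<forall>x \<in> params n. \<forall>y \<in> params n. x \<noteq> y \<and> pos \<gamma> x = pos \<gamma> y \<longrightarrow> (x \<in> U \<longleftrightarrow> y \<notin> U)) \<and>
     overs D = {(pos \<gamma> x, u) | x u. x \<in> U \<and> u \<in> {pdir \<gamma> x, - pdir \<gamma> x}}"

text \<open>Splitting \<open>arrow_diagram\<close> into \<open>parametrizes\<close>, which ignores
  arrows, and this condition fits the moves: some change only arrows and keep the parametrization,
  others exchange an arc and keep the arrows already present.\<close>

definition arrows_ok ::
  "nat \<Rightarrow> (nat \<Rightarrow> real \<Rightarrow> complex) \<Rightarrow> (complex \<times> complex) set \<Rightarrow> bool" where
  "arrows_ok n \<gamma> A \<longleftrightarrow> finite A \<and> inj_on fst A \<and>
     (\<forall>(q, u) \<in> A. \<exists>x \<in> params n - double_params n \<gamma>.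
        q = pos \<gamma> x \<and> u \<in> {pdir \<gamma> x, - pdir \<gamma> x})"

lemma arrow_diagram_iff:
  "arrow_diagram D \<longleftrightarrow> (\<exists>n \<gamma> U. parametrizes n \<gamma> U D \<and> arrows_ok n \<gamma> (arrows D))"
  unfolding arrow_diagram_def parametrizes_def arrows_ok_def by (simp only: conj_assoc)

lemma parametrizes_cong:
  "parametrizes n \<gamma> U D \<Longrightarrow> shadow D' = shadow D \<Longrightarrow> overs D' = overs D \<Longrightarrow> parametrizes n \<gamma> U D'"
  unfolding parametrizes_def by (elim conjE, intro conjI) simp_all

lemma parametrizesD:
  assumes "parametrizes n \<gamma> U D"
  shows "generic_immersion n \<gamma>" "shadow D = pos \<gamma> ` params n" "shadow D \<subseteq> ball 0 1"
    "U \<subseteq> double_params n \<gamma>"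
    "x \<in> params n \<Longrightarrow> y \<in> params n \<Longrightarrow> x \<noteq> y \<Longrightarrow> pos \<gamma> x = pos \<gamma> y \<Longrightarrow> x \<in> U \<longleftrightarrow> y \<notin> U"
    "overs D = {(pos \<gamma> x, u) | x u. x \<in> U \<and> u \<in> {pdir \<gamma> x, - pdir \<gamma> x}}"
proof -
  note P = assms[unfolded parametrizes_def interior_cball]
  show "generic_immersion n \<gamma>" using P by (elim conjE)
  show "shadow D = pos \<gamma> ` params n" using P by (elim conjE)
  show "shadow D \<subseteq> ball 0 1" using P by (elim conjE)
  show "U \<subseteq> double_params n \<gamma>" using P by (elim conjE)
  show "overs D = {(pos \<gamma> x, u) | x u. x \<in> U \<and> u \<in> {pdir \<gamma> x, - pdir \<gamma> x}}" using P by (elim conjE)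
  have *: "\<forall>x \<in> params n. \<forall>y \<in> params n. x \<noteq> y \<and> pos \<gamma> x = pos \<gamma> y \<longrightarrow> (x \<in> U \<longleftrightarrow> y \<notin> U)"
    using P by (elim conjE)
  show "x \<in> U \<longleftrightarrow> y \<notin> U" if "x \<in> params n" "y \<in> params n" "x \<noteq> y" "pos \<gamma> x = pos \<gamma> y"
    using *[rule_format, OF that(1,2) conjI, OF that(3,4)] .
qed

text \<open>\<open>overs\<close> records only the branches passing over. Exactly one of the two
  parameters of a double point lies in \<open>U\<close>, so the image of \<open>U\<close> already
  contains every double point.\<close>

lemma crossings_eq:
  assumes P: "parametrizes n \<gamma> U D"
  shows "crossings D = pos \<gamma> ` double_params n \<gamma>"
proof -
  have "fst ` {(p x, u) | x u. x \<in> U \<and> u \<in> {d x, - d x}} = p ` U"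
    for p d :: "nat \<times> real \<Rightarrow> complex"
    by (force simp: image_iff)
  then have "crossings D = pos \<gamma> ` U"
    unfolding crossings_def parametrizesD(6)[OF P] .
  moreover have "pos \<gamma> ` double_params n \<gamma> \<subseteq> pos \<gamma> ` U"
  proof
    fix z assume "z \<in> pos \<gamma> ` double_params n \<gamma>"
    then obtain x y where xy: "x \<in> params n" "y \<in> params n" "y \<noteq> x" "pos \<gamma> y = pos \<gamma> x" "z = pos \<gamma> x"
      unfolding double_params_def by blast
    from parametrizesD(5)[OF P xy(2,1,3,4)] consider "x \<in> U" | "y \<in> U" by blast
    then show "z \<in> pos \<gamma> ` U" using xy(4,5) by cases (metis imageI)+
  qed
  ultimately show ?thesis
    using parametrizesD(4)[OF P] by blast
qed

section \<open>Periodic parametrizations and the shadow near a simple point\<close>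

lemma immersed_circleD:
  assumes "immersed_circle g"
  shows "g (t + 1) = g t" "(g has_vector_derivative vector_derivative g (at t)) (at t)"
    "continuous_on UNIV (\<lambda>t. vector_derivative g (at t))" "vector_derivative g (at t) \<noteq> 0"
    "continuous_on S g"
proof -
  have C: "\<forall>x. g differentiable at x" "continuous_on UNIV (\<lambda>t. vector_derivative g (at t))"
    using assms unfolding immersed_circle_def C1_differentiable_on_eq by auto
  then show "(g has_vector_derivative vector_derivative g (at t)) (at t)"
    "continuous_on UNIV (\<lambda>t. vector_derivative g (at t))"
    by (simp_all add: vector_derivative_works)
  show "continuous_on S g"
    using C(1) by (meson continuous_at_imp_continuous_on differentiable_imp_continuous_within)
qed (use assms in \<open>auto simp: immersed_circle_def\<close>)

lemma periodic_int:
  fixes g :: "real \<Rightarrow> 'a"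
  assumes "\<And>t. g (t + 1) = g t"
  shows "g (t + of_int m) = g t"
proof (induction m rule: int_induct[where k = 0])
  case (step1 i)
  then show ?case using assms[of "t + of_int i"] by (simp add: algebra_simps)
next
  case (step2 i)
  then show ?case using assms[of "t + of_int i - 1"] by (simp add: algebra_simps)
qed simp

lemma periodic_frac:
  fixes g :: "real \<Rightarrow> 'a"
  assumes "\<And>t. g (t + 1) = g t"
  shows "g (frac t) = g t"
  using periodic_int[of g t "- \<lfloor>t\<rfloor>"] assms by (simp add: frac_def)

lemma generic_immersionD:
  assumes "generic_immersion n \<gamma>" "i < n"
  shows "immersed_circle (\<gamma> i)"
  using assms unfolding generic_immersion_def by auto

text \<open>\<open>params\<close> consists of half-open unit intervals; \<open>frac\<close> picks
  the representative of an arbitrary real parameter.\<close>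

lemma param_of:
  assumes "generic_immersion n \<gamma>" "i < n"
  shows "(i, frac s) \<in> params n" "pos \<gamma> (i, frac s) = \<gamma> i s"
  using assms periodic_frac[of "\<gamma> i" s] generic_immersionD[OF assms]
  by (auto simp: params_def pos_def frac_lt_1 immersed_circle_def)

text \<open>The other branches form a compact set, so they stay away from a simple point.\<close>

lemma local_strand:
  assumes P: "parametrizes n \<gamma> U D" and x: "x \<in> params n - double_params n \<gamma>" and "\<epsilon> > 0"
  shows "\<exists>\<eta>>0. \<forall>z \<in> shadow D. dist z (pos \<gamma> x) < \<eta> \<longrightarrow>
           (\<exists>\<tau>. \<bar>\<tau> - snd x\<bar> < \<epsilon> \<and> z = \<gamma> (fst x) \<tau>)"
proof -
  define e i t where "e = min \<epsilon> (1/2)" and "i = fst x" and "t = snd x"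
  have gi: "generic_immersion n \<gamma>" and sh: "shadow D = pos \<gamma> ` params n"
    using parametrizesD[OF P] by auto
  have e: "0 < e" "e \<le> 1/2" "e \<le> \<epsilon>" using \<open>\<epsilon> > 0\<close> by (auto simp: e_def)
  have i: "i < n" and t: "0 \<le> t" "t < 1" and xit: "x = (i, t)"
    using x by (auto simp: i_def t_def params_def)
  \<comment> \<open>Everything traced outside the \<open>e\<close>-window around \<open>t\<close>.
    The interval may run past 1, which is legitimate because \<open>\<gamma> i\<close> is
    periodic.\<close>
  define K where "K = (\<Union>j \<in> {..<n} - {i}. \<gamma> j ` {0..1}) \<union> \<gamma> i ` {t + e..t + 1 - e}"
  have cont: "continuous_on S (\<gamma> j)" if "j < n" for j S
    using immersed_circleD(5) generic_immersionD[OF gi that] by blast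
  have "compact K"
    unfolding K_def using cont i
    by (intro compact_Un compact_UN compact_continuous_image) auto
  have simple: "y = x" if "y \<in> params n" "pos \<gamma> y = pos \<gamma> x" for y
    using that x unfolding double_params_def by auto
  have "pos \<gamma> x \<notin> K"
  proof
    assume "pos \<gamma> x \<in> K"
    then consider j s where "j < n" "j \<noteq> i" "pos \<gamma> x = \<gamma> j s"
      | s where "t + e \<le> s" "s \<le> t + 1 - e" "pos \<gamma> x = \<gamma> i s"
      unfolding K_def by fastforce
    then show False
    proof cases
      case 1
      then show False using simple[of "(j, frac s)"] param_of[OF gi 1(1), of s] xit by simp
    next
      case 2
      then have "frac s = t" using simple[of "(i, frac s)"] param_of[OF gi i, of s] xit by simp
      then have "s - t = of_int \<lfloor>s\<rfloor>" by (simp add: frac_def)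
      moreover have "0 < s - t" "s - t < 1" using 2 e by auto
      ultimately have "0 < \<lfloor>s\<rfloor>" "\<lfloor>s\<rfloor> < 1" by linarith+
      then show False by simp
    qed
  qed
  then obtain d where d: "d > 0" "\<And>z. z \<in> K \<Longrightarrow> d \<le> dist (pos \<gamma> x) z"
    using separate_point_closed[of K "pos \<gamma> x"] \<open>compact K\<close> compact_imp_closed by blast
  have "\<exists>\<tau>. \<bar>\<tau> - t\<bar> < \<epsilon> \<and> z = \<gamma> i \<tau>" if "z \<in> shadow D" and zd: "dist z (pos \<gamma> x) < d" for z
  proof -
    obtain j s where js: "j < n" "0 \<le> s" "s < 1" "z = \<gamma> j s"
      using \<open>z \<in> shadow D\<close> sh by (auto simp: params_def pos_def)
    have zK: "z \<notin> K" using d(2)[of z] zd by (auto simp: dist_commute)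
    then have ji: "j = i" using js unfolding K_def by (metis (no_types, lifting) Diff_iff UN_I UnI1
        atLeastAtMost_iff empty_iff imageI insert_iff lessThan_iff less_imp_le)
    have nk: "\<not> (t + e \<le> r \<and> r \<le> t + 1 - e)" if "\<gamma> i r = z" for r
      using zK that unfolding K_def by auto
    have z: "\<gamma> i s = z" using js(4) ji by blast
    have per1: "\<gamma> i (s + 1) = z"
      using immersed_circleD(1)[OF generic_immersionD[OF gi i], of s] z by (rule trans)
    have "\<gamma> i (s - 1 + 1) = \<gamma> i (s - 1)"
      by (rule immersed_circleD(1)[OF generic_immersionD[OF gi i]])
    from trans[OF this[symmetric]] have per2: "\<gamma> i (s - 1) = z"
      unfolding diff_add_cancel using z by blast
    have "\<not> (t + e \<le> s \<and> s \<le> t + 1 - e)" "\<not> (t + e \<le> s + 1 \<and> s + 1 \<le> t + 1 - e)"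
      using nk[OF z] nk[OF per1] by blast+
    \<comment> \<open>Both parameters are representatives in \<open>{0..<1}\<close>, so close to the
      base point of the circle they may be near each other only after a shift by one period.\<close>
    then have "\<bar>s - t\<bar> < e \<or> \<bar>s - 1 - t\<bar> < e \<or> \<bar>s + 1 - t\<bar> < e"
      using js(2,3) t e(1,2) by linarith
    then have "\<bar>s - t\<bar> < \<epsilon> \<or> \<bar>s - 1 - t\<bar> < \<epsilon> \<or> \<bar>s + 1 - t\<bar> < \<epsilon>"
      using e(3) by linarith
    then show ?thesis using per1 per2 z by metis
  qed
  then show ?thesis using d(1) i_def t_def by blast
qed

section \<open>Tangent directions of the shadow\<close>

lemma sgn_parallel:
  assumes "Im (cnj a * b) = 0" "a \<noteq> 0" "b \<noteq> 0"
  shows "sgn b = sgn a \<or> sgn b = - sgn a"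
proof -
  define r where "r = Re (cnj a * b) / (norm a)\<^sup>2"
  have "cnj a * b = of_real (Re (cnj a * b))"
    using assms(1) by (simp add: complex_eq_iff)
  then have "a * cnj a * b = a * of_real (Re (cnj a * b))" by (simp add: mult.assoc)
  then have "of_real ((norm a)\<^sup>2) * b = a * of_real (Re (cnj a * b))"
    by (simp only: complex_norm_square[symmetric])
  then have b: "b = r *\<^sub>R a"
    using assms(2) unfolding r_def by (simp add: scaleR_conv_of_real field_simps)
  then have "r \<noteq> 0" using assms(3) by (metis scaleR_zero_left)
  then have "sgn (r *\<^sub>R a) = sgn a \<or> sgn (r *\<^sub>R a) = - sgn a"
    by (cases "r > 0") (simp_all add: sgn_scaleR)
  with b show ?thesis by metis
qed

lemma tendsto_slope:
  fixes c :: "real \<Rightarrow> complex"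
  assumes "(c has_vector_derivative c') (at s)"
  shows "((\<lambda>u. (c u - c s) /\<^sub>R (u - s)) \<longlongrightarrow> c') (at s)"
  using assms
  unfolding has_vector_derivative_complex_iff has_field_derivative_iff tendsto_complex_iff[of _ c']
  by (simp add: divide_inverse_commute)

text \<open>Near a simple point the shadow is a single branch, so each nearby \<open>c u\<close> is
  some \<open>\<gamma> i \<tau>\<close> with \<open>\<tau>\<close> close to \<open>t\<close>.
  Nothing is claimed about \<open>\<tau>\<close> as a function of \<open>u\<close>: it suffices that
  the component of \<open>c u - c s\<close> normal to the branch is small compared with its length,
  and this estimate passes to the limit of the difference quotients.\<close>

lemma tangent_to_strand:
  assumes P: "parametrizes n \<gamma> U D" and x: "x \<in> params n - double_params n \<gamma>"
    and c: "(c has_vector_derivative c') (at s)" "c' \<noteq> 0" "c s = pos \<gamma> x"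
    and ev: "\<forall>\<^sub>F u in at s. c u \<in> shadow D"
  shows "sgn c' = pdir \<gamma> x \<or> sgn c' = - pdir \<gamma> x"
proof -
  define i t a where "i = fst x" and "t = snd x" and "a = vector_derivative (\<gamma> i) (at t)"
  have i: "i < n" using x by (auto simp: i_def params_def)
  have ic: "immersed_circle (\<gamma> i)"
    using generic_immersionD[OF parametrizesD(1)[OF P] i] .
  have a: "a \<noteq> 0" "(\<gamma> i has_vector_derivative a) (at t)"
    using immersed_circleD(2,4)[OF ic] unfolding a_def by blast+
  have x': "pos \<gamma> x = \<gamma> i t" by (simp add: pos_def i_def t_def)
  have bound: "\<bar>Im (cnj a * c')\<bar> \<le> e * norm c'" if e: "0 < e" for e
  proof -
    \<comment> \<open>The bound \<open>norm a / 2\<close> yields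
      \<open>\<bar>\<tau> - t\<bar> * norm a \<le> 2 * norm w\<close>; the bound
      \<open>e / 2\<close> absorbs the factor 2 that this costs.\<close>
    define e1 where "e1 = min (norm a / 2) (e / 2)"
    have e1: "0 < e1" "e1 \<le> norm a / 2" "e1 \<le> e / 2" using a e by (auto simp: e1_def)
    obtain d where d: "d > 0"
      "\<And>\<tau>. \<bar>\<tau> - t\<bar> < d \<Longrightarrow> norm (\<gamma> i \<tau> - \<gamma> i t - (\<tau> - t) *\<^sub>R a) \<le> e1 * \<bar>\<tau> - t\<bar>"
      using a(2) e1(1) unfolding has_vector_derivative_def has_derivative_at_alt
      by (auto simp: real_norm_def)
    obtain \<eta> where \<eta>: "\<eta> > 0" "\<And>z. z \<in> shadow D \<Longrightarrow> dist z (c s) < \<eta> \<Longrightarrow>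
           \<exists>\<tau>. \<bar>\<tau> - t\<bar> < d \<and> z = \<gamma> i \<tau>"
      using local_strand[OF P x d(1)] c(3) unfolding i_def t_def by metis
    have "isCont c s" using c(1) has_vector_derivative_continuous by blast
    then have "\<forall>\<^sub>F u in at s. dist (c u) (c s) < \<eta>"
      using \<eta>(1) unfolding isCont_def tendsto_iff by blast
    then have "\<forall>\<^sub>F u in at s. \<bar>Im (cnj a * ((c u - c s) /\<^sub>R (u - s)))\<bar> \<le> e * norm ((c u - c s) /\<^sub>R (u - s))"
      using ev
    proof eventually_elim
      case (elim u)
      then obtain \<tau> where \<tau>: "\<bar>\<tau> - t\<bar> < d" "c u = \<gamma> i \<tau>" using \<eta>(2) by blast
      define w where "w = \<gamma> i \<tau> - \<gamma> i t"
      have w: "norm (w - (\<tau> - t) *\<^sub>R a) \<le> e1 * \<bar>\<tau> - t\<bar>" using d(2)[OF \<tau>(1)] by (simp add: w_def)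
      have "\<bar>\<tau> - t\<bar> * norm a \<le> norm w + e1 * \<bar>\<tau> - t\<bar>"
        using w norm_triangle_ineq3[of w "(\<tau> - t) *\<^sub>R a"] by simp
      also have "\<dots> \<le> norm w + norm a / 2 * \<bar>\<tau> - t\<bar>"
        using mult_right_mono[OF e1(2), of "\<bar>\<tau> - t\<bar>"] by simp
      also have "\<dots> = norm w + (\<bar>\<tau> - t\<bar> * norm a) / 2" by simp
      finally have w2: "\<bar>\<tau> - t\<bar> * norm a \<le> 2 * norm w" by linarith
      \<comment> \<open>Subtracting a real multiple of \<open>a\<close> does not change the normal
        component, since \<open>cnj a * a\<close> is real; what remains is the error of the linear
        approximation.\<close>
      have "Im (cnj a * w) = Im (cnj a * (w - (\<tau> - t) *\<^sub>R a))"
        by (simp add: algebra_simps)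
      also have "\<bar>\<dots>\<bar> \<le> norm (cnj a * (w - (\<tau> - t) *\<^sub>R a))" by (rule abs_Im_le_cmod)
      also have "\<dots> \<le> norm a * (e1 * \<bar>\<tau> - t\<bar>)"
        unfolding norm_mult complex_mod_cnj by (intro mult_left_mono w) auto
      also have "\<dots> \<le> e1 * (2 * norm w)"
        using mult_left_mono[OF w2, of e1] e1(1) by (simp add: mult_ac)
      also have "\<dots> \<le> e * norm w" using mult_right_mono[OF e1(3), of "norm w"] by simp
      finally have main: "\<bar>Im (cnj a * w)\<bar> \<le> e * norm w" .
      have cu: "c u - c s = w" using \<tau> c(3) x' w_def by simp
      have "Im (cnj a * ((c u - c s) /\<^sub>R (u - s))) = inverse (u - s) * Im (cnj a * w)"
        unfolding cu by (simp add: algebra_simps)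
      then show ?case
        using mult_left_mono[OF main, of "\<bar>inverse (u - s)\<bar>"] unfolding cu
        by (simp add: abs_mult mult_ac)
    qed
    moreover
    have q: "((\<lambda>u. (c u - c s) /\<^sub>R (u - s)) \<longlongrightarrow> c') (at s)"
      by (rule tendsto_slope[OF c(1)])
    have "((\<lambda>u. \<bar>Im (cnj a * ((c u - c s) /\<^sub>R (u - s)))\<bar>) \<longlongrightarrow> \<bar>Im (cnj a * c')\<bar>) (at s)"
      "((\<lambda>u. e * norm ((c u - c s) /\<^sub>R (u - s))) \<longlongrightarrow> e * norm c') (at s)"
      by (intro tendsto_intros q)+
    ultimately show ?thesis
      using tendsto_le[of "at s"] by simp
  qed
  have "\<bar>Im (cnj a * c')\<bar> \<le> 0"
  proof (rule field_le_epsilon)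
    fix \<epsilon> :: real assume "0 < \<epsilon>"
    then have "0 < \<epsilon> / norm c'" using c(2) by simp
    from bound[OF this] show "\<bar>Im (cnj a * c')\<bar> \<le> 0 + \<epsilon>" using c(2) by simp
  qed
  then have "Im (cnj a * c') = 0" by simp
  from sgn_parallel[OF this a(1) c(2)] show ?thesis
    by (simp only: pdir_def dir_def a_def i_def t_def)
qed

section \<open>Arrows on a free strand\<close>

lemma arrows_ok_mono: "arrows_ok n \<gamma> A \<Longrightarrow> A' \<subseteq> A \<Longrightarrow> arrows_ok n \<gamma> A'"
  unfolding arrows_ok_def by (meson finite_subset inj_on_subset subsetD)

lemma arrow_diagram_subset:
  assumes "arrow_diagram D" "A \<subseteq> arrows D"
  shows "arrow_diagram (D\<lparr>arrows := A\<rparr>)"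
proof -
  obtain n \<gamma> U where P: "parametrizes n \<gamma> U D" and A: "arrows_ok n \<gamma> (arrows D)"
    using assms(1) arrow_diagram_iff by blast
  have "parametrizes n \<gamma> U (D\<lparr>arrows := A\<rparr>)" by (rule parametrizes_cong[OF P]) simp_all
  moreover have "arrows_ok n \<gamma> (arrows (D\<lparr>arrows := A\<rparr>))" using arrows_ok_mono[OF A assms(2)] by simp
  ultimately show ?thesis using arrow_diagram_iff by blast
qed

lemma embedded_pathD:
  assumes "embedded_path c"
  shows "t \<in> {0..1} \<Longrightarrow> (c has_vector_derivative vector_derivative c (at t)) (at t)"
    "t \<in> {0..1} \<Longrightarrow> vector_derivative c (at t) \<noteq> 0"
    "inj_on c {0..1}" "continuous_on {0..1} c"
    "continuous_on {0..1} (\<lambda>t. vector_derivative c (at t))"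
proof -
  have d: "\<forall>x\<in>{0..1}. c differentiable at x"
    using assms by (simp add: embedded_path_def immersed_path_def C1_differentiable_on_eq)
  then show "t \<in> {0..1} \<Longrightarrow> (c has_vector_derivative vector_derivative c (at t)) (at t)"
    by (simp add: vector_derivative_works)
  show "continuous_on {0..1} c"
    using d by (meson continuous_at_imp_continuous_on differentiable_imp_continuous_within)
qed (use assms in \<open>auto simp: embedded_path_def immersed_path_def C1_differentiable_on_eq\<close>)

text \<open>The path \<open>c\<close> comes from a move and has no given relation to
  \<open>\<gamma>\<close>; tangency turns its direction into one of the two directions that
  \<open>arrow_diagram\<close> admits at that point.\<close>

lemma arrow_on_strand:
  assumes P: "parametrizes n \<gamma> U D" and c: "embedded_path c" "path_image c \<subseteq> shadow D"
    and s: "0 < s" "s < 1" "c s \<notin> crossings D"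
  shows "\<exists>x \<in> params n - double_params n \<gamma>. c s = pos \<gamma> x \<and> (dir c s = pdir \<gamma> x \<or> dir c s = - pdir \<gamma> x)"
proof -
  have cs: "c u \<in> shadow D" if "u \<in> {0<..<1}" for u
  proof -
    have "c u \<in> path_image c" using that by (auto simp: path_image_def)
    then show ?thesis using c(2) by blast
  qed
  have "s \<in> {0<..<1}" using s by simp
  from cs[OF this] obtain x where x: "x \<in> params n" "c s = pos \<gamma> x"
    unfolding parametrizesD(2)[OF P] by blast
  have x': "x \<in> params n - double_params n \<gamma>"
    using x s(3) unfolding crossings_eq[OF P] by auto
  have "\<forall>\<^sub>F u in at s. u \<in> {0<..<1}"
    by (rule eventually_at_in_open') (use s in auto)
  then have ev: "\<forall>\<^sub>F u in at s. c u \<in> shadow D"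
    by eventually_elim (rule cs)
  have "s \<in> {0..1}" using s by simp
  from tangent_to_strand[OF P x' embedded_pathD(1)[OF c(1) this] embedded_pathD(2)[OF c(1) this] x(2) ev]
  show ?thesis using x' x(2) unfolding dir_def by blast
qed

section \<open>Signed decorations of a strand\<close>

definition put :: "(real \<Rightarrow> complex) \<Rightarrow> (real \<times> int) set \<Rightarrow> (complex \<times> complex) set" where
  "put c S = (\<lambda>(t, e). (c t, of_int e * dir c t)) ` S"

definition decorate :: "diagram \<Rightarrow> (real \<Rightarrow> complex) \<Rightarrow> (real \<times> int) set \<Rightarrow> diagram" where
  "decorate D c S = D\<lparr>arrows := arrows D \<union> put c S\<rparr>"

text \<open>A sign is relative to the direction of the strand. The parameters stay off the ends so
  that an arrow-free subpath around neighbouring arrows always exists, and no two arrows share a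
  place.\<close>

definition signed :: "(real \<times> int) set \<Rightarrow> bool" where
  "signed S \<longleftrightarrow> finite S \<and> S \<subseteq> {0<..<1} \<times> {1, -1} \<and> inj_on fst S"

text \<open>Arrows of \<open>D\<close> at the two end points of \<open>c\<close> are allowed: the
  path of a k-move may end at arrows, and only those in its interior are rewritten as
  decorations.\<close>

definition free_strand :: "diagram \<Rightarrow> (real \<Rightarrow> complex) \<Rightarrow> bool" where
  "free_strand D c \<longleftrightarrow> arrow_diagram D \<and> embedded_path c \<and> path_image c \<subseteq> shadow D \<and>
     path_image c \<inter> crossings D = {} \<and> c ` {0<..<1} \<inter> arrow_points D = {}"

lemma decorate_simps [simp]:
  "shadow (decorate D c S) = shadow D" "overs (decorate D c S) = overs D"
  "crossings (decorate D c S) = crossings D" "arrows (decorate D c S) = arrows D \<union> put c S"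
  by (simp_all add: decorate_def crossings_def)

lemma fst_put: "fst ` put c S = c ` fst ` S"
  by (force simp: put_def image_iff)

lemma arrow_points_decorate: "arrow_points (decorate D c S) = arrow_points D \<union> c ` fst ` S"
  by (simp add: arrow_points_def image_Un fst_put)

lemma put_Un: "put c (S \<union> S') = put c S \<union> put c S'"
  by (simp add: put_def image_Un)

lemma put_insert: "put c (insert (t, e) S) = insert (c t, of_int e * dir c t) (put c S)"
  by (simp add: put_def)

lemma put_uniform: "put c (T \<times> {e}) = (\<lambda>t. (c t, of_int e * dir c t)) ` T"
  by (force simp: put_def image_iff)

lemma signed_subset: "signed S \<Longrightarrow> S' \<subseteq> S \<Longrightarrow> signed S'"
  unfolding signed_def by (meson finite_subset inj_on_subset subset_trans)

lemma signed_fst: "signed S \<Longrightarrow> fst ` S \<subseteq> {0<..<1}"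
  by (fastforce simp: signed_def)

lemma signed_uniform:
  "finite T \<Longrightarrow> T \<subseteq> {0<..<1} \<Longrightarrow> e \<in> {1, -1} \<Longrightarrow> signed (T \<times> {e})"
  by (auto simp: signed_def inj_on_def)

lemma sum_snd_uniform: "sum snd (T \<times> {e::int}) = int (card T) * e"
proof -
  have "T \<times> {e} = (\<lambda>t. (t, e)) ` T" by auto
  then have "sum snd (T \<times> {e}) = (\<Sum>t\<in>T. e)"
    by (simp add: sum.reindex inj_on_def)
  then show ?thesis by simp
qed

lemma arrows_ok_put:
  assumes P: "parametrizes n \<gamma> U D" and A: "arrows_ok n \<gamma> A" and c: "embedded_path c" "path_image c \<subseteq> shadow D"
    and cr: "path_image c \<inter> crossings D = {}" and S: "signed S" and dis: "c ` fst ` S \<inter> fst ` A = {}"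
  shows "arrows_ok n \<gamma> (A \<union> put c S)"
  unfolding arrows_ok_def
proof (intro conjI)
  have S': "finite S" "S \<subseteq> {0<..<1} \<times> {1, -1}" "inj_on fst S"
    using S by (auto simp: signed_def)
  show "finite (A \<union> put c S)"
    using A S'(1) by (simp add: arrows_ok_def put_def)
  have i1: "inj_on c (fst ` S)"
    using embedded_pathD(3)[OF c(1)] signed_fst[OF S] by (rule inj_on_subset[OF _ order_trans]) auto
  have "inj_on fst (put c S)"
  proof (rule inj_onI)
    fix p q assume "p \<in> put c S" "q \<in> put c S" and eq: "fst p = fst q"
    then obtain x y where xy: "x \<in> S" "y \<in> S" "p = (c (fst x), of_int (snd x) * dir c (fst x))"
      "q = (c (fst y), of_int (snd y) * dir c (fst y))"
      unfolding put_def by (auto split: prod.splits)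
    then have "fst x = fst y" using eq inj_onD[OF i1, of "fst x" "fst y"] by auto
    then have "x = y" using S'(3) xy(1,2) by (meson inj_onD)
    then show "p = q" using xy by simp
  qed
  then show "inj_on fst (A \<union> put c S)"
    using A dis unfolding inj_on_Un arrows_ok_def fst_put[symmetric] by blast
  show "\<forall>(q, u)\<in>A \<union> put c S. \<exists>x\<in>params n - double_params n \<gamma>.
           q = pos \<gamma> x \<and> u \<in> {pdir \<gamma> x, - pdir \<gamma> x}"
  proof (intro ballI, clarify)
    fix q u assume qu: "(q, u) \<in> A \<union> put c S"
    show "\<exists>x\<in>params n - double_params n \<gamma>. q = pos \<gamma> x \<and> u \<in> {pdir \<gamma> x, - pdir \<gamma> x}"
    proof (cases "(q, u) \<in> A")
      case True
      then show ?thesis using A unfolding arrows_ok_def by blast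
    next
      case False
      then obtain t e where te: "(t, e) \<in> S" "q = c t" "u = of_int e * dir c t"
        using qu unfolding put_def by auto
      then have t: "0 < t" "t < 1" "e = 1 \<or> e = -1" using S'(2) by auto
      have "c t \<in> path_image c" using t unfolding path_image_def by (intro imageI) simp
      then have "c t \<notin> crossings D" using cr by blast
      from arrow_on_strand[OF P c t(1,2) this] obtain x where
        x: "x \<in> params n - double_params n \<gamma>" "c t = pos \<gamma> x" "dir c t = pdir \<gamma> x \<or> dir c t = - pdir \<gamma> x"
        by blast
      have "u \<in> {pdir \<gamma> x, - pdir \<gamma> x}" using te(3) t(3) x(3) by auto
      then show ?thesis using x te(2) by blast
    qed
  qed
qed

lemma decorate_diagram:
  assumes F: "free_strand D c" and S: "signed S"
  shows "arrow_diagram (decorate D c S)"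
proof -
  have F': "arrow_diagram D" "embedded_path c" "path_image c \<subseteq> shadow D"
     "path_image c \<inter> crossings D = {}" "c ` {0<..<1} \<inter> arrow_points D = {}"
    using F by (auto simp: free_strand_def)
  obtain n \<gamma> U where P: "parametrizes n \<gamma> U D" and A: "arrows_ok n \<gamma> (arrows D)"
    using F'(1) arrow_diagram_iff by blast
  have "c ` fst ` S \<inter> fst ` arrows D = {}"
    using F'(5) signed_fst[OF S] unfolding arrow_points_def by blast
  from arrows_ok_put[OF P A F'(2-4) S this]
  have "arrows_ok n \<gamma> (arrows (decorate D c S))" by simp
  moreover have "parametrizes n \<gamma> U (decorate D c S)"
    by (rule parametrizes_cong[OF P]) simp_all
  ultimately show ?thesis using arrow_diagram_iff by blast
qed

lemma has_vector_derivative_affine: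
  assumes "(c has_vector_derivative c') (at (p + m * x))"
  shows "((\<lambda>x. c (p + m * x)) has_vector_derivative m *\<^sub>R c') (at (x::real))"
proof -
  have "((\<lambda>x. p + m * x) has_vector_derivative m) (at x)"
    by (auto intro!: derivative_eq_intros simp flip: has_real_derivative_iff_has_vector_derivative)
  from vector_diff_chain_at[OF this assms] show ?thesis by (simp add: o_def)
qed

text \<open>One statement serves subpaths, arcs of circles and reversed strands; on directions the
  only effect is the sign of \<open>m\<close>.\<close>

lemma embedded_affine:
  fixes c :: "real \<Rightarrow> complex"
  assumes d: "\<And>t. t \<in> S \<Longrightarrow> (c has_vector_derivative c' t) (at t)" "continuous_on S c'" "\<And>t. t \<in> S \<Longrightarrow> c' t \<noteq> 0"
    and "inj_on c S" and S: "\<And>x. x \<in> {0..1} \<Longrightarrow> p + m * x \<in> S" and "m \<noteq> 0"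
  shows "embedded_path (\<lambda>x. c (p + m * x))"
    "x \<in> {0..1} \<Longrightarrow> dir (\<lambda>x. c (p + m * x)) x = of_real (sgn m) * dir c (p + m * x)"
proof -
  have D: "((\<lambda>x. c (p + m * x)) has_vector_derivative m *\<^sub>R c' (p + m * x)) (at x)" if "x \<in> {0..1}" for x
    by (rule has_vector_derivative_affine) (rule d(1)[OF S[OF that]])
  have "continuous_on {0..1} (\<lambda>x. c' (p + m * x))"
    by (rule continuous_on_compose2[OF d(2)]) (use S in \<open>auto intro!: continuous_intros\<close>)
  then have "(\<lambda>x. c (p + m * x)) C1_differentiable_on {0..1}"
    unfolding C1_differentiable_on_def using D
    by (intro exI[of _ "\<lambda>x. m *\<^sub>R c' (p + m * x)"]) (auto intro!: continuous_intros)
  moreover have "vector_derivative (\<lambda>x. c (p + m * x)) (at x) \<noteq> 0" if "x \<in> {0..1}" for x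
    using vector_derivative_at[OF D[OF that]] d(3)[OF S[OF that]] \<open>m \<noteq> 0\<close> by simp
  moreover have "inj_on (\<lambda>x. c (p + m * x)) {0..1}"
  proof (rule inj_onI)
    fix x y :: real assume "x \<in> {0..1}" "y \<in> {0..1}" "c (p + m * x) = c (p + m * y)"
    then have "p + m * x = p + m * y" using S \<open>inj_on c S\<close> by (meson inj_onD)
    then show "x = y" using \<open>m \<noteq> 0\<close> by simp
  qed
  ultimately show "embedded_path (\<lambda>x. c (p + m * x))"
    by (simp add: embedded_path_def immersed_path_def)
  show "dir (\<lambda>x. c (p + m * x)) x = of_real (sgn m) * dir c (p + m * x)" if "x \<in> {0..1}"
    unfolding dir_def vector_derivative_at[OF D[OF that]] vector_derivative_at[OF d(1)[OF S[OF that]]]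
    by (simp only: sgn_scaleR) (simp only: scaleR_conv_of_real)
qed

lemma embedded_subpath:
  assumes c: "embedded_path c" and ab: "0 \<le> a" "a < b" "b \<le> 1"
  shows "embedded_path (\<lambda>x. c (a + (b - a) * x))"
    "x \<in> {0..1} \<Longrightarrow> dir (\<lambda>x. c (a + (b - a) * x)) x = dir c (a + (b - a) * x)"
    "path_image (\<lambda>x. c (a + (b - a) * x)) = c ` {a..b}"
proof -
  have S: "a + (b - a) * x \<in> {0..1}" if "x \<in> {0..1}" for x
  proof -
    have "0 \<le> (b - a) * x"
      using that ab by simp
    moreover have "a + (b - a) * x \<le> a + (b - a) * 1"
      using that ab by (intro add_left_mono mult_left_mono) auto
    ultimately have "0 \<le> a + (b - a) * x" "a + (b - a) * x \<le> 1" using ab by simp_all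
    then show ?thesis by simp
  qed
  note E = embedded_affine[OF embedded_pathD(1)[OF c] embedded_pathD(5)[OF c] embedded_pathD(2)[OF c]
      embedded_pathD(3)[OF c] S]
  show "embedded_path (\<lambda>x. c (a + (b - a) * x))"
    using E(1) ab by simp
  show "dir (\<lambda>x. c (a + (b - a) * x)) x = dir c (a + (b - a) * x)" if "x \<in> {0..1}"
    using E(2)[of x] that ab by simp
  have "(\<lambda>x. a + (b - a) * x) ` {0..1} = {a..b}"
    using ab image_affinity_atLeastAtMost[of "b - a" a 0 1] by (simp add: add.commute)
  then show "path_image (\<lambda>x. c (a + (b - a) * x)) = c ` {a..b}"
    unfolding path_image_def by (metis image_image)
qed

lemma room_below:
  fixes s :: real
  assumes "finite F" "\<forall>u\<in>F. u < s" "l < s"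
  shows "\<exists>a. l < a \<and> a < s \<and> (\<forall>u\<in>F. u < a)"
proof -
  define m where "m = Max (insert l F)"
  have "m < s" "l \<le> m" "\<forall>u\<in>F. u \<le> m" using assms by (auto simp: m_def)
  then show ?thesis by (intro exI[of _ "(m + s) / 2"]) (auto simp: field_simps intro: le_less_trans)
qed

lemma room_above:
  fixes s :: real
  assumes "finite F" "\<forall>u\<in>F. s < u" "s < h"
  shows "\<exists>b. s < b \<and> b < h \<and> (\<forall>u\<in>F. b < u)"
proof -
  define m where "m = Min (insert h F)"
  have "s < m" "m \<le> h" "\<forall>u\<in>F. m \<le> u" using assms by (auto simp: m_def)
  then show ?thesis by (intro exI[of _ "(m + s) / 2"]) (auto simp: field_simps intro: less_le_trans)
qed

text \<open>By \<open>gap\<close> no decoration lies between the two new arrows, and finiteness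
  leaves room on both sides. Hence \<open>c\<close> restricted to a slightly larger interval
  \<open>{a..b}\<close> is the arrow-free path that \<open>Omega4\<close> asks for.\<close>

lemma Omega4_decorate:
  assumes F: "free_strand D c" and S: "signed (insert (s, e) (insert (t, - e) S))" and "s < t"
    and gap: "\<And>u f. (u, f) \<in> S \<Longrightarrow> u < s \<or> t < u"
  shows "Omega4 (decorate D c S) (decorate D c (insert (s, e) (insert (t, - e) S)))"
proof -
  have F': "arrow_diagram D" "embedded_path c" "path_image c \<subseteq> shadow D"
     "path_image c \<inter> crossings D = {}" "c ` {0<..<1} \<inter> arrow_points D = {}"
    using F by (auto simp: free_strand_def)
  have S0: "signed S" by (rule signed_subset[OF S]) auto
  have st: "0 < s" "t < 1" "e = 1 \<or> e = -1" using S by (auto simp: signed_def)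
  have fin: "finite (fst ` S)" using S0 by (simp add: signed_def)
  obtain a where a: "0 < a" "a < s" "\<forall>u\<in>{u \<in> fst ` S. u < s}. u < a"
  proof -
    have "finite {u \<in> fst ` S. u < s}" "\<forall>u\<in>{u \<in> fst ` S. u < s}. u < s" using fin by auto
    from room_below[OF this st(1)] show ?thesis using that by blast
  qed
  obtain b where b: "t < b" "b < 1" "\<forall>u\<in>{u \<in> fst ` S. t < u}. b < u"
  proof -
    have "finite {u \<in> fst ` S. t < u}" "\<forall>u\<in>{u \<in> fst ` S. t < u}. t < u" using fin by auto
    from room_above[OF this st(2)] show ?thesis using that by blast
  qed
  have gap': "fst ` S \<inter> {a..b} = {}"
  proof (rule ccontr)
    assume "fst ` S \<inter> {a..b} \<noteq> {}"
    then obtain u f where u: "(u, f) \<in> S" "a \<le> u" "u \<le> b" by force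
    then have "u \<in> fst ` S" by force
    then show False using gap[OF u(1)] a(3) b(3) u(2,3) by force
  qed
  define g where "g = (\<lambda>x. c (a + (b - a) * x))"
  have ab: "0 \<le> a" "a < b" "b \<le> 1" using a b \<open>s < t\<close> by auto
  note E = embedded_subpath[OF F'(2) ab, folded g_def]
  define \<sigma> \<tau> where "\<sigma> = (s - a) / (b - a)" and "\<tau> = (t - a) / (b - a)"
  have \<sigma>\<tau>: "0 < \<sigma>" "\<sigma> < \<tau>" "\<tau> < 1" "a + (b - a) * \<sigma> = s" "a + (b - a) * \<tau> = t"
    using a(2) b(1) \<open>s < t\<close> ab(2) by (simp_all add: \<sigma>_def \<tau>_def divide_strict_right_mono)
  have g: "g \<sigma> = c s" "g \<tau> = c t" "dir g \<sigma> = dir c s" "dir g \<tau> = dir c t"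
    using \<sigma>\<tau> E(2)[of \<sigma>] E(2)[of \<tau>] by (simp_all add: g_def)
  have sub: "c ` {a..b} \<subseteq> path_image c" "c ` {a..b} \<subseteq> c ` {0<..<1}"
    unfolding path_image_def by (rule image_mono; use a(1) b(2) in auto)+
  have "c ` {a..b} \<inter> c ` fst ` S = c ` ({a..b} \<inter> fst ` S)"
    by (rule inj_on_image_Int[OF embedded_pathD(3)[OF F'(2)], symmetric])
      (use ab signed_fst[OF S0] in auto)
  then have dis: "c ` {a..b} \<inter> arrow_points (decorate D c S) = {}"
  proof -
    have "{a..b} \<inter> fst ` S = {}" using gap' by (simp add: Int_commute)
    with \<open>c ` {a..b} \<inter> c ` fst ` S = c ` ({a..b} \<inter> fst ` S)\<close>
    have "c ` {a..b} \<inter> c ` fst ` S = {}" by simp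
    moreover have "c ` {a..b} \<inter> arrow_points D = {}" using sub(2) F'(5) by (meson disjoint_iff subsetD)
    ultimately show ?thesis unfolding arrow_points_decorate by (simp add: Int_Un_distrib)
  qed
  show ?thesis
    unfolding Omega4_def
  proof (intro conjI exI)
    show "arrow_diagram (decorate D c S)" "arrow_diagram (decorate D c (insert (s, e) (insert (t, - e) S)))"
      using decorate_diagram[OF F S0] decorate_diagram[OF F S] by blast+
    show "embedded_path g" by (rule E(1))
    show "path_image g \<subseteq> shadow (decorate D c S)" "path_image g \<inter> crossings (decorate D c S) = {}"
      using sub(1) F'(3,4) unfolding E(3) decorate_simps by blast+
    show "path_image g \<inter> arrow_points (decorate D c S) = {}" using E(3) dis by simp
    show "(of_int e :: complex) \<in> {1, -1}" using st(3) by auto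
    show "arrows (decorate D c (insert (s, e) (insert (t, - e) S))) =
      arrows (decorate D c S) \<union> {(g \<sigma>, of_int e * dir g \<sigma>), (g \<tau>, - of_int e * dir g \<tau>)}"
      unfolding decorate_simps put_insert g by auto
  qed (use \<sigma>\<tau> in simp_all)
qed

section \<open>Sliding and cancelling arrows with Omega4-moves\<close>

lemma equiv_move: "m \<in> M \<Longrightarrow> m D D' \<Longrightarrow> equivclp (step M) D D'"
  by (rule r_into_equivclp) (auto simp: step_def)

context
  fixes M :: "move set" and D :: diagram and c :: "real \<Rightarrow> complex"
  assumes M4: "Omega4 \<in> M" and F: "free_strand D c"
begin

abbreviation equiv_dec (infix "~~" 50) where
  "S ~~ S' \<equiv> equivclp (step M) (decorate D c S) (decorate D c S')"

text \<open>Both sides arise from the same alternating triple with signs \<open>e\<close>,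
  \<open>- e\<close>, \<open>e\<close>: cancelling its right pair leaves the arrow at
  \<open>s\<close>, cancelling its left pair leaves the one at \<open>t\<close>.\<close>

lemma shift_arrow:
  assumes S: "signed (insert (s, e) S)" "signed (insert (t, e) S)" and "s < t"
    and gap: "\<And>u f. (u, f) \<in> S \<Longrightarrow> u < s \<or> t < u"
  shows "insert (s, e) S ~~ insert (t, e) S"
proof -
  define w where "w = (s + t) / 2"
  have w: "s < w" "w < t" using \<open>s < t\<close> by (auto simp: w_def)
  define X where "X = insert (s, e) (insert (w, - e) (insert (t, e) S))"
  have b: "0 < s" "t < 1" "e = 1 \<or> e = -1" "finite S" "S \<subseteq> {0<..<1} \<times> {1, -1}"
    "inj_on fst S"
    using S by (auto simp: signed_def)
  have ne: "\<forall>x\<in>S. fst x \<noteq> s \<and> fst x \<noteq> t \<and> fst x \<noteq> w"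
    using gap w \<open>s < t\<close> by (metis order_less_irrefl order_less_trans prod.collapse)
  have X: "signed X"
    unfolding X_def signed_def
  proof (intro conjI)
    show "finite (insert (s, e) (insert (w, - e) (insert (t, e) S)))" using b by simp
    show "insert (s, e) (insert (w, - e) (insert (t, e) S)) \<subseteq> {0<..<1} \<times> {1, - 1}"
      using b w by auto
    show "inj_on fst (insert (s, e) (insert (w, - e) (insert (t, e) S)))"
      using b(6) ne w by (simp add: inj_on_insert) (use w in force)
  qed
  have X1: "X = insert (w, - e) (insert (t, - (- e)) (insert (s, e) S))"
    and X2: "X = insert (s, e) (insert (w, - e) (insert (t, e) S))"
    unfolding X_def by auto
  have "Omega4 (decorate D c (insert (s, e) S)) (decorate D c X)"
    unfolding X1
  proof (rule Omega4_decorate[OF F _ w(2)])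
    show "signed (insert (w, - e) (insert (t, - (- e)) (insert (s, e) S)))" using X unfolding X1 .
    show "u < w \<or> t < u" if "(u, f) \<in> insert (s, e) S" for u f
      using that gap[of u f] w by auto
  qed
  moreover have "Omega4 (decorate D c (insert (t, e) S)) (decorate D c X)"
    unfolding X2
  proof (rule Omega4_decorate[OF F _ w(1)])
    show "signed (insert (s, e) (insert (w, - e) (insert (t, e) S)))" using X unfolding X2 .
    show "u < s \<or> w < u" if "(u, f) \<in> insert (t, e) S" for u f
      using that gap[of u f] w by auto
  qed
  ultimately show ?thesis
    by (rule equivclp_trans[OF equiv_move[OF M4] equivclp_sym[OF equiv_move[OF M4]]])
qed

lemma shift_uniform:
  assumes "finite T" "finite T'" "card T = card T'" "T \<subseteq> {0<..<b}" "T' \<subseteq> {0<..<b}" "b \<le> 1"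
    "signed S" "fst ` S \<subseteq> {b..<1}" "e = 1 \<or> e = -1"
  shows "T \<times> {e} \<union> S ~~ T' \<times> {e} \<union> S"
  using assms
proof (induction "card T" arbitrary: T T' b S)
  case 0
  then show ?case by simp
next
  case (Suc n)
  have ne: "T \<noteq> {}" "T' \<noteq> {}" using Suc.hyps(2) Suc.prems(3) by auto
  have fin: "finite (T \<union> T')" "\<forall>u\<in>T \<union> T'. u < b" "0 < b"
    using Suc.prems ne by auto
  obtain p where p: "0 < p" "p < b" "\<forall>u\<in>T \<union> T'. u < p"
    using room_below[OF fin] by blast
  have move: "Y \<times> {e} \<union> S ~~ (Y - {Max Y}) \<times> {e} \<union> insert (p, e) S"
    "Y - {Max Y} \<subseteq> {0<..<p}" "card (Y - {Max Y}) = n"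
    if Y: "Y = T \<or> Y = T'" for Y
  proof -
    define m where "m = Max Y"
    have Y': "finite Y" "Y \<noteq> {}" "Y \<subseteq> {0<..<b}" "card Y = Suc n" "\<forall>u\<in>Y. u < p"
      using Y Suc.prems Suc.hyps(2) ne p by auto
    then have m: "m \<in> Y" "\<forall>u\<in>Y. u \<le> m" by (auto simp: m_def)
    define R where "R = (Y - {m}) \<times> {e} \<union> S"
    have 1: "Y \<times> {e} \<union> S = insert (m, e) R" using m by (auto simp: R_def)
    have 2: "(Y - {m}) \<times> {e} \<union> insert (p, e) S = insert (p, e) R" by (auto simp: R_def)
    have inS: "inj_on fst S" "S \<subseteq> {0<..<1} \<times> {1, -1}" "finite S" using Suc.prems(7) by (auto simp: signed_def)
    have S_b: "b \<le> u" if "(u, f) \<in> S" for u f using Suc.prems(8) that by force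
    have sg: "signed (insert (q, e) R)" if q: "q = m \<or> q = p" for q
      unfolding signed_def
    proof (intro conjI)
      show "finite (insert (q, e) R)" using Y' inS by (simp add: R_def)
      have "0 < q" "q < 1" using q m(1) Y'(3) p Suc.prems(6) by auto
      moreover have "Y \<subseteq> {0<..<1}" using Y'(3) Suc.prems(6) by auto
      ultimately show "insert (q, e) R \<subseteq> {0<..<1} \<times> {1, -1}"
        using Suc.prems(9) inS(2) unfolding R_def by auto
      have "q < b" using q m(1) Y'(3) p by auto
      have neq: "fst x \<noteq> q" if "x \<in> R" for x
        using that \<open>q < b\<close> S_b[of "fst x" "snd x"] q m(2) Y'(5) unfolding R_def by auto
      have "inj_on fst R"
        unfolding R_def
      proof (subst inj_on_Un, intro conjI)
        show "inj_on fst ((Y - {m}) \<times> {e})" by (auto simp: inj_on_def)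
        have "fst ` ((Y - {m}) \<times> {e}) \<subseteq> {..<b}" using Y'(3) by auto
        moreover have "fst ` S \<subseteq> {b..}" using Suc.prems(8) by auto
        ultimately have "fst ` ((Y - {m}) \<times> {e}) \<inter> fst ` S = {}" by (force simp: subset_iff)
        then show "fst ` ((Y - {m}) \<times> {e} - S) \<inter> fst ` (S - (Y - {m}) \<times> {e}) = {}" by blast
      qed (rule inS(1))
      then show "inj_on fst (insert (q, e) R)"
        using neq by (force simp: inj_on_insert)
    qed
    have "insert (m, e) R ~~ insert (p, e) R"
    proof (rule shift_arrow[OF sg sg])
      show "m < p" using m Y' by auto
      show "u < m \<or> p < u" if "(u, f) \<in> R" for u f
        using that S_b[of u f] p(2) m(2) unfolding R_def by force
    qed simp_all
    then show "Y \<times> {e} \<union> S ~~ (Y - {Max Y}) \<times> {e} \<union> insert (p, e) S"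
      using 1 2 m_def by simp
    show "card (Y - {Max Y}) = n" using Y' m by (simp add: m_def)
    show "Y - {Max Y} \<subseteq> {0<..<p}" using Y' by auto
  qed
  have S': "signed (insert (p, e) S)"
    using Suc.prems(6-9) p unfolding signed_def by (force simp: inj_on_insert)
  have mid: "(T - {Max T}) \<times> {e} \<union> insert (p, e) S ~~ (T' - {Max T'}) \<times> {e} \<union> insert (p, e) S"
    by (rule Suc.hyps(1)[where b = p])
      (use move[of T] move[of T'] Suc.prems S' p in auto)
  show ?case
    by (rule equivclp_trans[OF equivclp_trans[OF move(1) mid] equivclp_sym[OF move(1)]]) simp_all
qed

text \<open>As long as both signs occur, an opposite pair at minimal distance consists of neighbours
  and can be removed; the signed sum is unchanged and the number of arrows drops.\<close>

lemma cancel_arrows: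
  assumes "signed S"
  shows "\<exists>S' e. signed S' \<and> snd ` S' \<subseteq> {e} \<and> sum snd S' = sum snd S \<and> S ~~ S'"
  using assms
proof (induction "card S" arbitrary: S rule: less_induct)
  case less
  show ?case
  proof (cases "\<exists>e. snd ` S \<subseteq> {e}")
    case True
    then obtain e where "snd ` S \<subseteq> {e}" by blast
    then show ?thesis using less.prems
      by (intro exI[of _ S] exI[of _ e] conjI refl equivclp_refl)
  next
    case False
    have S: "finite S" "S \<subseteq> {0<..<1} \<times> {1, -1}" "inj_on fst S"
      using less.prems by (auto simp: signed_def)
    define P where "P = {(x, y). x \<in> S \<and> y \<in> S \<and> snd x \<noteq> snd y \<and> fst x < fst y}"
    have "finite P" by (rule finite_subset[of _ "S \<times> S"]) (use S(1) in \<open>auto simp: P_def\<close>)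
    obtain x y where "x \<in> S" "y \<in> S" "snd x \<noteq> snd y"
    proof -
      have "S \<noteq> {}" using False by auto
      then obtain z where z: "z \<in> S" by blast
      then obtain z' where "z' \<in> S" "snd z' \<noteq> snd z" using False by blast
      then show ?thesis using that z by metis
    qed
    moreover from this have "fst x \<noteq> fst y" using S(3) by (metis inj_onD)
    ultimately have "(x, y) \<in> P \<or> (y, x) \<in> P" by (auto simp: P_def)
    then have "P \<noteq> {}" by blast
    define gp where "gp r = fst (snd r) - fst (fst r)" for r :: "(real \<times> int) \<times> (real \<times> int)"
    have "Min (gp ` P) \<in> gp ` P" using \<open>finite P\<close> \<open>P \<noteq> {}\<close> by (intro Min_in) auto
    then obtain q where "q \<in> P" "gp q = Min (gp ` P)" by (metis imageE)
    then have q: "q \<in> P" "\<forall>r\<in>P. gp q \<le> gp r" using \<open>finite P\<close> by auto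
    obtain s e t e' where se: "q = ((s, e), (t, e'))" by (cases q) auto
    have st: "(s, e) \<in> S" "(t, e') \<in> S" "e \<noteq> e'" "s < t"
      using q(1) se by (auto simp: P_def)
    have "e \<in> {1, -1}" "e' \<in> {1, -1}" using st(1,2) S(2) by blast+
    then have e': "e' = - e" using st(3) by auto
    define S0 where "S0 = S - {(s, e), (t, e')}"
    have Seq: "S = insert (s, e) (insert (t, - e) S0)" using st e' by (auto simp: S0_def)
    \<comment> \<open>An arrow in between differs in sign from one of the two and would form a
      closer opposite pair with it.\<close>
    have gap: "u < s \<or> t < u" if "(u, h) \<in> S0" for u h
    proof (rule ccontr)
      assume "\<not> (u < s \<or> t < u)"
      moreover have uS: "(u, h) \<in> S" "(u, h) \<noteq> (s, e)" "(u, h) \<noteq> (t, e')" using that by (auto simp: S0_def)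
      moreover have "u \<noteq> s" "u \<noteq> t"
        using inj_onD[OF S(3), of "(u, h)" "(s, e)"] inj_onD[OF S(3), of "(u, h)" "(t, e')"] uS st by auto
      ultimately have u: "s < u" "u < t" by auto
      show False
      proof (cases "h = e")
        case True
        then have "((u, h), (t, e')) \<in> P" using uS st u by (simp add: P_def)
        from q(2)[rule_format, OF this] show False using u by (simp add: se gp_def)
      next
        case False
        then have "((s, e), (u, h)) \<in> P" using uS st u by (simp add: P_def)
        from q(2)[rule_format, OF this] show False using u by (simp add: se gp_def)
      qed
    qed
    have S0: "signed S0" using signed_subset[OF less.prems] by (simp add: S0_def)
    have "Omega4 (decorate D c S0) (decorate D c S)"
      unfolding Seq
    proof (rule Omega4_decorate[OF F _ st(4)])
      show "signed (insert (s, e) (insert (t, - e) S0))" using less.prems unfolding Seq .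
    qed (rule gap)
    then have 1: "S ~~ S0" using equiv_move[OF M4] equivclp_sym by metis
    have "card S0 < card S" unfolding S0_def by (rule psubset_card_mono) (use S(1) st in auto)
    from less.hyps[OF this S0] obtain S' d where
      S': "signed S'" "snd ` S' \<subseteq> {d}" "sum snd S' = sum snd S0" "S0 ~~ S'" by blast
    have "(s, e) \<notin> insert (t, - e) S0" "(t, - e) \<notin> S0" "finite S0"
      using st e' S(1) by (auto simp: S0_def)
    then have "sum snd S = sum snd S0" unfolding Seq by simp
    then show ?thesis using S' equivclp_trans[OF 1 S'(4)] by metis
  qed
qed

lemma uniform_eq:
  assumes "signed S" "snd ` S \<subseteq> {e}"
  shows "S = fst ` S \<times> {e}" "card (fst ` S) = card S"
  using assms by (force simp: signed_def image_iff card_image)+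

text \<open>The signed sum is a complete invariant: after cancellation it determines the common sign
  and the number of arrows, unless there are none, and sliding matches the positions.\<close>

lemma decorate_equiv:
  assumes "signed S" "signed S'" "sum snd S = sum snd S'"
  shows "S ~~ S'"
proof -
  obtain R e where R: "signed R" "snd ` R \<subseteq> {e}" "sum snd R = sum snd S" "S ~~ R"
    using cancel_arrows[OF assms(1)] by blast
  obtain R' e' where R': "signed R'" "snd ` R' \<subseteq> {e'}" "sum snd R' = sum snd S'" "S' ~~ R'"
    using cancel_arrows[OF assms(2)] by blast
  have "R ~~ R'"
  proof (cases "R = {} \<or> R' = {}")
    case True
    \<comment> \<open>An empty set has no definite sign. If one side is empty, the product of
      cardinality and sign vanishes on the other side too; signs of actual arrows are nonzero, so
      that side is empty as well.\<close>
    have "int (card (fst ` R)) * e = int (card (fst ` R')) * e'"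
      using sum_snd_uniform[of "fst ` R" e] sum_snd_uniform[of "fst ` R'" e'] uniform_eq(1)[OF R(1,2)]
        uniform_eq(1)[OF R'(1,2)] R(3) R'(3) assms(3) by simp
    then have z: "int (card R) * e = int (card R') * e'"
      using uniform_eq(2)[OF R(1,2)] uniform_eq(2)[OF R'(1,2)] by simp
    have ne: "e \<noteq> 0" if "R \<noteq> {}" using that R(1,2) unfolding signed_def by fastforce
    have ne': "e' \<noteq> 0" if "R' \<noteq> {}" using that R'(1,2) unfolding signed_def by fastforce
    have "finite R" "finite R'" using R(1) R'(1) by (auto simp: signed_def)
    then have "R = {} \<and> R' = {}" using True z ne ne' by (cases "R = {}"; cases "R' = {}") (simp_all add: card_eq_0_iff)
    then show ?thesis by simp
  next
    case False
    have e: "e = 1 \<or> e = -1" "e' = 1 \<or> e' = -1"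
      using False R(1,2) R'(1,2) unfolding signed_def by fastforce+
    have fin: "finite (fst ` R)" "finite (fst ` R')" using R(1) R'(1) by (auto simp: signed_def)
    have pos: "0 < card (fst ` R)" "0 < card (fst ` R')" using False fin by (auto simp: card_gt_0_iff)
    have "int (card (fst ` R)) * e = int (card (fst ` R')) * e'"
      using sum_snd_uniform[of "fst ` R" e] sum_snd_uniform[of "fst ` R'" e'] uniform_eq(1)[OF R(1,2)]
        uniform_eq(1)[OF R'(1,2)] R(3) R'(3) assms(3) by simp
    then have "e = e'" "card (fst ` R) = card (fst ` R')" using e pos by auto
    then have "fst ` R \<times> {e} \<union> {} ~~ fst ` R' \<times> {e} \<union> {}"
      using fin e signed_fst[OF R(1)] signed_fst[OF R'(1)]
      by (intro shift_uniform[where b = 1]) (auto simp: signed_def)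
    then show ?thesis using uniform_eq(1)[OF R(1,2)] uniform_eq(1)[OF R'(1,2)] \<open>e = e'\<close> by simp
  qed
  then show ?thesis using R(4) R'(4) equivclp_sym equivclp_trans by metis
qed

end

section \<open>Prescribed totals, k-moves and Omega_inf-moves on a decorated strand\<close>

lemma many_points:
  fixes a b :: real
  assumes "finite F" "a < b"
  shows "\<exists>T. finite T \<and> card T = n \<and> T \<subseteq> {a<..<b} - F"
proof -
  have "infinite ({a<..<b} - F)" using assms by (simp add: infinite_Ioo)
  then show ?thesis using infinite_arbitrarily_large by blast
qed

text \<open>Unlike \<open>sgn\<close> this is a legal arrow sign at 0 too, where it agrees with the
  case \<open>p \<ge> 0\<close> in \<open>Omega_inf\<close>.\<close>

definition int_sign :: "int \<Rightarrow> int" where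
  "int_sign p = (if p \<ge> 0 then 1 else -1)"

lemma signed_of_sum:
  assumes "finite F" "0 \<le> a" "a < b" "b \<le> 1"
  shows "\<exists>T. finite T \<and> card T = nat \<bar>p\<bar> \<and> T \<subseteq> {a<..<b} - F \<and> signed (T \<times> {int_sign p}) \<and>
    sum snd (T \<times> {int_sign p}) = p"
proof -
  obtain T where T: "finite T" "card T = nat \<bar>p\<bar>" "T \<subseteq> {a<..<b} - F"
    using many_points[OF assms(1,3)] by blast
  then have "signed (T \<times> {int_sign p})"
    using assms by (intro signed_uniform) (auto simp: int_sign_def)
  moreover have "sum snd (T \<times> {int_sign p}) = p"
    unfolding sum_snd_uniform T(2) by (simp add: int_sign_def)
  ultimately show ?thesis using T by blast
qed

text \<open>A \<open>k_move\<close> permits arrows already present between the new ones, so the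
  whole path \<open>c\<close> can be taken as its strand whatever \<open>S\<close> is.\<close>

lemma k_move_decorate:
  assumes F: "free_strand D c" and "finite T" "card T = k" "T \<subseteq> {0<..<1}" "T \<inter> fst ` S = {}" "signed S"
  shows "k_move k (decorate D c S) (decorate D c (S \<union> T \<times> {1}))" "signed (S \<union> T \<times> {1})"
proof -
  have F': "arrow_diagram D" "embedded_path c" "path_image c \<subseteq> shadow D"
     "path_image c \<inter> crossings D = {}" "c ` {0<..<1} \<inter> arrow_points D = {}"
    using F by (auto simp: free_strand_def)
  have S: "finite S" "S \<subseteq> {0<..<1} \<times> {1, -1}" "inj_on fst S" using assms(6) by (auto simp: signed_def)
  have "fst ` (T \<times> {1::int}) = T" by force
  then have "inj_on fst (S \<union> T \<times> {1})"
    using assms(5) S(3) by (subst inj_on_Un) (force simp: inj_on_def image_iff)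
  then show sg: "signed (S \<union> T \<times> {1})"
    using S assms(2,4) unfolding signed_def by auto
  have "c ` T \<inter> c ` fst ` S = c ` (T \<inter> fst ` S)"
    by (rule inj_on_image_Int[OF embedded_pathD(3)[OF F'(2)], symmetric])
      (use assms(4) signed_fst[OF assms(6)] in auto)
  then have dis: "c ` T \<inter> arrow_points (decorate D c S) = {}"
  proof -
    have "c ` T \<inter> c ` fst ` S = {}"
      using \<open>c ` T \<inter> c ` fst ` S = c ` (T \<inter> fst ` S)\<close> assms(5) by simp
    moreover have "c ` T \<inter> arrow_points D = {}" using F'(5) assms(4) by blast
    ultimately show ?thesis unfolding arrow_points_decorate by (simp add: Int_Un_distrib)
  qed
  show "k_move k (decorate D c S) (decorate D c (S \<union> T \<times> {1}))"
    unfolding k_move_def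
    by (intro conjI exI[of _ c] exI[of _ T])
      (use decorate_diagram[OF F] sg assms F' dis in \<open>simp_all add: put_Un put_uniform Un_assoc\<close>)
qed

text \<open>For \<open>b \<ge> 0\<close> add \<open>k\<close> arrows \<open>b\<close> times and
  adjust with \<open>decorate_equiv\<close>; for negative \<open>b\<close> exchange the roles of
  \<open>S\<close> and \<open>S'\<close>, as the generated relation is symmetric.\<close>

lemma decorate_mod:
  assumes M: "Omega4 \<in> M" "k_move k \<in> M" and F: "free_strand D c"
    and "signed S" "signed S'" "sum snd S' = sum snd S + int k * b"
  shows "equivclp (step M) (decorate D c S) (decorate D c S')"
proof -
  let ?R = "\<lambda>S S'. equivclp (step M) (decorate D c S) (decorate D c S')"
  have nat: "?R S S'" if "signed S" "signed S'" "sum snd S' = sum snd S + int k * int m" for S S' m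
    using that
  proof (induction m arbitrary: S)
    case 0
    then show ?case by (intro decorate_equiv[OF M(1) F]) simp_all
  next
    case (Suc m)
    have finS: "finite (fst ` S)" using Suc.prems by (simp add: signed_def)
    obtain T where T: "finite T" "card T = k" "T \<subseteq> {0<..<1} - fst ` S"
      using many_points[OF finS zero_less_one] by blast
    have T': "T \<subseteq> {0<..<1}" "T \<inter> fst ` S = {}" using T(3) by auto
    note K = k_move_decorate[OF F T(1,2) T' Suc.prems(1)]
    have "S \<inter> T \<times> {1} = {}" using T'(2) by force
    then have "sum snd (S \<union> T \<times> {1}) = sum snd S + int k"
      using Suc.prems(1) T(1,2) by (subst sum.union_disjoint) (auto simp: signed_def sum_snd_uniform)
    then have "?R (S \<union> T \<times> {1}) S'"
      using Suc.prems K(2) by (intro Suc.IH) (auto simp: algebra_simps)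
    then show ?case using equiv_move[OF M(2) K(1)] equivclp_trans by metis
  qed
  show ?thesis
  proof (cases "b \<ge> 0")
    case True
    then show ?thesis using nat[OF assms(4,5), of "nat b"] assms(6) by simp
  next
    case False
    then have "sum snd S = sum snd S' + int k * int (nat (- b))" using assms(6) by simp
    then show ?thesis using nat[OF assms(5,4)] equivclp_sym by metis
  qed
qed

lemma arrow_points_subset: "arrow_diagram D \<Longrightarrow> arrow_points D \<subseteq> shadow D"
  unfolding arrow_diagram_iff arrow_points_def arrows_ok_def by (fastforce dest: parametrizesD(2))

lemma crossings_subset: "arrow_diagram D \<Longrightarrow> crossings D \<subseteq> shadow D"
  unfolding arrow_diagram_iff using crossings_eq parametrizesD(2) double_params_def by fastforce

text \<open>Separates the geometry of the move from its number of arrows: \<open>D0\<close> is the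
  target without the new arrows, \<open>h\<close> is a free strand of it, and the same pair of arcs
  supports an Omega_inf-move for every integer \<open>q\<close>.\<close>

lemma Omega_inf_decorate:
  assumes "Omega_inf p D D'"
  obtains D0 h S where "free_strand D0 h" "signed S" "sum snd S = p" "D' = decorate D0 h S"
    "\<And>q. \<exists>S. signed S \<and> sum snd S = q \<and> Omega_inf q D (decorate D0 h S)"
proof -
  obtain Z g h T where ad: "arrow_diagram D" "arrow_diagram D'" "overs D' = overs D"
    and gh: "embedded_path g" "embedded_path h" "same_ends g h"
      "shadow D = Z \<union> path_image g" "shadow D' = Z \<union> path_image h"
      "Z \<inter> path_image g = {pathstart g, pathfinish g}"
      "Z \<inter> path_image h = {pathstart g, pathfinish g}"
      "path_image g \<inter> path_image h = {pathstart g, pathfinish g}"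
      "path_image g \<inter> crossings D = {}" "path_image g \<inter> arrow_points D = {}"
      "Z - {pathstart g, pathfinish g} \<subseteq> inside (path_image g \<union> path_image h)"
      "\<forall>z \<in> inside (path_image g \<union> path_image h). winding_number (h +++ reversepath g) z = -1"
    and T: "T \<subseteq> {0<..<1}" "finite T" "card T = nat \<bar>p\<bar>"
      "arrows D' = arrows D \<union> (\<lambda>t. (h t, if p \<ge> 0 then dir h t else - dir h t)) ` T"
    using assms unfolding Omega_inf_def by (elim conjE exE) (rule that; assumption)
  define D0 where "D0 = D'\<lparr>arrows := arrows D\<rparr>"
  have D0: "shadow D0 = shadow D'" "overs D0 = overs D'" "arrows D0 = arrows D"
    "crossings D0 = crossings D" "arrow_points D0 = arrow_points D"
    using ad(3) by (auto simp: D0_def crossings_def arrow_points_def)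
  have ends: "path_image h \<inter> shadow D = {pathstart g, pathfinish g}" using gh(4,7,8) by blast
  have F: "free_strand D0 h"
    unfolding free_strand_def D0
  proof (intro conjI)
    show "arrow_diagram D0" unfolding D0_def by (rule arrow_diagram_subset[OF ad(2)]) (use T in auto)
    show "path_image h \<inter> crossings D = {}"
      using ends crossings_subset[OF ad(1)] gh(6,9) by blast
    have "h ` {0<..<1} \<inter> {h 0, h 1} = {}"
      using embedded_pathD(3)[OF gh(2)] by (auto dest: inj_onD)
    then have "h ` {0<..<1} \<inter> {pathstart g, pathfinish g} = {}"
      using gh(3) by (simp add: same_ends_def pathstart_def pathfinish_def)
    moreover have "h ` {0<..<1} \<subseteq> path_image h" by (auto simp: path_image_def)
    ultimately show "h ` {0<..<1} \<inter> arrow_points D = {}"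
      using ends arrow_points_subset[OF ad(1)] by blast
  qed (use gh in auto)
  have arr: "arrows D \<union> (\<lambda>t. (h t, if q \<ge> 0 then dir h t else - dir h t)) ` T =
     arrows (decorate D0 h (T \<times> {int_sign q}))" for q T
    by (auto simp: D0 put_uniform int_sign_def)
  show ?thesis
  proof (rule that[OF F])
    show "signed (T \<times> {int_sign p})" using T by (intro signed_uniform) (auto simp: int_sign_def)
    show "sum snd (T \<times> {int_sign p}) = p" unfolding sum_snd_uniform T(3) by (simp add: int_sign_def)
    show "D' = decorate D0 h (T \<times> {int_sign p})"
      using T(4)[unfolded arr] D0 by (simp add: decorate_def D0_def)
    show "\<exists>S. signed S \<and> sum snd S = q \<and> Omega_inf q D (decorate D0 h S)" for q
    proof -
      obtain T where T: "finite T" "card T = nat \<bar>q\<bar>" "T \<subseteq> {0<..<1} - {}" "signed (T \<times> {int_sign q})"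
        "sum snd (T \<times> {int_sign q}) = q"
        using signed_of_sum[of "{}" 0 1 q] by auto
      have "Omega_inf q D (decorate D0 h (T \<times> {int_sign q}))"
        unfolding Omega_inf_def
      proof (intro conjI exI)
        show "arrow_diagram (decorate D0 h (T \<times> {int_sign q}))" by (rule decorate_diagram[OF F T(4)])
        show "arrows (decorate D0 h (T \<times> {int_sign q})) =
          arrows D \<union> (\<lambda>t. (h t, if q \<ge> 0 then dir h t else - dir h t)) ` T"
          by (rule arr[symmetric])
        show "shadow (decorate D0 h (T \<times> {int_sign q})) = Z \<union> path_image h"
          using D0 gh by simp
        show "overs (decorate D0 h (T \<times> {int_sign q})) = overs D" using D0 ad by simp
        show "T \<subseteq> {0<..<1}" using T by simp
      qed (fact ad gh T)+
      then show ?thesis using T by blast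
    qed
  qed
qed

text \<open>The same arc is attached with \<open>a\<close> arrows, and k-moves on it change the
  signed sum by \<open>k * b\<close>.\<close>

lemma generates_Omega_inf:
  assumes "Omega4 \<in> M" "k_move k \<in> M" "Omega_inf a \<in> M"
  shows "generates M (Omega_inf (a + int k * b))"
  unfolding generates_def
proof (intro allI impI)
  fix D D' assume "Omega_inf (a + int k * b) D D'"
  then obtain D0 h S where S: "free_strand D0 h" "signed S" "sum snd S = a + int k * b" "D' = decorate D0 h S"
    "\<And>q. \<exists>S. signed S \<and> sum snd S = q \<and> Omega_inf q D (decorate D0 h S)"
    by (rule Omega_inf_decorate) metis
  obtain S1 where S1: "signed S1" "sum snd S1 = a" "Omega_inf a D (decorate D0 h S1)" using S(5) by blast
  have "equivclp (step M) (decorate D0 h S1) (decorate D0 h S)"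
    by (rule decorate_mod[OF assms(1,2) S(1) S1(1) S(2), of b]) (use S1(2) S(3) in simp)
  then show "equivclp (step M) D D'"
    using equivclp_trans[OF equiv_move[OF assms(3) S1(3)]] S(4) by simp
qed

section \<open>An arc around everything\<close>

text \<open>Provides the angle on the part of the new arc at constant radius, where it has to fit
  both legs with its derivative. A cubic with given end values and slopes need not be monotone, so a
  positive derivative \<open>\<psi>\<close> on the unit interval is prescribed and
  integrated.\<close>

lemma monotone_Hermite:
  fixes x0 x1 y0 y1 m0 m1 :: real
  assumes "x0 < x1" "y1 < y0" "m0 < 0" "m1 < 0"
  obtains \<beta> \<beta>' where "\<And>x. (\<beta> has_real_derivative \<beta>' x) (at x)" "continuous_on UNIV \<beta>'"
    "\<And>x. x \<in> {x0..x1} \<Longrightarrow> \<beta>' x < 0" "\<beta> x0 = y0" "\<beta> x1 = y1" "\<beta>' x0 = m0" "\<beta>' x1 = m1"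
proof -
  define l D p q where "l = x1 - x0" and "D = y1 - y0" and "p = m0 * l / D" and "q = m1 * l / D"
  have l: "0 < l" "D < 0" using assms by (auto simp: l_def D_def)
  have pq: "0 < p" "0 < q" unfolding p_def q_def using l assms by (auto intro!: divide_neg_neg mult_neg_pos)
  \<comment> \<open>A large exponent confines the boundary terms to the ends: they contribute
    \<open>(p + q) / (n + 1)\<close> to the integral of \<open>\<psi>\<close>, which is then below
    1.\<close>
  obtain n :: nat where n: "p + q + 1 < real n" using reals_Archimedean2 by blast
  then have n2: "2 \<le> n" using pq by linarith
  then have z: "(0::real) ^ n = 0" by simp
  \<comment> \<open>The solution of \<open>(p + q) / (n + 1) + c * (n - 1) / (n + 1) = 1\<close>,
    that is of \<open>\<Psi> 1 = 1\<close>.\<close>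
  define c where "c = (real n + 1 - p - q) / (real n - 1)"
  have c: "0 < c" using n n2 pq unfolding c_def by (intro divide_pos_pos) linarith+
  define \<psi> where "\<psi> t = p * (1 - t) ^ n + q * t ^ n + c * (1 - (1 - t) ^ n - t ^ n)" for t :: real
  define \<Psi> where "\<Psi> t = p * ((1 - (1 - t) ^ Suc n) / Suc n) + q * (t ^ Suc n / Suc n)
    + c * (t - (1 - (1 - t) ^ Suc n) / Suc n - t ^ Suc n / Suc n)" for t :: real
  have D\<Psi>: "(\<Psi> has_real_derivative \<psi> t) (at t)" for t
  proof -
    have 1: "((\<lambda>t. (1 - (1 - t) ^ Suc n) / Suc n) has_real_derivative (1 - t) ^ n) (at t)"
      by (rule derivative_eq_intros refl | simp)+
    have 2: "((\<lambda>t. t ^ Suc n / Suc n) has_real_derivative t ^ n) (at t)"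
      by (rule derivative_eq_intros refl | simp)+
    show ?thesis
      unfolding \<Psi>_def \<psi>_def
      by (rule DERIV_add DERIV_cmult DERIV_diff DERIV_ident 1 2)+
  qed
  have \<psi>: "0 < \<psi> t" if "0 \<le> t" "t \<le> 1" for t
  proof -
    have le: "(1 - t) ^ n \<le> 1 - t" "t ^ n \<le> t"
      using that n2 power_decreasing[of 1 n "1 - t"] power_decreasing[of 1 n t] by auto
    have "0 < p * (1 - t) ^ n + q * t ^ n"
    proof (cases "t = 0")
      case True
      then show ?thesis using pq by (simp add: z)
    next
      case False
      then have "0 < q * t ^ n" "0 \<le> p * (1 - t) ^ n" using that pq by auto
      then show ?thesis by linarith
    qed
    moreover have "0 \<le> c * (1 - (1 - t) ^ n - t ^ n)" using c le by simp
    ultimately show ?thesis unfolding \<psi>_def by linarith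
  qed
  have \<Psi>1: "\<Psi> 1 = 1"
  proof -
    have "c * (real n - 1) = real n + 1 - p - q" using n2 unfolding c_def by simp
    then have N: "p + q + c * (real (Suc n) - 2) = real (Suc n)" "real (Suc n) \<noteq> 0" by (simp_all add: algebra_simps)
    have "\<Psi> 1 = p * (1 / real (Suc n)) + q * (1 / real (Suc n)) + c * (1 - 1 / real (Suc n) - 1 / real (Suc n))"
      unfolding \<Psi>_def by simp
    also have "\<dots> = (p + q + c * (real (Suc n) - 2)) / real (Suc n)"
      using N(2) by (simp only: divide_inverse algebra_simps) simp
    finally show ?thesis using N by simp
  qed
  define \<beta> where "\<beta> x = y0 + D * \<Psi> ((x - x0) / l)" for x
  define \<beta>' where "\<beta>' x = D * (\<psi> ((x - x0) / l) * (1 / l))" for x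
  show ?thesis
  proof
    show "(\<beta> has_real_derivative \<beta>' x) (at x)" for x
    proof -
      have "((\<lambda>x. (x - x0) / l) has_real_derivative 1 / l) (at x)"
        by (rule DERIV_cong[OF DERIV_cdivide[OF DERIV_diff[OF DERIV_ident DERIV_const]]]) simp
      from DERIV_chain2[OF D\<Psi> this]
      have "((\<lambda>x. \<Psi> ((x - x0) / l)) has_real_derivative \<psi> ((x - x0) / l) * (1 / l)) (at x)" .
      from DERIV_add[OF DERIV_const DERIV_cmult[OF this]]
      show ?thesis unfolding \<beta>_def \<beta>'_def by simp
    qed
    show "continuous_on UNIV \<beta>'"
      unfolding \<beta>'_def \<psi>_def using l by (intro continuous_intros) auto
    show "\<beta>' x < 0" if "x \<in> {x0..x1}" for x
    proof -
      have "0 \<le> (x - x0) / l" "(x - x0) / l \<le> 1" using that l by (auto simp: l_def)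
      from \<psi>[OF this] show ?thesis unfolding \<beta>'_def using l by (intro mult_neg_pos mult_pos_pos) simp_all
    qed
    show "\<beta> x0 = y0" by (simp add: \<beta>_def \<Psi>_def)
    show "\<beta> x1 = y1" using l \<Psi>1 by (simp add: \<beta>_def l_def D_def)
    show "\<beta>' x0 = m0" using l by (simp add: z \<beta>'_def \<psi>_def p_def)
    show "\<beta>' x1 = m1" using l by (simp add: z \<beta>'_def \<psi>_def q_def l_def)
  qed
qed

text \<open>The difference is \<open>y - x\<close> times a second factor equal to \<open>2 * x * (1
  - x) + 2 * y * (1 - y) + x * (1 - y) + y * (1 - x)\<close>, whose last term is positive.
  Strictness is what lets \<open>eta\<close> separate the points of a leg.\<close>

lemma smoothstep_less:
  fixes x y :: real
  assumes "0 \<le> x" "x < y" "y \<le> 1"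
  shows "3 * x\<^sup>2 - 2 * x ^ 3 < 3 * y\<^sup>2 - 2 * y ^ 3"
proof -
  have "x * x \<le> x * 1" "y * y \<le> y * 1" using assms by (intro mult_left_mono; simp)+
  moreover have "0 \<le> x * (1 - y)" "0 < y * (1 - x)" using assms by auto
  ultimately have "0 < 3 * (x + y) - 2 * (x * x + x * y + y * y)" by (simp add: algebra_simps)
  then have "0 < (y - x) * (3 * (x + y) - 2 * (x * x + x * y + y * y))" using assms by simp
  then show ?thesis by (simp add: algebra_simps power2_eq_square power3_eq_cube)
qed

text \<open>With derivatives taken within closed intervals, the conclusion has the shape of the
  hypotheses, so three pieces are joined by two applications.\<close>

lemma has_vector_derivative_join:
  fixes f g :: "real \<Rightarrow> complex"
  assumes f: "\<And>x. x \<in> {a..b} \<Longrightarrow> (f has_vector_derivative f' x) (at x within {a..b})" "continuous_on {a..b} f'"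
    and g: "\<And>x. x \<in> {b..c} \<Longrightarrow> (g has_vector_derivative g' x) (at x within {b..c})" "continuous_on {b..c} g'"
    and m: "f b = g b" "f' b = g' b" and "a \<le> b" "b \<le> c"
  shows "x \<in> {a..c} \<Longrightarrow> ((\<lambda>x. if x \<le> b then f x else g x) has_vector_derivative
      (if x \<le> b then f' x else g' x)) (at x within {a..c})"
    "continuous_on {a..c} (\<lambda>x. if x \<le> b then f' x else g' x)"
proof -
  have U: "{a..c} = {a..b} \<union> {b..c}" using assms by auto
  have I: "closure {a..b} \<inter> closure {b..c} = {b}" using assms by auto
  show "continuous_on {a..c} (\<lambda>x. if x \<le> b then f' x else g' x)"
    unfolding U by (rule continuous_on_If) (use f g m assms in auto)
  assume x: "x \<in> {a..c}"
  have "((\<lambda>x. if x \<in> {a..b} then f x else g x) has_vector_derivative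
      (if x \<in> {a..b} then f' x else g' x)) (at x within {a..c})"
  proof (rule has_vector_derivative_If_within_closures[OF _ U])
    show "x \<in> {a..b} \<union> {b..c}" using x U by simp
    have e: "{a..b} \<union> {b} = {a..b}" "{b..c} \<union> {b} = {b..c}" using assms by auto
    show "(f has_vector_derivative f' x) (at x within {a..b} \<union> (closure {a..b} \<inter> closure {b..c}))"
      if "x \<in> {a..b} \<union> (closure {a..b} \<inter> closure {b..c})"
      using f(1) that unfolding I e by simp
    show "(g has_vector_derivative g' x) (at x within {b..c} \<union> (closure {a..b} \<inter> closure {b..c}))"
      if "x \<in> {b..c} \<union> (closure {a..b} \<inter> closure {b..c})"
      using g(1) that unfolding I e by simp
    show "f x = g x" "f' x = g' x" if "x \<in> closure {a..b}" "x \<in> closure {b..c}"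
      using that I m by auto
  qed
  moreover have "(if x \<in> {a..b} then f' x else g' x) = (if x \<le> b then f' x else g' x)" using x by auto
  ultimately have D: "((\<lambda>x. if x \<in> {a..b} then f x else g x) has_vector_derivative
      (if x \<le> b then f' x else g' x)) (at x within {a..c})" by simp
  show "((\<lambda>x. if x \<le> b then f x else g x) has_vector_derivative
      (if x \<le> b then f' x else g' x)) (at x within {a..c})"
    by (rule has_vector_derivative_transform[OF x _ D]) auto
qed

lemma exp_eq_window:
  assumes "exp p = exp q" "\<bar>Im p - Im q\<bar> < 2 * pi"
  shows "p = q"
  using assms exp_complex_eqI[of p q] by simp

text \<open>
  Logarithmic coordinates \<open>q0 + exp p\<close> about a centre \<open>q0\<close>: the strand is \<open>L\<close>, crossing the ray in
  direction \<open>\<theta>\<close> counterclockwise, and \<open>Z\<close> is the rest of the diagram.  The new arc leaves the strand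
  at parameter \<open>-\<delta>\<close>, climbs to radius \<open>exp A\<close> on one side of the ray, runs clockwise around
  everything, and comes down on the other side to parameter \<open>\<delta>\<close>.
\<close>

locale arch =
  fixes q0 :: complex and \<theta> A lo \<kappa> \<delta> \<delta>1 :: real and L L' :: "real \<Rightarrow> complex"
    and Z :: "complex set" and \<beta> \<beta>' :: "real \<Rightarrow> real"
  assumes \<delta>: "0 < \<delta>" "\<delta> \<le> \<delta>1"
    and DL: "u \<in> {-\<delta>1..\<delta>1} \<Longrightarrow> (L has_vector_derivative L' u) (at u)"
    and CL: "continuous_on {-\<delta>1..\<delta>1} L'"
    and Im_L': "u \<in> {-\<delta>1..\<delta>1} \<Longrightarrow> 0 < Im (L' u)"
    and L0: "Im (L 0) = \<theta>"
    and angle: "u \<in> {-\<delta>1..\<delta>1} \<Longrightarrow> \<bar>Im (L u) - \<theta>\<bar> < pi / 2"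
    and Re_L: "u \<in> {-\<delta>1..\<delta>1} \<Longrightarrow> Re (L u) < A"
    and low: "u \<in> {-\<delta>..\<delta>} \<Longrightarrow> lo \<le> Re (L u)" "u \<in> {-\<delta>..\<delta>} \<Longrightarrow> \<bar>Im (L u) - \<theta>\<bar> \<le> \<kappa>"
    and Z_A: "z \<in> Z \<Longrightarrow> norm (z - q0) < exp A"
    and sector: "lo \<le> Re p \<Longrightarrow> \<bar>Im p - \<theta>\<bar> \<le> \<kappa> \<Longrightarrow> q0 + exp p \<notin> Z"
    and D\<beta>: "(\<beta> has_real_derivative \<beta>' x) (at x)" and C\<beta>: "continuous_on UNIV \<beta>'"
    and \<beta>'_neg: "x \<in> {-\<delta>/2..\<delta>/2} \<Longrightarrow> \<beta>' x < 0"
    and \<beta>_ends: "\<beta> (-\<delta>/2) = Im (L (-\<delta>))" "\<beta> (\<delta>/2) = Im (L \<delta>) - 2 * pi"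
      "\<beta>' (-\<delta>/2) = - Im (L' (-\<delta>))" "\<beta>' (\<delta>/2) = - Im (L' \<delta>)"
begin

section \<open>The lift of the new arc in logarithmic coordinates\<close>

definition E :: "complex \<Rightarrow> complex" where "E p = q0 + exp p"
definition X :: "real \<Rightarrow> real" where "X u = (u + \<delta>) / (\<delta> / 2)"
text \<open>\<open>X\<close> rescales the first quarter of the parameter interval to
  \<open>{0..1}\<close>. Over it the strand parameter \<open>tau\<close> leaves
  \<open>- \<delta>\<close> with speed 1, turns at \<open>X u = 1/2\<close> and is back with speed
  -1, while \<open>eta\<close>, the cubic smoothstep, has speed 0 at both ends. So a leg leaves
  tangent to the strand and arrives at radius \<open>exp A\<close> with purely angular velocity in
  the reverse sense.\<close>

definition tau :: "real \<Rightarrow> real" where "tau u = - \<delta> + (\<delta> / 2) * (X u * (1 - X u))"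
definition tau' :: "real \<Rightarrow> real" where "tau' u = 1 - 2 * X u"
definition eta :: "real \<Rightarrow> real" where "eta u = 3 * (X u)\<^sup>2 - 2 * (X u) ^ 3"
definition eta' :: "real \<Rightarrow> real" where "eta' u = 6 * (X u * (1 - X u)) / (\<delta> / 2)"

text \<open>The angle is that of the strand at \<open>tau u\<close>; the logarithmic radius is moved
  from that of the strand to \<open>A\<close>. The strand is a variable because the second leg uses
  the reversed strand.\<close>

definition leg :: "(real \<Rightarrow> complex) \<Rightarrow> real \<Rightarrow> complex" where
  "leg M u = Complex ((1 - eta u) * Re (M (tau u)) + eta u * A) (Im (M (tau u)))"

definition leg' :: "(real \<Rightarrow> complex) \<Rightarrow> (real \<Rightarrow> complex) \<Rightarrow> real \<Rightarrow> complex" where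
  "leg' M M' u = Complex ((1 - eta u) * (tau' u * Re (M' (tau u))) + eta' u * (A - Re (M (tau u))))
     (tau' u * Im (M' (tau u)))"

lemma X_range: "u \<in> {-\<delta>..-\<delta>/2} \<Longrightarrow> 0 \<le> X u \<and> X u \<le> 1"
  using \<delta> by (auto simp: X_def field_simps)

lemma X_ends: "X (-\<delta>) = 0" "X (-\<delta>/2) = 1"
  using \<delta> by (auto simp: X_def field_simps)

lemma X_inj: "X u = X v \<Longrightarrow> u = v"
  using \<delta> by (auto simp: X_def)

text \<open>Already \<open>X u * (1 - X u) \<le> 1\<close> gives
  \<open>tau u \<le> - \<delta> / 2\<close>, so the leg stays strictly on its side of the ray, which
  the strand crosses at parameter 0.\<close>

lemma tau_range: assumes "u \<in> {-\<delta>..-\<delta>/2}" shows "-\<delta> \<le> tau u" "tau u < 0"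
proof -
  define x where "x = X u"
  have x: "0 \<le> x" "x \<le> 1" using X_range[OF assms] by (auto simp: x_def)
  have "0 \<le> (\<delta> / 2) * (x * (1 - x))" using x \<delta> by simp
  then show "-\<delta> \<le> tau u" by (simp add: tau_def x_def)
  have "x * (1 - x) \<le> 1 * 1" using x by (intro mult_mono) auto
  then have "(\<delta> / 2) * (x * (1 - x)) \<le> (\<delta> / 2) * (1 * 1)" using \<delta> by (intro mult_left_mono) auto
  then show "tau u < 0" using \<delta> unfolding tau_def x_def by linarith
qed

lemma eta_range: assumes "u \<in> {-\<delta>..-\<delta>/2}" shows "0 \<le> eta u" "eta u \<le> 1" "eta u = 0 \<Longrightarrow> u = -\<delta>"
proof -
  define x where "x = X u"
  have x: "0 \<le> x" "x \<le> 1" using X_range[OF assms] by (auto simp: x_def)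
  have e: "eta u = 3 * x\<^sup>2 - 2 * x ^ 3" by (simp add: eta_def x_def)
  have pos: "0 < eta u" if "x \<noteq> 0" using smoothstep_less[of 0 x] x that e by simp
  show "0 \<le> eta u" using pos e by (cases "x = 0") auto
  show "eta u \<le> 1" using smoothstep_less[of x 1] x e by (cases "x = 1") auto
  show "u = -\<delta>" if "eta u = 0"
  proof -
    have "x = 0" using pos that by force
    then show ?thesis using X_ends(1) X_inj x_def by metis
  qed
qed

lemma eta_inj: assumes "u \<in> {-\<delta>..-\<delta>/2}" "v \<in> {-\<delta>..-\<delta>/2}" "eta u = eta v" shows "u = v"
proof -
  have "X u = X v"
    using smoothstep_less[of "X u" "X v"] smoothstep_less[of "X v" "X u"] X_range[OF assms(1)] X_range[OF assms(2)] assms(3)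
    unfolding eta_def by (metis linorder_neqE_linordered_idom order_less_irrefl)
  then show ?thesis by (rule X_inj)
qed

lemma D_leg:
  assumes u: "u \<in> {-\<delta>..-\<delta>/2}" and M: "(M has_vector_derivative M' (tau u)) (at (tau u))"
  shows "(leg M has_vector_derivative leg' M M' u) (at u)"
proof -
  have DX: "(X has_real_derivative 2 / \<delta>) (at u)"
    unfolding X_def using \<delta> by (auto intro!: derivative_eq_intros)
  have Dt: "(tau has_real_derivative tau' u) (at u)"
    unfolding tau_def by (rule derivative_eq_intros DX refl | simp)+ (use \<delta> in \<open>simp add: tau'_def field_simps\<close>)
  have De: "(eta has_real_derivative eta' u) (at u)"
    unfolding eta_def by (rule derivative_eq_intros DX refl | simp)+
      (use \<delta> in \<open>simp add: eta'_def field_simps power2_eq_square\<close>)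
  from vector_diff_chain_at[OF Dt[unfolded has_real_derivative_iff_has_vector_derivative] M]
  have "((\<lambda>u. M (tau u)) has_vector_derivative tau' u *\<^sub>R M' (tau u)) (at u)" by (simp add: o_def)
  then have R: "((\<lambda>u. Re (M (tau u))) has_real_derivative tau' u * Re (M' (tau u))) (at u)"
    and I: "((\<lambda>u. Im (M (tau u))) has_real_derivative tau' u * Im (M' (tau u))) (at u)"
    unfolding has_vector_derivative_complex_iff by simp_all
  have "((\<lambda>u. (1 - eta u) * Re (M (tau u)) + eta u * A) has_real_derivative
     (1 - eta u) * (tau' u * Re (M' (tau u))) + eta' u * (A - Re (M (tau u)))) (at u)"
    by (rule derivative_eq_intros R De refl | simp)+ (simp add: algebra_simps)
  with I show ?thesis
    unfolding has_vector_derivative_complex_iff leg_def leg'_def by simp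
qed

lemma C_leg:
  assumes M: "\<And>u. u \<in> {-\<delta>..0} \<Longrightarrow> (M has_vector_derivative M' u) (at u)" "continuous_on {-\<delta>..0} M'"
  shows "continuous_on {-\<delta>..-\<delta>/2} (leg' M M')"
proof -
  have cX: "continuous_on S X" for S unfolding X_def using \<delta> by (intro continuous_intros) auto
  have ct: "continuous_on S tau" "continuous_on S tau'" "continuous_on S eta" "continuous_on S eta'" for S
    unfolding tau_def tau'_def eta_def eta'_def using \<delta> by (intro continuous_intros cX; simp)+
  have sub: "tau ` {-\<delta>..-\<delta>/2} \<subseteq> {-\<delta>..0}" using tau_range by (auto simp: less_imp_le)
  have "continuous_on {-\<delta>..0} M"
    using M(1) by (meson continuous_at_imp_continuous_on has_vector_derivative_continuous)
  note cM = continuous_on_compose2[OF this ct(1) sub] continuous_on_compose2[OF M(2) ct(1) sub]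
  show ?thesis
    unfolding leg'_def Complex_eq
    by (intro continuous_intros ct cM)
qed

lemma leg_values:
  "leg M (-\<delta>) = M (-\<delta>)" "leg M (-\<delta>/2) = Complex A (Im (M (-\<delta>)))"
  "leg' M M' (-\<delta>) = M' (-\<delta>)" "leg' M M' (-\<delta>/2) = Complex 0 (- Im (M' (-\<delta>)))"
  unfolding leg_def leg'_def tau_def tau'_def eta_def eta'_def X_ends by (simp_all add: complex_eq_iff)

text \<open>The angular velocity vanishes only at the turning point \<open>X u = 1/2\<close> of
  \<open>tau\<close>, and there \<open>eta\<close> grows, so the radius increases towards
  \<open>A\<close>.\<close>

lemma leg'_nz:
  assumes u: "u \<in> {-\<delta>..-\<delta>/2}" and "Im (M' (tau u)) \<noteq> 0" "Re (M (tau u)) < A"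
  shows "leg' M M' u \<noteq> 0"
proof
  assume 0: "leg' M M' u = 0"
  then have "tau' u = 0" using assms(2) by (auto simp: leg'_def complex_eq_iff)
  then have "X u = 1 / 2" by (simp add: tau'_def)
  then have "0 < eta' u" using \<delta> by (simp add: eta'_def)
  then have "0 < eta' u * (A - Re (M (tau u)))" using assms(3) by simp
  moreover have "eta' u * (A - Re (M (tau u))) = Re (leg' M M' u)"
    by (simp add: leg'_def \<open>tau' u = 0\<close>)
  ultimately show False using 0 by simp
qed

text \<open>The strand run backwards. The descent on the far side of the ray is the leg of
  \<open>M\<close>, itself traversed backwards.\<close>

definition M :: "real \<Rightarrow> complex" where "M x = L (- x)"
definition M' :: "real \<Rightarrow> complex" where "M' x = - L' (- x)"

lemma DM: assumes "u \<in> {-\<delta>1..\<delta>1}" shows "(M has_vector_derivative M' u) (at u)"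
proof -
  have "(L has_vector_derivative L' (- u)) (at (0 + (-1) * u))" using DL[of "- u"] assms by simp
  from has_vector_derivative_affine[OF this] show ?thesis by (simp add: M_def[abs_def] M'_def)
qed

lemma CM: "continuous_on {-\<delta>1..\<delta>1} M'"
  unfolding M'_def by (intro continuous_intros continuous_on_compose2[OF CL]) auto

lemma Im_L_mono:
  assumes "u \<in> {-\<delta>1..\<delta>1}" "v \<in> {-\<delta>1..\<delta>1}" "u < v"
  shows "Im (L u) < Im (L v)"
proof (rule DERIV_pos_imp_increasing[OF assms(3)])
  fix x assume "u \<le> x" "x \<le> v"
  then have "x \<in> {-\<delta>1..\<delta>1}" using assms by simp
  from DL[OF this] Im_L'[OF this] show "\<exists>y. ((\<lambda>x. Im (L x)) has_real_derivative y) (at x) \<and> 0 < y"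
    unfolding has_vector_derivative_complex_iff by blast
qed

lemma Im_L_inj:
  assumes "u \<in> {-\<delta>1..\<delta>1}" "v \<in> {-\<delta>1..\<delta>1}" "Im (L u) = Im (L v)"
  shows "u = v"
  using Im_L_mono[of u v] Im_L_mono[of v u] assms by (cases u v rule: linorder_cases) auto

lemma \<beta>_anti:
  assumes "u \<in> {-\<delta>/2..\<delta>/2}" "v \<in> {-\<delta>/2..\<delta>/2}" "u < v"
  shows "\<beta> v < \<beta> u"
proof (rule DERIV_neg_imp_decreasing[OF assms(3)])
  fix x assume "u \<le> x" "x \<le> v"
  then have "x \<in> {-\<delta>/2..\<delta>/2}" using assms by simp
  from D\<beta>[of x] \<beta>'_neg[OF this] show "\<exists>y. (\<beta> has_real_derivative y) (at x) \<and> y < 0" by blast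
qed

text \<open>One clockwise turn lowers the angle by \<open>2 * pi\<close>, so subtracting this on the
  last piece keeps the lift continuous. The end slopes of \<open>\<beta>\<close> are the angular
  velocities with which the legs reach radius \<open>exp A\<close>.\<close>

definition zeta :: "real \<Rightarrow> complex" where
  "zeta u = (if u \<le> -\<delta>/2 then leg L u else if u \<le> \<delta>/2 then Complex A (\<beta> u)
     else leg M (- u) - Complex 0 (2 * pi))"

definition zeta' :: "real \<Rightarrow> complex" where
  "zeta' u = (if u \<le> -\<delta>/2 then leg' L L' u else if u \<le> \<delta>/2 then Complex 0 (\<beta>' u)
     else - leg' M M' (- u))"

lemma tau_in: "u \<in> {-\<delta>..-\<delta>/2} \<Longrightarrow> tau u \<in> {-\<delta>1..\<delta>1}" "u \<in> {-\<delta>..-\<delta>/2} \<Longrightarrow> - tau u \<in> {-\<delta>1..\<delta>1}"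
  "u \<in> {-\<delta>..-\<delta>/2} \<Longrightarrow> tau u \<in> {-\<delta>..\<delta>}" "u \<in> {-\<delta>..-\<delta>/2} \<Longrightarrow> - tau u \<in> {-\<delta>..\<delta>}"
  using tau_range \<delta> by fastforce+

lemma zeta_D:
  shows "u \<in> {-\<delta>..\<delta>} \<Longrightarrow> (zeta has_vector_derivative zeta' u) (at u within {-\<delta>..\<delta>})"
    and "continuous_on {-\<delta>..\<delta>} zeta'"
proof -
  have le: "-\<delta> \<le> -\<delta>/2" "-\<delta>/2 \<le> \<delta>/2" "\<delta>/2 \<le> \<delta>" using \<delta> by auto
  have sub: "{-\<delta>..0} \<subseteq> {-\<delta>1..\<delta>1}" using \<delta> by auto
  have f: "(leg L has_vector_derivative leg' L L' x) (at x within {-\<delta>..-\<delta>/2})" if "x \<in> {-\<delta>..-\<delta>/2}" for x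
    by (rule has_vector_derivative_at_within, rule D_leg[where M = L and M' = L', OF that DL[OF tau_in(1)[OF that]]])
  have f': "continuous_on {-\<delta>..-\<delta>/2} (leg' L L')"
    by (rule C_leg) (use DL sub in \<open>auto intro: continuous_on_subset[OF CL]\<close>)
  have g: "((\<lambda>u. Complex A (\<beta> u)) has_vector_derivative Complex 0 (\<beta>' x)) (at x within {-\<delta>/2..\<delta>/2})" for x
    by (rule has_vector_derivative_at_within)
      (use D\<beta>[of x] in \<open>simp add: has_vector_derivative_complex_iff\<close>)
  have g': "continuous_on {-\<delta>/2..\<delta>/2} (\<lambda>u. Complex 0 (\<beta>' u))"
    unfolding Complex_eq by (intro continuous_intros continuous_on_subset[OF C\<beta>]) auto
  have h: "((\<lambda>u. leg M (- u) - Complex 0 (2 * pi)) has_vector_derivative - leg' M M' (- x)) (at x within {\<delta>/2..\<delta>})"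
    if "x \<in> {\<delta>/2..\<delta>}" for x
  proof (rule has_vector_derivative_at_within)
    have x: "- x \<in> {-\<delta>..-\<delta>/2}" using that by auto
    have "(leg M has_vector_derivative leg' M M' (- x)) (at (0 + (-1) * x))"
      using D_leg[where M = M and M' = M', OF x DM[OF tau_in(1)[OF x]]] by simp
    from has_vector_derivative_affine[OF this]
    have "((\<lambda>u. leg M (- u)) has_vector_derivative - leg' M M' (- x)) (at x)" by simp
    from has_vector_derivative_diff[OF this has_vector_derivative_const]
    show "((\<lambda>u. leg M (- u) - Complex 0 (2 * pi)) has_vector_derivative - leg' M M' (- x)) (at x)" by simp
  qed
  have "continuous_on {-\<delta>..-\<delta>/2} (leg' M M')"
    by (rule C_leg) (use DM sub in \<open>auto intro: continuous_on_subset[OF CM]\<close>)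
  then have "continuous_on {\<delta>/2..\<delta>} (\<lambda>u. leg' M M' (- u))"
    by (rule continuous_on_compose2) (auto intro!: continuous_intros)
  then have h': "continuous_on {\<delta>/2..\<delta>} (\<lambda>u. - leg' M M' (- u))"
    by (rule continuous_on_minus)
  have m2: "Complex A (\<beta> (\<delta>/2)) = leg M (- (\<delta>/2)) - Complex 0 (2 * pi)"
    "Complex 0 (\<beta>' (\<delta>/2)) = - leg' M M' (- (\<delta>/2))"
    using leg_values(2,4) by (simp_all add: \<beta>_ends M_def M'_def complex_eq_iff)
  note J = has_vector_derivative_join[OF g g' h h' m2 le(2,3)]
  have m1: "leg L (-\<delta>/2) = (if -\<delta>/2 \<le> \<delta>/2 then Complex A (\<beta> (-\<delta>/2)) else leg M (- (-\<delta>/2)) - Complex 0 (2 * pi))"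
    "leg' L L' (-\<delta>/2) = (if -\<delta>/2 \<le> \<delta>/2 then Complex 0 (\<beta>' (-\<delta>/2)) else - leg' M M' (- (-\<delta>/2)))"
    by (simp_all only: le(2) if_True leg_values \<beta>_ends)
  have l2: "-\<delta>/2 \<le> \<delta>" using le by linarith
  show "u \<in> {-\<delta>..\<delta>} \<Longrightarrow> (zeta has_vector_derivative zeta' u) (at u within {-\<delta>..\<delta>})"
    using has_vector_derivative_join(1)[OF f f' J m1 le(1) l2] unfolding zeta_def[abs_def] zeta'_def .
  show "continuous_on {-\<delta>..\<delta>} zeta'"
    using has_vector_derivative_join(2)[OF f f' J m1 le(1) l2] unfolding zeta'_def[abs_def] .
qed

text \<open>
  Another lift of the same arc, with discontinuous angle confined to a window of length \<open>2\<pi>\<close>, on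
  which the exponential is injective.
\<close>

definition zh :: "real \<Rightarrow> complex" where
  "zh u = zeta u + Complex 0 (if \<delta>/2 \<le> u then 2 * pi else 0)"

lemma E_zh: "E (zh u) = E (zeta u)"
proof -
  have "exp (Complex 0 (if \<delta>/2 \<le> u then 2 * pi else 0)) = 1"
    by (simp add: exp_eq_polar cis.ctr complex_eq_iff)
  then show ?thesis unfolding E_def zh_def by (simp add: exp_add)
qed

lemma zh1: "u \<in> {-\<delta>..-\<delta>/2} \<Longrightarrow> zh u = leg L u"
  using \<delta> by (auto simp: zh_def zeta_def complex_eq_iff)

lemma zh2: "u \<in> {-\<delta>/2<..<\<delta>/2} \<Longrightarrow> zh u = Complex A (\<beta> u)"
  using \<delta> by (auto simp: zh_def zeta_def complex_eq_iff)

lemma zh3: "u \<in> {\<delta>/2..\<delta>} \<Longrightarrow> zh u = leg M (- u)"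
proof (cases "u = \<delta>/2")
  case True
  have "leg M (- (\<delta>/2)) = Complex A (Im (L \<delta>))" using leg_values(2)[of M] by (simp add: M_def)
  moreover have "zh (\<delta>/2) = Complex A (Im (L \<delta>))"
    using \<delta> by (simp add: zh_def zeta_def \<beta>_ends complex_eq_iff)
  ultimately show ?thesis unfolding True by simp
next
  case False
  assume "u \<in> {\<delta>/2..\<delta>}"
  then show ?thesis using False \<delta> by (simp add: zh_def zeta_def complex_eq_iff)
qed

lemma u_cases:
  assumes "u \<in> {-\<delta>..\<delta>}"
  obtains "u \<in> {-\<delta>..-\<delta>/2}" | "u \<in> {-\<delta>/2<..<\<delta>/2}" | "u \<in> {\<delta>/2..\<delta>}"
  using assms by fastforce

text \<open>Together with \<open>Im_leg_M\<close> and \<open>Im_mid\<close> this puts the three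
  pieces into disjoint ranges of angles: the first leg below \<open>\<theta>\<close>, the second
  above \<open>\<theta>\<close>, the middle part below the first leg, all within a half-open window
  of length \<open>2 * pi\<close>. Injectivity and the avoidance of the ray both follow from
  this.\<close>

lemma Im_leg_L: assumes "u \<in> {-\<delta>..-\<delta>/2}" shows "Im (L (-\<delta>)) \<le> Im (leg L u)" "Im (leg L u) < \<theta>"
proof -
  have t: "tau u \<in> {-\<delta>1..\<delta>1}" "-\<delta> \<in> {-\<delta>1..\<delta>1}" "0 \<in> {-\<delta>1..\<delta>1}" using tau_in(1)[OF assms] \<delta> by auto
  show "Im (L (-\<delta>)) \<le> Im (leg L u)"
    using Im_L_mono[OF t(2,1)] tau_range(1)[OF assms] by (cases "tau u = -\<delta>") (auto simp: leg_def)
  show "Im (leg L u) < \<theta>"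
    using Im_L_mono[OF t(1,3) tau_range(2)[OF assms]] L0 by (simp add: leg_def)
qed

lemma Im_leg_M: assumes "u \<in> {-\<delta>..-\<delta>/2}" shows "Im (leg M u) \<le> Im (L \<delta>)" "\<theta> < Im (leg M u)"
proof -
  have t: "- tau u \<in> {-\<delta>1..\<delta>1}" "\<delta> \<in> {-\<delta>1..\<delta>1}" "0 \<in> {-\<delta>1..\<delta>1}" using tau_in(2)[OF assms] \<delta> by auto
  show "Im (leg M u) \<le> Im (L \<delta>)"
    using Im_L_mono[OF t(1,2)] tau_range(1)[OF assms] by (cases "tau u = -\<delta>") (auto simp: leg_def M_def)
  show "\<theta> < Im (leg M u)"
    using Im_L_mono[OF t(3,1)] tau_range(2)[OF assms] L0 by (simp add: leg_def M_def)
qed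

lemma Im_mid: assumes "u \<in> {-\<delta>/2<..<\<delta>/2}" shows "\<beta> u < Im (L (-\<delta>))" "Im (L \<delta>) - 2 * pi < \<beta> u"
  using \<beta>_anti[of "-\<delta>/2" u] \<beta>_anti[of u "\<delta>/2"] assms \<delta> \<beta>_ends by auto

lemma ends_angle: "\<theta> - pi / 2 < Im (L (-\<delta>))" "Im (L (-\<delta>)) < \<theta>" "\<theta> < Im (L \<delta>)" "Im (L \<delta>) < \<theta> + pi / 2"
  using angle[of "-\<delta>"] angle[of \<delta>] Im_L_mono[of "-\<delta>" 0] Im_L_mono[of 0 \<delta>] \<delta> L0 by auto

lemma zh_window:
  assumes "u \<in> {-\<delta>..\<delta>}"
  shows "Im (L \<delta>) - 2 * pi < Im (zh u)" "Im (zh u) \<le> Im (L \<delta>)"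
proof -
  have "Im (L \<delta>) - 2 * pi < Im (zh u) \<and> Im (zh u) \<le> Im (L \<delta>)"
    using assms
  proof (cases rule: u_cases)
    case 1
    then show ?thesis using Im_leg_L[OF 1] ends_angle pi_gt_zero zh1[OF 1] by simp
  next
    case 2
    then show ?thesis using Im_mid[OF 2] ends_angle zh2[OF 2] by simp
  next
    case 3
    then have "- u \<in> {-\<delta>..-\<delta>/2}" by auto
    from Im_leg_M[OF this] show ?thesis using ends_angle zh3[OF 3] by simp
  qed
  then show "Im (L \<delta>) - 2 * pi < Im (zh u)" "Im (zh u) \<le> Im (L \<delta>)" by auto
qed

text \<open>The angle determines only \<open>tau u\<close>, a value taken twice since
  \<open>tau\<close> turns back; the radius then separates the two points because \<open>eta\<close>
  is injective and the strand lies below \<open>A\<close>.\<close>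

lemma leg_inj:
  assumes u: "u \<in> {-\<delta>..-\<delta>/2}" and v: "v \<in> {-\<delta>..-\<delta>/2}" and eq: "leg K u = leg K v"
    and K: "Im (K (tau u)) = Im (K (tau v)) \<Longrightarrow> tau u = tau v" "Re (K (tau u)) < A"
  shows "u = v"
proof -
  have t: "tau u = tau v" using eq K(1) by (simp add: leg_def)
  have "(1 - eta u) * Re (K (tau u)) + eta u * A = (1 - eta v) * Re (K (tau u)) + eta v * A"
    using eq t by (simp add: leg_def)
  then have "(eta u - eta v) * (A - Re (K (tau u))) = 0" by (simp add: algebra_simps)
  then have "eta u = eta v" using K(2) by simp
  then show ?thesis by (rule eta_inj[OF u v])
qed

lemma zh_inj:
  assumes u: "u \<in> {-\<delta>..\<delta>}" and v: "v \<in> {-\<delta>..\<delta>}" and eq: "zh u = zh v"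
  shows "u = v"
proof -
  have I1: "Im (L (-\<delta>)) \<le> Im (zh w) \<and> Im (zh w) < \<theta>" if "w \<in> {-\<delta>..-\<delta>/2}" for w
    using Im_leg_L[OF that] zh1[OF that] by simp
  have I2: "Im (zh w) < Im (L (-\<delta>))" if "w \<in> {-\<delta>/2<..<\<delta>/2}" for w
    using Im_mid[OF that] zh2[OF that] by simp
  have I3: "\<theta> < Im (zh w)" if "w \<in> {\<delta>/2..\<delta>}" for w
  proof -
    have "- w \<in> {-\<delta>..-\<delta>/2}" using that by auto
    from Im_leg_M[OF this] show ?thesis using zh3[OF that] by simp
  qed
  have Im: "Im (zh u) = Im (zh v)" using eq by simp
  show ?thesis
    using u
  proof (cases rule: u_cases)
    case 1
    from v have v1: "v \<in> {-\<delta>..-\<delta>/2}"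
      by (cases rule: u_cases) (use I1[OF 1] I2[of v] I3[of v] Im in auto)
    show ?thesis
      by (rule leg_inj[OF 1 v1, of L])
        (use eq zh1[OF 1] zh1[OF v1] Im_L_inj[OF tau_in(1)[OF 1] tau_in(1)[OF v1]] Re_L[OF tau_in(1)[OF 1]] in auto)
  next
    case 2
    from v have v2: "v \<in> {-\<delta>/2<..<\<delta>/2}"
      by (cases rule: u_cases) (use I2[OF 2] I1[of v] I3[of v] Im ends_angle in auto)
    have "\<beta> u = \<beta> v" using eq zh2[OF 2] zh2[OF v2] by simp
    then show ?thesis using \<beta>_anti[of u v] \<beta>_anti[of v u] 2 v2 by (cases u v rule: linorder_cases) auto
  next
    case 3
    from v have v3: "v \<in> {\<delta>/2..\<delta>}"
      by (cases rule: u_cases) (use I3[OF 3] I2[of v] I1[of v] Im ends_angle in auto)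
    have m: "- u \<in> {-\<delta>..-\<delta>/2}" "- v \<in> {-\<delta>..-\<delta>/2}" using 3 v3 by auto
    have "- u = - v"
      by (rule leg_inj[OF m, of M])
        (use eq zh3[OF 3] zh3[OF v3] Im_L_inj[OF tau_in(2)[OF m(1)] tau_in(2)[OF m(2)]] Re_L[OF tau_in(2)[OF m(1)]]
         in \<open>auto simp: M_def\<close>)
    then show ?thesis by simp
  qed
qed

section \<open>The new arc in the plane, the strand and the rest of the diagram\<close>

definition mu :: "real \<Rightarrow> complex" where "mu u = E (zeta u)"
lemma mu_zh: "mu u = E (zh u)" by (simp add: mu_def E_zh)

definition mu' :: "real \<Rightarrow> complex" where "mu' u = zeta' u * exp (zeta u)"

lemma mu_D:
  shows "u \<in> {-\<delta>..\<delta>} \<Longrightarrow> (mu has_vector_derivative mu' u) (at u within {-\<delta>..\<delta>})"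
    and "continuous_on {-\<delta>..\<delta>} mu'"
proof -
  assume u: "u \<in> {-\<delta>..\<delta>}"
  have "((\<lambda>p. q0 + exp p) has_field_derivative exp (zeta u)) (at (zeta u) within zeta ` {-\<delta>..\<delta>})"
    by (rule derivative_eq_intros refl | simp)+
  from field_vector_diff_chain_within[OF zeta_D(1)[OF u] this]
  show "(mu has_vector_derivative mu' u) (at u within {-\<delta>..\<delta>})"
    unfolding mu_def[abs_def] mu'_def E_def by (simp add: o_def)
next
  have "continuous_on {-\<delta>..\<delta>} zeta"
    using zeta_D(1) by (meson continuous_on_eq_continuous_within has_vector_derivative_continuous)
  then show "continuous_on {-\<delta>..\<delta>} mu'"
    unfolding mu'_def[abs_def] by (intro continuous_intros zeta_D(2))
qed

lemma mu'_nz: assumes "u \<in> {-\<delta>..\<delta>}" shows "mu' u \<noteq> 0"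
proof -
  have "zeta' u \<noteq> 0"
  proof (cases "u \<le> -\<delta>/2")
    case True
    then have u: "u \<in> {-\<delta>..-\<delta>/2}" using assms by auto
    have "leg' L L' u \<noteq> 0"
      by (rule leg'_nz[OF u]) (use Im_L'[OF tau_in(1)[OF u]] Re_L[OF tau_in(1)[OF u]] in auto)
    then show ?thesis using True by (simp add: zeta'_def)
  next
    case F: False
    show ?thesis
    proof (cases "u \<le> \<delta>/2")
      case True
      then show ?thesis using F \<beta>'_neg[of u] by (auto simp: zeta'_def complex_eq_iff)
    next
      case False
      then have u: "- u \<in> {-\<delta>..-\<delta>/2}" using assms by auto
      have "leg' M M' (- u) \<noteq> 0"
        by (rule leg'_nz[OF u])
          (use Im_L'[OF tau_in(2)[OF u]] Re_L[OF tau_in(2)[OF u]] in \<open>auto simp: M_def M'_def\<close>)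
      then show ?thesis using F False by (simp add: zeta'_def)
    qed
  qed
  then show ?thesis by (simp add: mu'_def)
qed

text \<open>At both ends the arc agrees with the strand to first order; at \<open>\<delta>\<close>
  the lifts differ by \<open>2 * pi\<close> in the angle, which \<open>exp\<close> does not
  see.\<close>

lemma mu_ends: "mu (-\<delta>) = E (L (-\<delta>))" "mu \<delta> = E (L \<delta>)"
  "mu' (-\<delta>) = L' (-\<delta>) * exp (L (-\<delta>))" "mu' \<delta> = L' \<delta> * exp (L \<delta>)"
proof -
  have z: "zeta (-\<delta>) = L (-\<delta>)" "zeta' (-\<delta>) = L' (-\<delta>)"
    using \<delta> by (simp_all add: zeta_def zeta'_def leg_values)
  then show "mu (-\<delta>) = E (L (-\<delta>))" "mu' (-\<delta>) = L' (-\<delta>) * exp (L (-\<delta>))"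
    by (simp_all add: mu_def mu'_def)
  have "zh \<delta> = L \<delta>" using zh3[of \<delta>] \<delta> leg_values(1)[of M] by (simp add: M_def)
  then show 1: "mu \<delta> = E (L \<delta>)" using E_zh[of \<delta>] by (simp add: mu_def)
  then have e: "exp (zeta \<delta>) = exp (L \<delta>)" by (simp add: mu_def E_def)
  have "zeta' \<delta> = L' \<delta>"
    using \<delta> leg_values(3)[of M M'] by (simp add: zeta'_def M'_def)
  then show "mu' \<delta> = L' \<delta> * exp (L \<delta>)" by (simp add: mu'_def e)
qed

lemma E_eq_window: "E p = E q \<Longrightarrow> \<bar>Im p - Im q\<bar> < 2 * pi \<Longrightarrow> p = q"
  by (rule exp_eq_window) (simp_all add: E_def)

lemma mu_inj: "inj_on mu {-\<delta>..\<delta>}"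
proof (rule inj_onI)
  fix u v assume uv: "u \<in> {-\<delta>..\<delta>}" "v \<in> {-\<delta>..\<delta>}" "mu u = mu v"
  then have "E (zh u) = E (zh v)" by (simp only: mu_zh)
  moreover have "\<bar>Im (zh u) - Im (zh v)\<bar> < 2 * pi"
    using zh_window[OF uv(1)] zh_window[OF uv(2)] by linarith
  ultimately have "zh u = zh v" by (rule E_eq_window)
  then show "u = v" using zh_inj uv by blast
qed

text \<open>The channel swept out when the short strand is pushed radially outwards from
  \<open>q0\<close>. Both legs lie in it, and by \<open>low\<close> and \<open>sector\<close> it
  misses \<open>Z\<close>.\<close>

definition chan :: "complex set" where
  "chan = {E (L w + of_real t) | w t. w \<in> {-\<delta>..\<delta>} \<and> 0 \<le> t}"

lemma leg_shift: "leg K u = K (tau u) + of_real (eta u * (A - Re (K (tau u))))"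
  by (simp add: leg_def complex_eq_iff algebra_simps)

lemma mu_cases:
  assumes "u \<in> {-\<delta>..\<delta>}"
  shows "mu u \<in> chan \<or> norm (mu u - q0) = exp A"
  using assms
proof (cases rule: u_cases)
  case 1
  have "0 \<le> eta u * (A - Re (L (tau u)))"
    using eta_range(1)[OF 1] Re_L[OF tau_in(1)[OF 1]] by simp
  moreover have "mu u = E (L (tau u) + of_real (eta u * (A - Re (L (tau u)))))"
    unfolding mu_zh zh1[OF 1] by (subst leg_shift) simp
  ultimately show ?thesis using tau_in(3)[OF 1] unfolding chan_def by blast
next
  case 2
  have "mu u - q0 = exp (Complex A (\<beta> u))" unfolding mu_zh zh2[OF 2] E_def by simp
  then show ?thesis by simp
next
  case 3
  then have u: "- u \<in> {-\<delta>..-\<delta>/2}" by auto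
  have "0 \<le> eta (- u) * (A - Re (L (- tau (- u))))"
    using eta_range(1)[OF u] Re_L[OF tau_in(2)[OF u]] by simp
  moreover have "mu u = E (L (- tau (- u)) + of_real (eta (- u) * (A - Re (L (- tau (- u))))))"
    unfolding mu_zh zh3[OF 3] by (subst leg_shift) (simp add: M_def)
  ultimately show ?thesis using tau_in(4)[OF u] unfolding chan_def by blast
qed

lemma mu_norm: assumes "u \<in> {-\<delta>..\<delta>}" shows "norm (mu u - q0) \<le> exp A"
proof -
  have c: "(1 - e) * r + e * A \<le> A" if "0 \<le> e" "e \<le> 1" "r < A" for e r :: real
  proof -
    have "0 \<le> (1 - e) * (A - r)" using that by simp
    then show ?thesis by (simp add: algebra_simps)
  qed
  have "Re (zh u) \<le> A"
    using assms
  proof (cases rule: u_cases)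
    case 1
    show ?thesis unfolding zh1[OF 1] leg_def
      using c[OF eta_range(1,2)[OF 1] Re_L[OF tau_in(1)[OF 1]]] by simp
  next
    case 2
    then show ?thesis using zh2[OF 2] by simp
  next
    case 3
    then have u: "- u \<in> {-\<delta>..-\<delta>/2}" by auto
    show ?thesis unfolding zh3[OF 3] leg_def M_def
      using c[OF eta_range(1,2)[OF u] Re_L[OF tau_in(2)[OF u]]] by simp
  qed
  moreover have "mu u - q0 = exp (zh u)" by (simp add: mu_zh E_def)
  ultimately show ?thesis by simp
qed

lemma chan_Z: "z \<in> chan \<Longrightarrow> z \<notin> Z"
proof -
  assume "z \<in> chan"
  then obtain w t where wt: "w \<in> {-\<delta>..\<delta>}" "0 \<le> t" "z = E (L w + of_real t)" unfolding chan_def by auto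
  have "lo \<le> Re (L w + of_real t)" "\<bar>Im (L w + of_real t) - \<theta>\<bar> \<le> \<kappa>"
    using low[OF wt(1)] wt(2) by simp_all
  from sector[OF this] show "z \<notin> Z" unfolding wt(3) E_def .
qed

lemma chan_strand:
  assumes "E (L w) \<in> chan" "w \<in> {-\<delta>1..\<delta>1}"
  shows "w \<in> {-\<delta>..\<delta>}"
proof -
  obtain w' t where w': "w' \<in> {-\<delta>..\<delta>}" "E (L w) = E (L w' + of_real t)" using assms(1) unfolding chan_def by auto
  then have w1: "w' \<in> {-\<delta>1..\<delta>1}" using \<delta> by auto
  have "\<bar>Im (L w) - Im (L w')\<bar> < 2 * pi" using angle[OF assms(2)] angle[OF w1] pi_gt_zero by linarith
  then have "\<bar>Im (L w) - Im (L w' + of_real t)\<bar> < 2 * pi" by simp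
  with w'(2) have "L w = L w' + of_real t" by (rule E_eq_window)
  then have "Im (L w) = Im (L w')" by simp
  then have "w = w'" by (rule Im_L_inj[OF assms(2) w1])
  then show ?thesis using w'(1) by simp
qed

text \<open>Dilation by \<open>r\<close> about \<open>q0\<close> is translation by
  \<open>ln r\<close> in logarithmic coordinates. Hence the complement of the channel is star-shaped
  about \<open>q0\<close>.\<close>

lemma chan_scale:
  assumes "y \<in> chan" "1 \<le> r"
  shows "q0 + of_real r * (y - q0) \<in> chan"
proof -
  obtain w t where wt: "w \<in> {-\<delta>..\<delta>}" "0 \<le> t" "y = E (L w + of_real t)" using assms(1) unfolding chan_def by auto
  have "of_real r = exp (of_real (ln r) :: complex)" using assms(2) by (simp add: exp_of_real)
  then have "q0 + of_real r * (y - q0) = E (L w + of_real (t + ln r))"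
    unfolding wt(3) E_def by (simp add: exp_add)
  moreover have "0 \<le> t + ln r" using wt(2) assms(2) by simp
  ultimately show ?thesis using wt(1) unfolding chan_def by blast
qed

lemma mu_Z: "u \<in> {-\<delta>..\<delta>} \<Longrightarrow> mu u \<notin> Z"
  using mu_cases[of u] chan_Z Z_A by (metis order_less_irrefl)

text \<open>On a leg, equality of angles identifies the strand parameter with \<open>tau u\<close>,
  or its negative for the second leg, and equality of radii then forces \<open>eta\<close> to
  vanish, which happens only at the foot of the leg. The middle part lies at radius
  \<open>exp A\<close>, beyond the strand.\<close>

lemma mu_strand:
  assumes u: "u \<in> {-\<delta>..\<delta>}" and w: "w \<in> {-\<delta>1..\<delta>1}" and eq: "mu u = E (L w)"
  shows "u = w" "w = -\<delta> \<or> w = \<delta>"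
proof -
  have E: "E (zh u) = E (L w)" using eq by (simp only: mu_zh)
  have aw: "\<bar>Im (L w) - \<theta>\<bar> < pi / 2" by (rule angle[OF w])
  have leg: "tau v = - \<delta>" if K: "leg K v = L w" and v: "v \<in> {-\<delta>..-\<delta>/2}" and "Re (K (tau v)) < A"
     "Im (K (tau v)) = Im (L w) \<Longrightarrow> K (tau v) = L w" for K v
  proof -
    have "K (tau v) = L w" using K that(4) by (simp add: leg_def complex_eq_iff)
    then have "eta v * (A - Re (K (tau v))) = 0" using K leg_shift[of K v] by simp
    then have "eta v = 0" using that(3) by simp
    then have "v = -\<delta>" using eta_range(3)[OF v] by blast
    then show ?thesis using X_ends by (simp add: tau_def)
  qed
  have "u = w \<and> (w = -\<delta> \<or> w = \<delta>)"
    using u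
  proof (cases rule: u_cases)
    case 1
    have "\<bar>Im (leg L u) - Im (L w)\<bar> < 2 * pi" using Im_leg_L[OF 1] ends_angle aw pi_gt_zero by linarith
    with E[unfolded zh1[OF 1]] have *: "leg L u = L w" by (rule E_eq_window)
    have w': "Im (L (tau u)) = Im (L w) \<Longrightarrow> tau u = w" by (rule Im_L_inj[OF tau_in(1)[OF 1] w])
    have "tau u = -\<delta>" by (rule leg[OF * 1 Re_L[OF tau_in(1)[OF 1]]]) (use w' in auto)
    moreover have "tau u = w" using w' * by (simp add: leg_def complex_eq_iff)
    ultimately have w0: "w = -\<delta>" by simp
    then have "mu u = mu (-\<delta>)" using eq mu_ends by simp
    then have "u = -\<delta>" using inj_onD[OF mu_inj _ u, of "-\<delta>"] \<delta> by auto
    then show ?thesis using w0 by simp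
  next
    case 2
    have "norm (E (zh u) - q0) = exp A" unfolding zh2[OF 2] E_def by simp
    from this[unfolded E] have "Re (L w) = A" by (simp add: E_def)
    then show ?thesis using Re_L[OF w] by simp
  next
    case 3
    then have m: "- u \<in> {-\<delta>..-\<delta>/2}" by auto
    have "\<bar>Im (leg M (- u)) - Im (L w)\<bar> < 2 * pi" using Im_leg_M[OF m] ends_angle aw pi_gt_zero by linarith
    with E[unfolded zh3[OF 3]] have *: "leg M (- u) = L w" by (rule E_eq_window)
    have w': "Im (L (- tau (- u))) = Im (L w) \<Longrightarrow> - tau (- u) = w" by (rule Im_L_inj[OF tau_in(2)[OF m] w])
    have "tau (- u) = -\<delta>"
      by (rule leg[OF * m]) (use w' Re_L[OF tau_in(2)[OF m]] in \<open>auto simp: M_def\<close>)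
    moreover have "- tau (- u) = w" using w' * by (simp add: leg_def M_def complex_eq_iff)
    ultimately have w0: "w = \<delta>" by simp
    then have "mu u = mu \<delta>" using eq mu_ends by simp
    then have "u = \<delta>" using inj_onD[OF mu_inj _ u, of \<delta>] \<delta> by auto
    then show ?thesis using w0 by simp
  qed
  then show "u = w" "w = -\<delta> \<or> w = \<delta>" by auto
qed

text \<open>The angle \<open>\<theta>\<close> is the gap between the ranges of the two legs, and the
  middle part passes on the other side of \<open>q0\<close>. The arc thus misses the ray altogether,
  inside and outside the strand alike, which lowers the number of hits in the recursion.\<close>

lemma mu_ray:
  assumes "u \<in> {-\<delta>..\<delta>}"
  shows "mu u \<noteq> E (Complex a \<theta>)"
proof
  assume "mu u = E (Complex a \<theta>)"
  then have "E (zh u) = E (Complex a \<theta>)" by (simp only: mu_zh)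
  moreover have "\<bar>Im (zh u) - Im (Complex a \<theta>)\<bar> < 2 * pi"
    using zh_window[OF assms] ends_angle pi_gt_zero unfolding complex.sel by linarith
  ultimately have "zh u = Complex a \<theta>" by (rule E_eq_window)
  then have th: "Im (zh u) = \<theta>" by simp
  from assms show False
  proof (cases rule: u_cases)
    case 1
    then show False using Im_leg_L[OF 1] zh1[OF 1] th by simp
  next
    case 2
    then show False using Im_mid[OF 2] zh2[OF 2] th ends_angle by simp
  next
    case 3
    then have "- u \<in> {-\<delta>..-\<delta>/2}" by auto
    from Im_leg_M[OF this] show False using zh3[OF 3] th by simp
  qed
qed

section \<open>The closed curve formed by the strand and the new arc\<close>

definition strand_path :: "real \<Rightarrow> complex" where "strand_path s = E (L (- \<delta> + 2 * \<delta> * s))"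
definition arch_path :: "real \<Rightarrow> complex" where "arch_path s = mu (- \<delta> + 2 * \<delta> * s)"

abbreviation loop :: "real \<Rightarrow> complex" where "loop \<equiv> arch_path +++ reversepath strand_path"

lemma affine_image: "(\<lambda>s. - \<delta> + 2 * \<delta> * s) ` {0..1} = {-\<delta>..\<delta>}"
proof -
  have "(\<lambda>s. (2 * \<delta>) * s + - \<delta>) ` {0..1} = {-\<delta>..\<delta>}"
    using \<delta> by (subst image_affinity_atLeastAtMost) auto
  then show ?thesis by (simp add: add.commute)
qed

lemma affine_in: "s \<in> {0..1} \<Longrightarrow> - \<delta> + 2 * \<delta> * s \<in> {-\<delta>..\<delta>}"
  using affine_image by blast

lemma path_images:
  "path_image strand_path = (\<lambda>u. E (L u)) ` {-\<delta>..\<delta>}" "path_image arch_path = mu ` {-\<delta>..\<delta>}"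
  unfolding path_image_def strand_path_def arch_path_def affine_image[symmetric] image_image by rule+

lemma continuous_L: "continuous_on {-\<delta>..\<delta>} L"
proof (intro continuous_at_imp_continuous_on ballI)
  fix x assume "x \<in> {-\<delta>..\<delta>}"
  then have "x \<in> {-\<delta>1..\<delta>1}" using \<delta> by auto
  then show "isCont L x" by (rule has_vector_derivative_continuous[OF DL])
qed

lemma continuous_zeta: "continuous_on {-\<delta>..\<delta>} zeta"
  using zeta_D(1) by (meson continuous_on_eq_continuous_within has_vector_derivative_continuous)

lemma ends_paths:
  "pathstart strand_path = E (L (-\<delta>))" "pathfinish strand_path = E (L \<delta>)"
  "pathstart arch_path = E (L (-\<delta>))" "pathfinish arch_path = E (L \<delta>)"
  using mu_ends by (simp_all add: pathstart_def pathfinish_def strand_path_def arch_path_def)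

lemma continuous_affine: "continuous_on {0..1} (\<lambda>s. K (- \<delta> + 2 * \<delta> * s))"
  if "continuous_on {-\<delta>..\<delta>} K" for K :: "real \<Rightarrow> complex"
  by (rule continuous_on_compose2[OF that]) (use affine_in in \<open>auto intro!: continuous_intros\<close>)

lemma strand_inj:
  assumes "u \<in> {-\<delta>1..\<delta>1}" "v \<in> {-\<delta>1..\<delta>1}" "E (L u) = E (L v)"
  shows "u = v"
proof -
  have "\<bar>Im (L u) - Im (L v)\<bar> < 2 * pi" using angle[OF assms(1)] angle[OF assms(2)] pi_gt_zero by linarith
  with assms(3) have "L u = L v" by (rule E_eq_window)
  then show ?thesis by (intro Im_L_inj[OF assms(1,2)]) simp
qed

lemma arcs: "arc strand_path" "arc arch_path"
proof -
  have inj: "s = t" if "- \<delta> + 2 * \<delta> * s = - \<delta> + 2 * \<delta> * t" for s t :: real using that \<delta> by simp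
  have sub: "w \<in> {-\<delta>1..\<delta>1}" if "w \<in> {-\<delta>..\<delta>}" for w using that \<delta> by auto
  have cE: "continuous_on {-\<delta>..\<delta>} (\<lambda>u. E (K u))" if "continuous_on {-\<delta>..\<delta>} K" for K
    unfolding E_def by (intro continuous_intros that)
  have "path strand_path" unfolding path_def strand_path_def
    by (rule continuous_affine[OF cE[OF continuous_L]])
  moreover have "inj_on strand_path {0..1}"
  proof (rule inj_onI)
    fix s t :: real assume st: "s \<in> {0..1}" "t \<in> {0..1}" "strand_path s = strand_path t"
    have "- \<delta> + 2 * \<delta> * s = - \<delta> + 2 * \<delta> * t"
      by (rule strand_inj[OF sub[OF affine_in[OF st(1)]] sub[OF affine_in[OF st(2)]] st(3)[unfolded strand_path_def]])
    then show "s = t" by (rule inj)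
  qed
  ultimately show "arc strand_path" by (simp add: arc_def)
  have "path arch_path" unfolding path_def arch_path_def mu_def
    by (rule continuous_affine[OF cE[OF continuous_zeta]])
  moreover have "inj_on arch_path {0..1}"
  proof (rule inj_onI)
    fix s t :: real assume st: "s \<in> {0..1}" "t \<in> {0..1}" "arch_path s = arch_path t"
    have "- \<delta> + 2 * \<delta> * s = - \<delta> + 2 * \<delta> * t"
      by (rule inj_onD[OF mu_inj]) (use affine_in[OF st(1)] affine_in[OF st(2)] st(3) in \<open>auto simp: arch_path_def\<close>)
    then show "s = t" by (rule inj)
  qed
  ultimately show "arc arch_path" by (simp add: arc_def)
qed

lemma strand_arch_Int:
  "path_image strand_path \<inter> path_image arch_path = {pathstart strand_path, pathfinish strand_path}"
proof
  show "path_image strand_path \<inter> path_image arch_path \<subseteq> {pathstart strand_path, pathfinish strand_path}"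
  proof
    fix z assume "z \<in> path_image strand_path \<inter> path_image arch_path"
    then obtain u w where uw: "u \<in> {-\<delta>..\<delta>}" "w \<in> {-\<delta>..\<delta>}" "z = mu u" "z = E (L w)"
      unfolding path_images by blast
    then have "w \<in> {-\<delta>1..\<delta>1}" using \<delta> by auto
    from mu_strand(2)[OF uw(1) this] uw have "w = -\<delta> \<or> w = \<delta>" by simp
    then show "z \<in> {pathstart strand_path, pathfinish strand_path}" using uw(4) ends_paths by auto
  qed
  show "{pathstart strand_path, pathfinish strand_path} \<subseteq> path_image strand_path \<inter> path_image arch_path"
  proof -
    have eq: "pathstart strand_path = pathstart arch_path" "pathfinish strand_path = pathfinish arch_path"
      by (simp_all only: ends_paths)
    have "pathstart strand_path \<in> path_image arch_path" "pathfinish strand_path \<in> path_image arch_path"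
      unfolding eq by (rule pathstart_in_path_image pathfinish_in_path_image)+
    moreover have "pathstart strand_path \<in> path_image strand_path" "pathfinish strand_path \<in> path_image strand_path"
      by (rule pathstart_in_path_image pathfinish_in_path_image)+
    ultimately show ?thesis by blast
  qed
qed

lemma simple_loop: "simple_path loop"
proof (rule simple_path_join_loop)
  show "path_image arch_path \<inter> path_image (reversepath strand_path) \<subseteq> {pathstart arch_path, pathstart (reversepath strand_path)}"
    using strand_arch_Int by (auto simp: ends_paths)
qed (use arcs in \<open>auto simp: arc_reversepath ends_paths\<close>)

lemma image_loop: "path_image loop = path_image strand_path \<union> path_image arch_path"
  by (subst path_image_join) (auto simp: ends_paths)

lemma in_loop: "y \<in> path_image loop \<Longrightarrow> y \<in> chan \<or> norm (y - q0) = exp A"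
proof -
  assume "y \<in> path_image loop"
  then consider u where "u \<in> {-\<delta>..\<delta>}" "y = E (L u)" | u where "u \<in> {-\<delta>..\<delta>}" "y = mu u"
    unfolding image_loop path_images by blast
  then show ?thesis
  proof cases
    case 1
    then have "y = E (L u + of_real 0)" by simp
    then show ?thesis using 1 unfolding chan_def by blast
  next
    case 2
    then show ?thesis using mu_cases by simp
  qed
qed

lemma E_ne: "E p \<noteq> q0"
  by (simp add: E_def)

lemma q0_notin: "q0 \<notin> path_image loop"
  unfolding image_loop path_images mu_def using E_ne by (metis UnE imageE)

text \<open>The loop lifts to logarithmic coordinates: \<open>zeta\<close> leads from
  \<open>L (-\<delta>)\<close> to \<open>L \<delta>\<close> lowered by \<open>2 * pi\<close> in the
  angle, and the strand, lowered likewise, leads back. The lift ends exactly one turn below its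
  start.\<close>

lemma winding_centre: "winding_number loop q0 = -1"
proof -
  define Q where "Q = (\<lambda>s. zeta (- \<delta> + 2 * \<delta> * s)) +++ reversepath (\<lambda>s. L (- \<delta> + 2 * \<delta> * s) - 2 * of_real pi * \<i>)"
  have zd: "zeta \<delta> = L \<delta> - 2 * of_real pi * \<i>"
    using \<delta> leg_values(1)[of M] by (simp add: zeta_def M_def complex_eq_iff)
  have zm: "zeta (-\<delta>) = L (-\<delta>)" using \<delta> by (simp add: zeta_def leg_values)
  have "path Q"
    unfolding Q_def
  proof (rule path_join_imp)
    show "path (\<lambda>s. zeta (- \<delta> + 2 * \<delta> * s))"
      unfolding path_def by (rule continuous_affine[OF continuous_zeta])
    have "path (\<lambda>s. L (- \<delta> + 2 * \<delta> * s) - 2 * of_real pi * \<i>)"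
      unfolding path_def by (intro continuous_intros continuous_affine[OF continuous_L])
    then show "path (reversepath (\<lambda>s. L (- \<delta> + 2 * \<delta> * s) - 2 * of_real pi * \<i>))" by simp
    show "pathfinish (\<lambda>s. zeta (- \<delta> + 2 * \<delta> * s)) = pathstart (reversepath (\<lambda>s. L (- \<delta> + 2 * \<delta> * s) - 2 * of_real pi * \<i>))"
      using zd by (simp add: pathfinish_def pathstart_def reversepath_def)
  qed
  have "exp (L x - 2 * of_real pi * \<i>) = exp (L x)" for x
    by (simp add: exp_diff)
  then have "exp \<circ> Q = (\<lambda>t. loop t - q0)"
    by (auto simp: fun_eq_iff Q_def joinpaths_def reversepath_def arch_path_def strand_path_def mu_def E_def)
  then have "winding_number loop q0 = winding_number (exp \<circ> Q) 0"
    using winding_number_offset[of loop q0] by simp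
  also have "\<dots> = (pathfinish Q - pathstart Q) / (2 * of_real pi * \<i>)"
    by (rule winding_number_compose_exp[OF \<open>path Q\<close>])
  also have "pathfinish Q - pathstart Q = - (2 * of_real pi * \<i>)"
    unfolding Q_def using zm by (simp add: pathfinish_def pathstart_def reversepath_def joinpaths_def)
  finally show ?thesis by simp
qed

lemma closed_loop: "path loop" "pathfinish loop = pathstart loop"
  using simple_loop by (auto simp: simple_path_def ends_paths)

lemma centre_inside: "q0 \<in> inside (path_image loop)"
proof -
  have "q0 \<notin> outside (path_image loop)"
    using winding_number_zero_in_outside[OF closed_loop] winding_centre by force
  then show ?thesis using q0_notin inside_Un_outside[of "path_image loop"] by blast
qed

text \<open>The winding number of a simple closed curve is constantly 1 or constantly -1 on its
  inside; the centre decides.\<close>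

lemma winding_inside: "z \<in> inside (path_image loop) \<Longrightarrow> winding_number loop z = -1"
  using simple_closed_path_winding_number_inside[OF simple_loop] centre_inside winding_centre
  by (metis one_neq_neg_one)

text \<open>The segment from \<open>q0\<close> to \<open>z\<close> misses the loop: a point of it in
  the channel would, dilated from \<open>q0\<close>, put \<open>z\<close> into the channel as well,
  and all of it lies at distance less than \<open>exp A\<close> from \<open>q0\<close>. So
  \<open>z\<close> is in the component of the centre.\<close>

lemma star_inside:
  assumes z: "norm (z - q0) < exp A" and nc: "z \<notin> chan"
  shows "z \<in> inside (path_image loop)"
proof -
  have "closed_segment q0 z \<subseteq> - path_image loop"
  proof
    fix y assume "y \<in> closed_segment q0 z"
    then obtain s where s: "0 \<le> s" "s \<le> 1" "y = q0 + of_real s * (z - q0)"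
      by (auto simp: closed_segment_def scaleR_conv_of_real algebra_simps)
    show "y \<in> - path_image loop"
    proof
      assume y: "y \<in> path_image loop"
      then have "s \<noteq> 0" using s q0_notin by auto
      then have s0: "0 < s" using s by simp
      have "y \<notin> chan"
      proof
        assume "y \<in> chan"
        from chan_scale[OF this, of "1 / s"] have "q0 + of_real (1 / s) * (y - q0) \<in> chan" using s s0 by simp
        moreover have "q0 + of_real (1 / s) * (y - q0) = z" using s(3) s0 by simp
        ultimately show False using nc by simp
      qed
      then have "norm (y - q0) = exp A" using in_loop[OF y] by simp
      moreover have "norm (y - q0) = s * norm (z - q0)" using s by (simp add: norm_mult)
      moreover have "s * norm (z - q0) \<le> 1 * norm (z - q0)" using s by (intro mult_right_mono) auto
      ultimately show False using z by simp
    qed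
  qed
  then have "connected_component (- path_image loop) q0 z"
    unfolding connected_component_def by (intro exI[of _ "closed_segment q0 z"]) auto
  then show ?thesis using inside_same_component centre_inside by metis
qed

text \<open>The second claim concerns the strand next to the exchanged arc, which is not part of
  \<open>Z\<close>: monotone angles keep it out of the channel, so the segment argument applies to
  it too.\<close>

theorem arch_encloses:
  shows "Z \<subseteq> inside (path_image strand_path \<union> path_image arch_path)"
    and "w \<in> {-\<delta>1..\<delta>1} \<Longrightarrow> w \<notin> {-\<delta>..\<delta>} \<Longrightarrow> E (L w) \<in> inside (path_image strand_path \<union> path_image arch_path)"
    and "z \<in> inside (path_image strand_path \<union> path_image arch_path) \<Longrightarrow>
      winding_number (arch_path +++ reversepath strand_path) z = -1"
  unfolding image_loop[symmetric]
proof -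
  show "Z \<subseteq> inside (path_image loop)"
    using star_inside Z_A chan_Z by blast
  show "E (L w) \<in> inside (path_image loop)" if "w \<in> {-\<delta>1..\<delta>1}" "w \<notin> {-\<delta>..\<delta>}"
  proof (rule star_inside)
    show "norm (E (L w) - q0) < exp A" using Re_L[OF that(1)] by (simp add: E_def)
    show "E (L w) \<notin> chan" using chan_strand that by blast
  qed
  show "winding_number loop z = -1" if "z \<in> inside (path_image loop)" using winding_inside[OF that] .
qed

end

section \<open>Replacing an arc of a diagram\<close>

text \<open>\<open>frac\<close> makes the result periodic. The interval \<open>{a..b}\<close> will
  lie inside \<open>{0<..<1}\<close>, so the base point of the circle is never on the exchanged
  arc.\<close>

definition replace_arc :: "(real \<Rightarrow> complex) \<Rightarrow> real \<Rightarrow> real \<Rightarrow> (real \<Rightarrow> complex) \<Rightarrow> real \<Rightarrow> complex" where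
  "replace_arc g a b \<nu> t = (if frac t \<in> {a..b} then \<nu> (frac t) else g t)"

lemma frac_unit: "0 \<le> t \<Longrightarrow> t < 1 \<Longrightarrow> frac t = (t::real)"
  by (simp add: frac_eq)

lemma replace_arc_periodic:
  assumes "\<And>t. g (t + 1) = g t"
  shows "replace_arc g a b \<nu> (t + 1) = replace_arc g a b \<nu> t"
  using assms by (simp add: replace_arc_def frac_def)

lemma replace_arc_unit:
  assumes "0 \<le> t" "t < 1"
  shows "replace_arc g a b \<nu> t = (if t \<in> {a..b} then \<nu> t else g t)"
  using frac_unit[OF assms] by (simp add: replace_arc_def)

lemma replace_arc_near_int:
  assumes "0 < a" "a < b" "b < 1" "t \<in> {b - 1<..<a}"
  shows "replace_arc g a b \<nu> t = g t"
proof -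
  have "frac t \<notin> {a..b}"
  proof (cases "0 \<le> t")
    case True
    then have "frac t = t" using assms by (intro frac_unit) auto
    then show ?thesis using assms by auto
  next
    case False
    have "\<lfloor>t\<rfloor> = -1" using False assms by (intro floor_unique) auto
    then have "frac t = t + 1" by (simp add: frac_def)
    then show ?thesis using assms by auto
  qed
  then show ?thesis by (auto simp: replace_arc_def)
qed

text \<open>Up to integer translation the circle is covered by an open window containing the arc and
  an open window around the base point where nothing changes; smoothness can be checked on
  each.\<close>

lemma cover_circle:
  fixes t :: real
  assumes "0 < a" "b < 1"
  obtains m :: int where "t - of_int m \<in> {0<..<1}" | m :: int where "t - of_int m \<in> {b - 1<..<a}"
proof (cases "frac t = 0")
  case True
  then show ?thesis using that(2)[of "\<lfloor>t\<rfloor>"] assms by (simp add: frac_def)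
next
  case False
  then have "0 < frac t" using frac_ge_0[of t] by linarith
  then show ?thesis using that(1)[of "\<lfloor>t\<rfloor>"] frac_lt_1[of t] by (simp add: frac_def)
qed

text \<open>On \<open>{0<..<1}\<close> three C1 pieces are joined, near the base point the function
  is \<open>g\<close> itself, and periodicity carries both to all parameters.\<close>

lemma replace_arc_C1:
  assumes g: "immersed_circle g" and ab: "0 < a" "a < b" "b < 1"
    and \<nu>: "\<And>t. t \<in> {a..b} \<Longrightarrow> (\<nu> has_vector_derivative \<nu>' t) (at t within {a..b})"
      "continuous_on {a..b} \<nu>'" "\<And>t. t \<in> {a..b} \<Longrightarrow> \<nu>' t \<noteq> 0"
    and ends: "\<nu> a = g a" "\<nu> b = g b" "\<nu>' a = vector_derivative g (at a)" "\<nu>' b = vector_derivative g (at b)"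
  shows "immersed_circle (replace_arc g a b \<nu>)"
    "vector_derivative (replace_arc g a b \<nu>) (at t) = replace_arc (\<lambda>t. vector_derivative g (at t)) a b \<nu>' t"
proof -
  define g' where "g' t = vector_derivative g (at t)" for t
  have D: "(g has_vector_derivative g' t) (at t)" and C: "continuous_on UNIV g'" and nz: "g' t \<noteq> 0" for t
    using immersed_circleD(2,3,4)[OF g] by (simp_all add: g'_def)
  have per: "g (t + 1) = g t" for t using immersed_circleD(1)[OF g] .
  have per': "g' (t + 1) = g' t" for t
  proof -
    have "((\<lambda>x. g (1 + 1 * x)) has_vector_derivative 1 *\<^sub>R g' (1 + 1 * t)) (at t)"
      by (rule has_vector_derivative_affine[OF D])
    then have "(g has_vector_derivative g' (t + 1)) (at t)" using per by (simp add: add.commute)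
    then show ?thesis using D vector_derivative_at by metis
  qed
  define r r' where "r = replace_arc g a b \<nu>" and "r' = replace_arc g' a b \<nu>'"
  have rper: "r (t + 1) = r t" "r' (t + 1) = r' t" for t
    unfolding r_def r'_def by (rule replace_arc_periodic; rule per per')+
  define f f' where "f x = (if x \<le> b then if x \<le> a then g x else \<nu> x else g x)"
    and "f' x = (if x \<le> b then if x \<le> a then g' x else \<nu>' x else g' x)" for x
  have le: "0 \<le> a" "a \<le> b" "b \<le> 1" "0 \<le> b" using ab by auto
  have Dw: "(g has_vector_derivative g' x) (at x within S)" for x S
    using D has_vector_derivative_at_within by blast
  have Cw: "continuous_on S g'" for S using C continuous_on_subset by blast
  have e1: "g a = \<nu> a" "g' a = \<nu>' a" using ends by (simp_all add: g'_def)
  note J = has_vector_derivative_join[OF Dw Cw \<nu>(1,2) e1 le(1,2)]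
  have e2: "(if b \<le> a then g b else \<nu> b) = g b" "(if b \<le> a then g' b else \<nu>' b) = g' b"
    using ends ab by (auto simp: g'_def)
  have Df: "(f has_vector_derivative f' x) (at x within {0..1})" if "x \<in> {0..1}" for x
    using has_vector_derivative_join(1)[OF J Dw Cw e2 le(4,3) that] unfolding f_def[abs_def] f'_def .
  have Cf: "continuous_on {0..1} f'"
    using has_vector_derivative_join(2)[OF J Dw Cw e2 le(4,3)] unfolding f'_def[abs_def] .
  have rf: "r x = f x" "r' x = f' x" if "x \<in> {0<..<1}" for x
    using replace_arc_unit[of x] that e1 ab unfolding r_def r'_def f_def f'_def by auto
  have rg: "r x = g x" "r' x = g' x" if "x \<in> {b - 1<..<a}" for x
    unfolding r_def r'_def by (rule replace_arc_near_int[OF ab that])+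
  have loc1: "(r has_vector_derivative r' x) (at x) \<and> isCont r' x" if x: "x \<in> {0<..<1}" for x
  proof
    have "x \<in> interior {0..1}" using x by simp
    then have "(f has_vector_derivative f' x) (at x)"
      using Df[of x] x at_within_interior[of x "{0..1}"] by auto
    then show "(r has_vector_derivative r' x) (at x)"
      using has_vector_derivative_transform_within_open[OF _ open_greaterThanLessThan x, of f "f' x" r] rf x by auto
    have "continuous_on {0<..<1} f'" using Cf by (rule continuous_on_subset) auto
    then have "continuous_on {0<..<1} r'" by (rule continuous_on_eq) (rule rf(2)[symmetric])
    then show "isCont r' x" using x by (simp add: continuous_on_eq_continuous_at)
  qed
  have loc2: "(r has_vector_derivative r' x) (at x) \<and> isCont r' x" if x: "x \<in> {b - 1<..<a}" for x
  proof
    show "(r has_vector_derivative r' x) (at x)"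
      using has_vector_derivative_transform_within_open[OF D open_greaterThanLessThan x, of r] rg x by auto
    have "continuous_on {b - 1<..<a} r'" by (rule continuous_on_eq[OF Cw]) (rule rg(2)[symmetric])
    then show "isCont r' x" using x by (simp add: continuous_on_eq_continuous_at)
  qed
  have loc: "(r has_vector_derivative r' t) (at t) \<and> isCont r' t" for t
  proof -
    obtain m :: int where m: "(r has_vector_derivative r' (t - of_int m)) (at (t - of_int m))" "isCont r' (t - of_int m)"
      using cover_circle[OF ab(1,3), of t] loc1 loc2 by metis
    have sh: "r (x - of_int m) = r x" "r' (x - of_int m) = r' x" for x
      using periodic_int[of r x "- m"] periodic_int[of r' x "- m"] rper by auto
    have "((\<lambda>x. r (- of_int m + 1 * x)) has_vector_derivative 1 *\<^sub>R r' (t - of_int m)) (at t)"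
      by (rule has_vector_derivative_affine) (use m(1) in simp)
    moreover have "(\<lambda>x. r (- of_int m + 1 * x)) = r" using sh by (simp add: fun_eq_iff)
    moreover have "isCont (\<lambda>x. x - of_int m) t" by (intro continuous_intros)
    from isCont_o2[OF this m(2)] have "isCont (\<lambda>x. r' (x - of_int m)) t" .
    ultimately show ?thesis unfolding sh by simp
  qed
  have r'nz: "r' t \<noteq> 0" for t
    using \<nu>(3) nz unfolding r'_def replace_arc_def by simp
  have vd: "vector_derivative r (at t) = r' t" for t
    using loc vector_derivative_at by blast
  show "vector_derivative (replace_arc g a b \<nu>) (at t) = replace_arc (\<lambda>t. vector_derivative g (at t)) a b \<nu>' t"
    using vd unfolding r_def r'_def g'_def .
  have "r C1_differentiable_on UNIV"
    unfolding C1_differentiable_on_def using loc by (intro exI[of _ r'] conjI ballI continuous_at_imp_continuous_on) auto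
  then show "immersed_circle (replace_arc g a b \<nu>)"
    unfolding immersed_circle_def r_def[symmetric] using rper vd r'nz by simp
qed

text \<open>An arc without crossings on circle \<open>i\<close> is exchanged for
  \<open>\<nu>\<close>, fitting to first order at both ends. \<open>new\<close> speaks of the open
  interval because the end points are shared. The number of circles and the parameters of all
  crossings stay the same, so that \<open>U\<close> can be kept literally.\<close>

locale arc_replacement =
  fixes n :: nat and \<gamma> :: "nat \<Rightarrow> real \<Rightarrow> complex" and U :: "(nat \<times> real) set" and D :: diagram
    and i :: nat and a b :: real and \<nu> \<nu>' :: "real \<Rightarrow> complex"
  assumes P: "parametrizes n \<gamma> U D" and i: "i < n" and ab: "0 < a" "a < b" "b < 1"
    and simple: "t \<in> {a..b} \<Longrightarrow> (i, t) \<notin> double_params n \<gamma>"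
    and \<nu>: "t \<in> {a..b} \<Longrightarrow> (\<nu> has_vector_derivative \<nu>' t) (at t within {a..b})"
      "continuous_on {a..b} \<nu>'" "t \<in> {a..b} \<Longrightarrow> \<nu>' t \<noteq> 0"
    and ends: "\<nu> a = \<gamma> i a" "\<nu> b = \<gamma> i b"
      "\<nu>' a = vector_derivative (\<gamma> i) (at a)" "\<nu>' b = vector_derivative (\<gamma> i) (at b)"
    and inj: "inj_on \<nu> {a..b}"
    and new: "t \<in> {a<..<b} \<Longrightarrow> \<nu> t \<notin> pos \<gamma> ` (params n - {i} \<times> {a<..<b})"
    and disk: "t \<in> {a..b} \<Longrightarrow> \<nu> t \<in> ball 0 1"
begin

definition \<gamma>2 :: "nat \<Rightarrow> real \<Rightarrow> complex" where "\<gamma>2 = \<gamma>(i := replace_arc (\<gamma> i) a b \<nu>)"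

definition rest :: "(nat \<times> real) set" where "rest = params n - {i} \<times> {a<..<b}"

lemma arc_params: "t \<in> {a..b} \<Longrightarrow> (i, t) \<in> params n"
  using ab i by (auto simp: params_def)

lemma immersed_i: "immersed_circle (\<gamma> i)"
  by (rule generic_immersionD[OF parametrizesD(1)[OF P] i])

lemma arc_pos: "t \<in> {a..b} \<Longrightarrow> \<gamma>2 i t = \<nu> t"
  using ab by (simp add: \<gamma>2_def replace_arc_unit)

lemma rest_pos: assumes "x \<in> rest" shows "pos \<gamma>2 x = pos \<gamma> x"
    "vector_derivative (\<gamma>2 (fst x)) (at (snd x)) = vector_derivative (\<gamma> (fst x)) (at (snd x))"
proof -
  have "pos \<gamma>2 x = pos \<gamma> x \<and> vector_derivative (\<gamma>2 (fst x)) (at (snd x)) = vector_derivative (\<gamma> (fst x)) (at (snd x))"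
  proof (cases "fst x = i")
    case True
    then obtain t where t: "x = (i, t)" "0 \<le> t" "t < 1" "t \<notin> {a<..<b}"
      using assms unfolding rest_def params_def by (cases x) auto
    have vd: "vector_derivative (\<gamma>2 i) (at t) = replace_arc (\<lambda>t. vector_derivative (\<gamma> i) (at t)) a b \<nu>' t"
      unfolding \<gamma>2_def fun_upd_same by (rule replace_arc_C1(2)[OF immersed_i ab \<nu> ends])
    have "vector_derivative (\<gamma>2 i) (at t) = vector_derivative (\<gamma> i) (at t)"
      using t(4) ends unfolding vd replace_arc_unit[OF t(2,3)] by (auto simp: order_less_le)
    moreover have "\<gamma>2 i t = \<gamma> i t"
      using t(4) ends unfolding \<gamma>2_def fun_upd_same replace_arc_unit[OF t(2,3)] by (auto simp: order_less_le)
    ultimately show ?thesis using t(1) by (simp add: pos_def)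
  next
    case False
    then show ?thesis by (simp add: pos_def \<gamma>2_def)
  qed
  then show "pos \<gamma>2 x = pos \<gamma> x" "vector_derivative (\<gamma>2 (fst x)) (at (snd x)) = vector_derivative (\<gamma> (fst x)) (at (snd x))"
    by auto
qed

lemma rest_pdir: "x \<in> rest \<Longrightarrow> pdir \<gamma>2 x = pdir \<gamma> x"
  using rest_pos(2) by (simp add: pdir_def dir_def)

lemma params_split: "x \<in> params n \<Longrightarrow> x \<in> rest \<or> (\<exists>t. x = (i, t) \<and> t \<in> {a<..<b})"
  by (cases x) (auto simp: rest_def)

lemma double_rest: "double_params n \<gamma> \<subseteq> rest"
proof
  fix x assume x: "x \<in> double_params n \<gamma>"
  have "x \<notin> {i} \<times> {a<..<b}"
  proof
    assume "x \<in> {i} \<times> {a<..<b}"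
    then obtain t where "x = (i, t)" "t \<in> {a..b}" by (cases x) auto
    then show False using simple x by simp
  qed
  then show "x \<in> rest" using x unfolding rest_def double_params_def by blast
qed

lemma arc_new:
  assumes "t \<in> {a<..<b}" "y \<in> params n" "pos \<gamma>2 y = \<nu> t"
  shows "y = (i, t)"
  using params_split[OF assms(2)]
proof
  assume "y \<in> rest"
  then have "\<nu> t \<in> pos \<gamma> ` rest" using rest_pos(1) assms(3) by (metis imageI)
  then show ?thesis using new[OF assms(1)] by (simp add: rest_def)
next
  assume "\<exists>s. y = (i, s) \<and> s \<in> {a<..<b}"
  then obtain s where s: "y = (i, s)" "s \<in> {a<..<b}" by blast
  then have "\<nu> s = \<nu> t" using assms(3) arc_pos[of s] by (simp add: pos_def)
  then have "s = t" using inj_onD[OF inj, of s t] s assms(1) by auto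
  then show ?thesis using s by simp
qed

text \<open>An interior point of the new arc has a single parameter by \<open>arc_new\<close>, and
  the old arc carried no crossing; hence every coincidence, before or after, takes place in
  \<open>rest\<close>, where \<open>\<gamma>2\<close> and \<open>\<gamma>\<close> agree.\<close>

lemma double_eq: "double_params n \<gamma>2 = double_params n \<gamma>"
proof
  show "double_params n \<gamma>2 \<subseteq> double_params n \<gamma>"
  proof
    fix x assume "x \<in> double_params n \<gamma>2"
    then obtain y where xy: "x \<in> params n" "y \<in> params n" "y \<noteq> x" "pos \<gamma>2 y = pos \<gamma>2 x"
      unfolding double_params_def by blast
    have "z \<in> rest" if zw: "z \<in> params n" "w \<in> params n" "w \<noteq> z" "pos \<gamma>2 w = pos \<gamma>2 z" for z w
    proof (rule ccontr)
      assume "z \<notin> rest"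
      then obtain t where t: "z = (i, t)" "t \<in> {a<..<b}" using params_split[OF zw(1)] by blast
      then have "pos \<gamma>2 w = \<nu> t" using zw(4) arc_pos[of t] by (simp add: pos_def)
      from arc_new[OF t(2) zw(2) this] show False using t(1) zw(3) by simp
    qed
    from this[OF xy] this[OF xy(2,1) xy(3)[symmetric] xy(4)[symmetric]]
    have "pos \<gamma> y = pos \<gamma> x" using xy(4) rest_pos(1) by simp
    then show "x \<in> double_params n \<gamma>" using xy unfolding double_params_def by blast
  qed
  show "double_params n \<gamma> \<subseteq> double_params n \<gamma>2"
  proof
    fix x assume x: "x \<in> double_params n \<gamma>"
    then obtain y where xy: "x \<in> params n" "y \<in> params n" "y \<noteq> x" "pos \<gamma> y = pos \<gamma> x"
      unfolding double_params_def by blast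
    then have "y \<in> double_params n \<gamma>" unfolding double_params_def by force
    then have "pos \<gamma>2 y = pos \<gamma>2 x" using xy(4) rest_pos(1) double_rest x by (metis subsetD)
    then show "x \<in> double_params n \<gamma>2" using xy unfolding double_params_def by blast
  qed
qed

lemma same_pos:
  assumes "x \<in> params n" "y \<in> params n" "x \<noteq> y" "pos \<gamma>2 x = pos \<gamma>2 y"
  shows "x \<in> rest" "y \<in> rest" "pos \<gamma> x = pos \<gamma> y"
proof -
  have "x \<in> double_params n \<gamma>2" "y \<in> double_params n \<gamma>2"
    using assms unfolding double_params_def by force+
  then show "x \<in> rest" "y \<in> rest" unfolding double_eq using double_rest by blast+
  then show "pos \<gamma> x = pos \<gamma> y" using assms(4) rest_pos(1) by simp
qed

lemma generic2: "generic_immersion n \<gamma>2"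
proof -
  have g: "generic_immersion n \<gamma>" by (rule parametrizesD(1)[OF P])
  show ?thesis
    unfolding generic_immersion_def double_eq
  proof (intro conjI allI impI ballI)
    show "immersed_circle (\<gamma>2 j)" if "j < n" for j
      using generic_immersionD[OF g that] replace_arc_C1(1)[OF immersed_i ab \<nu> ends] by (simp add: \<gamma>2_def)
    show "finite (double_params n \<gamma>)" using g unfolding generic_immersion_def by blast
    show "x = y \<or> y = z \<or> x = z" if xyz: "x \<in> params n" "y \<in> params n" "z \<in> params n"
      "pos \<gamma>2 x = pos \<gamma>2 y \<and> pos \<gamma>2 y = pos \<gamma>2 z" for x y z
    proof (rule ccontr)
      assume ne: "\<not> (x = y \<or> y = z \<or> x = z)"
      then have "pos \<gamma> x = pos \<gamma> y" "pos \<gamma> y = pos \<gamma> z" using same_pos(3) xyz by auto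
      then show False using g xyz(1-3) ne unfolding generic_immersion_def by blast
    qed
    show "Im (cnj (pdir \<gamma>2 x) * pdir \<gamma>2 y) \<noteq> 0" if xy: "x \<in> params n" "y \<in> params n"
      "x \<noteq> y \<and> pos \<gamma>2 x = pos \<gamma>2 y" for x y
    proof -
      note S = same_pos[OF xy(1,2) conjunct1[OF xy(3)] conjunct2[OF xy(3)]]
      have "Im (cnj (pdir \<gamma> x) * pdir \<gamma> y) \<noteq> 0"
        using g xy(1,2) conjunct1[OF xy(3)] S(3) unfolding generic_immersion_def by blast
      then show ?thesis using S(1,2) rest_pdir by simp
    qed
  qed
qed

lemma image2: "pos \<gamma>2 ` params n = pos \<gamma> ` rest \<union> \<nu> ` {a..b}"
proof
  show "pos \<gamma>2 ` params n \<subseteq> pos \<gamma> ` rest \<union> \<nu> ` {a..b}"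
  proof
    fix z assume "z \<in> pos \<gamma>2 ` params n"
    then obtain x where x: "x \<in> params n" "z = pos \<gamma>2 x" by blast
    from params_split[OF x(1)] show "z \<in> pos \<gamma> ` rest \<union> \<nu> ` {a..b}"
    proof
      assume "x \<in> rest"
      then show ?thesis using x(2) rest_pos(1) by auto
    next
      assume "\<exists>t. x = (i, t) \<and> t \<in> {a<..<b}"
      then obtain t where "x = (i, t)" "t \<in> {a<..<b}" by blast
      then show ?thesis using x(2) arc_pos[of t] by (auto simp: pos_def)
    qed
  qed
  have "pos \<gamma> ` rest \<subseteq> pos \<gamma>2 ` params n"
  proof
    fix z assume "z \<in> pos \<gamma> ` rest"
    then obtain x where x: "x \<in> rest" "z = pos \<gamma> x" by blast
    then have "z = pos \<gamma>2 x" "x \<in> params n" using rest_pos(1)[OF x(1)] by (auto simp: rest_def)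
    then show "z \<in> pos \<gamma>2 ` params n" by blast
  qed
  moreover have "\<nu> ` {a..b} \<subseteq> pos \<gamma>2 ` params n"
  proof
    fix z assume "z \<in> \<nu> ` {a..b}"
    then obtain t where "t \<in> {a..b}" "z = \<nu> t" by blast
    then have "z = pos \<gamma>2 (i, t)" "(i, t) \<in> params n" using arc_pos arc_params by (auto simp: pos_def)
    then show "z \<in> pos \<gamma>2 ` params n" by blast
  qed
  ultimately show "pos \<gamma> ` rest \<union> \<nu> ` {a..b} \<subseteq> pos \<gamma>2 ` params n" by blast
qed

lemma image1: "pos \<gamma> ` params n = pos \<gamma> ` rest \<union> \<gamma> i ` {a..b}"
proof
  show "pos \<gamma> ` params n \<subseteq> pos \<gamma> ` rest \<union> \<gamma> i ` {a..b}"
  proof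
    fix z assume "z \<in> pos \<gamma> ` params n"
    then obtain x where x: "x \<in> params n" "z = pos \<gamma> x" by blast
    from params_split[OF x(1)] show "z \<in> pos \<gamma> ` rest \<union> \<gamma> i ` {a..b}"
      using x(2) by (auto simp: pos_def)
  qed
  have "\<gamma> i ` {a..b} \<subseteq> pos \<gamma> ` params n"
  proof
    fix z assume "z \<in> \<gamma> i ` {a..b}"
    then obtain t where "t \<in> {a..b}" "z = pos \<gamma> (i, t)" by (auto simp: pos_def)
    then show "z \<in> pos \<gamma> ` params n" using arc_params by blast
  qed
  then show "pos \<gamma> ` rest \<union> \<gamma> i ` {a..b} \<subseteq> pos \<gamma> ` params n" by (auto simp: rest_def)
qed

text \<open>Without arrows, because the same exchange is later combined with various arrow
  sets.\<close>

definition D2 :: diagram where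
  "D2 = \<lparr>shadow = pos \<gamma>2 ` params n, overs = overs D, arrows = {}\<rparr>"

lemma parametrizes2: "parametrizes n \<gamma>2 U D2"
  unfolding parametrizes_def
proof (intro conjI ballI impI)
  show "generic_immersion n \<gamma>2" by (rule generic2)
  show "shadow D2 = pos \<gamma>2 ` params n" by (simp add: D2_def)
  have "pos \<gamma> ` rest \<subseteq> ball 0 1"
    using parametrizesD(2,3)[OF P] by (auto simp: rest_def)
  then show "shadow D2 \<subseteq> interior B" using disk by (auto simp: D2_def image2)
  show "U \<subseteq> double_params n \<gamma>2" unfolding double_eq by (rule parametrizesD(4)[OF P])
  show "(x \<in> U) = (y \<notin> U)" if xy: "x \<in> params n" "y \<in> params n" "x \<noteq> y \<and> pos \<gamma>2 x = pos \<gamma>2 y" for x y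
    using parametrizesD(5)[OF P xy(1,2)] same_pos(3)[OF xy(1,2)] xy(3) by blast
  have "U \<subseteq> rest" using parametrizesD(4)[OF P] double_rest by blast
  then have eq: "(x \<in> U \<and> u \<in> {pdir \<gamma> x, - pdir \<gamma> x} \<and> w = (pos \<gamma> x, u)) =
     (x \<in> U \<and> u \<in> {pdir \<gamma>2 x, - pdir \<gamma>2 x} \<and> w = (pos \<gamma>2 x, u))" for x u w
  proof (cases "x \<in> U")
    case True
    then have "x \<in> rest" using \<open>U \<subseteq> rest\<close> by blast
    then show ?thesis by (simp add: rest_pos(1) rest_pdir)
  qed simp
  show "overs D2 = {(pos \<gamma>2 x, u) |x u. x \<in> U \<and> u \<in> {pdir \<gamma>2 x, - pdir \<gamma>2 x}}"
  proof (rule set_eqI)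
    fix w
    have "w \<in> overs D2 \<longleftrightarrow> (\<exists>x u. x \<in> U \<and> u \<in> {pdir \<gamma> x, - pdir \<gamma> x} \<and> w = (pos \<gamma> x, u))"
      unfolding D2_def diagram.simps parametrizesD(6)[OF P] by blast
    also have "\<dots> \<longleftrightarrow> w \<in> {(pos \<gamma>2 x, u) |x u. x \<in> U \<and> u \<in> {pdir \<gamma>2 x, - pdir \<gamma>2 x}}"
      unfolding eq by blast
    finally show "w \<in> overs D2 \<longleftrightarrow> w \<in> {(pos \<gamma>2 x, u) |x u. x \<in> U \<and> u \<in> {pdir \<gamma>2 x, - pdir \<gamma>2 x}}" .
  qed
qed

lemma arrows_ok2:
  assumes A: "arrows_ok n \<gamma> A" and dis: "fst ` A \<inter> \<gamma> i ` {a..b} = {}"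
  shows "arrows_ok n \<gamma>2 A"
proof -
  have "\<exists>x\<in>params n - double_params n \<gamma>2. q = pos \<gamma>2 x \<and> u \<in> {pdir \<gamma>2 x, - pdir \<gamma>2 x}" if qu: "(q, u) \<in> A" for q u
  proof -
    obtain x where x: "x \<in> params n - double_params n \<gamma>" "q = pos \<gamma> x" "u \<in> {pdir \<gamma> x, - pdir \<gamma> x}"
      using A qu unfolding arrows_ok_def by blast
    have "x \<in> rest"
    proof (rule ccontr)
      assume "x \<notin> rest"
      then obtain t where "x = (i, t)" "t \<in> {a<..<b}" using params_split x(1) by blast
      then have "q \<in> \<gamma> i ` {a..b}" using x(2) by (auto simp: pos_def)
      moreover have "q \<in> fst ` A" using qu by force
      ultimately show False using dis by blast
    qed
    show ?thesis
      unfolding double_eq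
      by (rule bexI[OF _ x(1)]) (use x(2,3) rest_pos(1)[OF \<open>x \<in> rest\<close>] rest_pdir[OF \<open>x \<in> rest\<close>] in simp)
  qed
  then show ?thesis using A unfolding arrows_ok_def by (simp add: case_prod_beta)
qed

end

section \<open>Opening a ray\<close>

text \<open>In logarithmic coordinates the preimage of \<open>Z\<close> is closed and the relevant
  part of the ray is a compact segment disjoint from it, so a positive distance separates them. This
  thickens a ray avoiding \<open>Z\<close> to a sector that also begins slightly below radius
  \<open>exp a1\<close>.\<close>

lemma sector_free:
  assumes Z: "compact Z" "\<And>z. z \<in> Z \<Longrightarrow> norm (z - q0) < exp A"
    and ray: "\<And>a. a1 \<le> a \<Longrightarrow> q0 + exp (Complex a \<theta>) \<notin> Z"
  shows "\<exists>\<kappa>>0. \<forall>p. a1 - \<kappa> \<le> Re p \<longrightarrow> \<bar>Im p - \<theta>\<bar> \<le> \<kappa> \<longrightarrow> q0 + exp p \<notin> Z"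
proof -
  define C where "C = (\<lambda>p. q0 + exp p) -` Z"
  \<comment> \<open>Beyond logarithmic radius \<open>A\<close> there is no point of
    \<open>Z\<close>, so a segment represents the whole ray.\<close>
  define S where "S = (\<lambda>a. Complex a \<theta>) ` {a1..max A a1}"
  have "closed C"
    unfolding C_def by (intro continuous_closed_vimage compact_imp_closed Z) (intro continuous_intros)
  moreover have "compact S"
    unfolding S_def Complex_eq by (intro compact_continuous_image continuous_intros) auto
  moreover have "S \<inter> C = {}" using ray unfolding S_def C_def by auto
  ultimately obtain d where d: "0 < d" "\<forall>x\<in>S. \<forall>y\<in>C. d \<le> dist x y"
    using separate_compact_closed[of S C] by auto
  \<comment> \<open>Radius and angle each deviate from the segment by at most a third of
    \<open>d\<close>, which keeps the distance below \<open>d\<close>.\<close>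
  have "q0 + exp p \<notin> Z" if p: "a1 - d / 3 \<le> Re p" "\<bar>Im p - \<theta>\<bar> \<le> d / 3" for p
  proof
    assume "q0 + exp p \<in> Z"
    then have "p \<in> C" "Re p < A" using Z(2) by (force simp: C_def)+
    define q where "q = Complex (max (Re p) a1) \<theta>"
    have "q \<in> S" unfolding S_def q_def by (rule imageI) (use \<open>Re p < A\<close> in auto)
    then have "d \<le> dist q p" using d(2) \<open>p \<in> C\<close> by blast
    also have "\<dots> \<le> \<bar>Re (q - p)\<bar> + \<bar>Im (q - p)\<bar>" unfolding dist_norm by (rule cmod_le)
    also have "\<dots> \<le> d / 3 + d / 3"
    proof (rule add_mono)
      show "\<bar>Re (q - p)\<bar> \<le> d / 3" using p(1) d(1) by (auto simp: q_def)
      show "\<bar>Im (q - p)\<bar> \<le> d / 3" using p(2) by (simp add: q_def abs_minus_commute)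
    qed
    finally show False using d(1) by simp
  qed
  then show ?thesis using d(1) by (intro exI[of _ "d / 3"]) auto
qed

lemma positive_near:
  fixes f :: "real \<Rightarrow> real"
  assumes "isCont f x" "0 < f x"
  shows "\<exists>d>0. \<forall>y. \<bar>y - x\<bar> \<le> d \<longrightarrow> 0 < f y"
proof -
  obtain d where "d > 0" "\<And>y. \<bar>y - x\<bar> < d \<Longrightarrow> \<bar>f y - f x\<bar> < f x"
    using assms unfolding continuous_at_eps_delta dist_real_def by (metis abs_minus_commute)
  then have "0 < f y" if "\<bar>y - x\<bar> \<le> d / 2" for y
    using that \<open>d > 0\<close> by (smt (verit) field_sum_of_halves)
  then show ?thesis using \<open>d > 0\<close> by (intro exI[of _ "d / 2"]) auto
qed

text \<open>Matches the arch with the exchange of an arc of the diagram. Clockwise arrows on the new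
  arc count \<open>\<sigma>\<close> times their number along the circle. \<open>S\<close> is chosen
  before the arrow set \<open>A\<close>, so one arc with one decoration serves diagrams that differ
  in their other arrows.\<close>

lemma Omega_inf_arch:
  assumes R: "arc_replacement n \<gamma> U D i (t1 - \<delta>) (t1 + \<delta>) \<nu> \<nu>'"
    and Q: "arch q0 \<theta> A lo \<kappa> \<delta> \<delta>1 L L' Z \<beta> \<beta>'"
    and \<sigma>: "\<sigma> = 1 \<or> \<sigma> = (-1 :: int)"
    and lam: "\<And>u. u \<in> {-\<delta>1..\<delta>1} \<Longrightarrow> \<gamma> i (t1 + of_int \<sigma> * u) = q0 + exp (L u)"
    and nu: "\<And>t. t \<in> {t1 - \<delta>..t1 + \<delta>} \<Longrightarrow> \<nu> t = arch.mu q0 A \<delta> L \<beta> (of_int \<sigma> * (t - t1))"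
    and Z: "pos \<gamma> ` (params n - {i} \<times> {t1 - \<delta>1..t1 + \<delta>1}) \<subseteq> Z"
  shows "\<exists>S. signed S \<and> sum snd S = \<sigma> * p \<and>
    (\<forall>A. arrows_ok n \<gamma> A \<longrightarrow> fst ` A \<inter> \<gamma> i ` {t1 - \<delta>..t1 + \<delta>} = {} \<longrightarrow>
       Omega_inf p (D\<lparr>arrows := A\<rparr>)
         ((arc_replacement.D2 n \<gamma> D i (t1 - \<delta>) (t1 + \<delta>) \<nu>)
           \<lparr>arrows := A \<union> put (\<lambda>s. arc_replacement.\<gamma>2 \<gamma> i (t1 - \<delta>) (t1 + \<delta>) \<nu> i (t1 - \<delta> + 2 * \<delta> * s)) S\<rparr>))"
proof -
  interpret R: arc_replacement n \<gamma> U D i "t1 - \<delta>" "t1 + \<delta>" \<nu> \<nu>' by (rule R)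
  interpret Q: arch q0 \<theta> A lo \<kappa> \<delta> \<delta>1 L L' Z \<beta> \<beta>' by (rule Q)
  let ?a = "t1 - \<delta>" and ?b = "t1 + \<delta>"
  have \<delta>: "0 < \<delta>" "\<delta> \<le> \<delta>1" by (fact Q.\<delta>)+
  define s where "s = real_of_int \<sigma>"
  have s: "s = 1 \<or> s = -1" "sgn s = s" "s * s = 1" "s \<noteq> 0" using \<sigma> by (auto simp: s_def)
  \<comment> \<open>For \<open>\<sigma> = -1\<close> this affine map reverses the circle, so that
    \<open>g\<close> crosses the ray counterclockwise and \<open>h\<close> runs clockwise, as
    \<open>Omega_inf\<close> demands; \<open>h0\<close> keeps the direction of the circle.\<close>
  define p0 m where "p0 = t1 - s * \<delta>" and "m = 2 * \<delta> * s"
  define g h h0 where "g x = \<gamma> i (p0 + m * x)" and "h x = R.\<gamma>2 i (p0 + m * x)"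
    and "h0 x = R.\<gamma>2 i (t1 - \<delta> + 2 * \<delta> * x)" for x
  have pm: "p0 + m * x = t1 + s * (- \<delta> + 2 * \<delta> * x)" for x
    by (simp add: p0_def m_def algebra_simps)
  have pm_in: "p0 + m * x \<in> {?a..?b}" if "x \<in> {0..1}" for x
  proof -
    have "\<bar>s * (- \<delta> + 2 * \<delta> * x)\<bar> \<le> \<delta>" using Q.affine_in[OF that] s(1) by auto
    then show ?thesis unfolding pm by (auto simp: abs_le_iff)
  qed
  have rng: "s * (t - t1) \<in> {-\<delta>..\<delta>}" if "t \<in> {?a..?b}" for t
    using that s(1) by auto
  have bk: "t1 + s * (s * (t - t1)) = t" for t using s(3) by (simp add: mult.assoc[symmetric])
  have gE: "\<gamma> i t = Q.E (L (s * (t - t1)))" if "t \<in> {?a..?b}" for t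
    using lam[of "s * (t - t1)"] rng[OF that] \<delta> unfolding s_def[symmetric] bk Q.E_def by auto
  have hmu: "R.\<gamma>2 i t = Q.mu (s * (t - t1))" if "t \<in> {?a..?b}" for t
    using R.arc_pos[OF that] nu[OF that] unfolding s_def by simp
  have un: "s * (p0 + m * x - t1) = - \<delta> + 2 * \<delta> * x" for x
    unfolding pm using s(3) by (simp add: mult.assoc[symmetric])
  have gs: "g x = Q.strand_path x" and hs: "h x = Q.arch_path x" if "x \<in> {0..1}" for x
    using gE[OF pm_in[OF that]] hmu[OF pm_in[OF that]] unfolding un
    by (simp_all add: g_def h_def Q.strand_path_def Q.arch_path_def)
  have pig: "path_image g = path_image Q.strand_path" and pih: "path_image h = path_image Q.arch_path"
    unfolding path_image_def using gs hs by auto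
  have "(\<lambda>x. p0 + m * x) ` {0..1} = {?a..?b}"
  proof
    show "(\<lambda>x. p0 + m * x) ` {0..1} \<subseteq> {?a..?b}" using pm_in by blast
    show "{?a..?b} \<subseteq> (\<lambda>x. p0 + m * x) ` {0..1}"
    proof
      fix t assume t: "t \<in> {?a..?b}"
      obtain x where x: "x \<in> {0..1}" "s * (t - t1) = - \<delta> + 2 * \<delta> * x"
        using rng[OF t] unfolding Q.affine_image[symmetric] by blast
      have "t = p0 + m * x" unfolding pm x(2)[symmetric] bk ..
      then show "t \<in> (\<lambda>x. p0 + m * x) ` {0..1}" using x(1) by blast
    qed
  qed
  then have pig': "path_image g = \<gamma> i ` {?a..?b}" and pih': "path_image h = R.\<gamma>2 i ` {?a..?b}"
    unfolding path_image_def g_def h_def by (metis image_image)+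
  have simp_i: "y = (i, t)" if "t \<in> {?a..?b}" "y \<in> params n" "pos \<gamma> y = \<gamma> i t" for t y
    using R.simple[OF that(1)] R.arc_params[OF that(1)] that unfolding double_params_def
    by (auto simp: pos_def)
  have inj_g: "inj_on (\<gamma> i) {?a..?b}"
  proof (rule inj_onI)
    fix t t' assume "t \<in> {?a..?b}" "t' \<in> {?a..?b}" "\<gamma> i t = \<gamma> i t'"
    then show "t = t'" using simp_i[of t "(i, t')"] R.arc_params by (auto simp: pos_def)
  qed
  have inj_h: "inj_on (R.\<gamma>2 i) {?a..?b}"
  proof (rule inj_onI)
    fix t t' assume t: "t \<in> {?a..?b}" "t' \<in> {?a..?b}" "R.\<gamma>2 i t = R.\<gamma>2 i t'"
    then have "\<nu> t = \<nu> t'" using R.arc_pos[OF t(1)] R.arc_pos[OF t(2)] by simp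
    then show "t = t'" using t(1,2) by (rule inj_onD[OF R.inj])
  qed
  have m: "m \<noteq> 0" "sgn m = s" using \<delta> s by (auto simp: m_def sgn_mult)
  have ig: "immersed_circle (\<gamma> i)" and ih: "immersed_circle (R.\<gamma>2 i)"
    using R.immersed_i generic_immersionD[OF R.generic2 R.i] by auto
  have Eg: "embedded_path g"
    unfolding g_def
    by (rule embedded_affine(1)[OF immersed_circleD(2)[OF ig] continuous_on_subset[OF immersed_circleD(3)[OF ig]]
          immersed_circleD(4)[OF ig] inj_g pm_in m(1)]) simp
  have Eh: "embedded_path h" and dh: "x \<in> {0..1} \<Longrightarrow> dir h x = of_real s * dir (R.\<gamma>2 i) (p0 + m * x)" for x
    using embedded_affine[OF immersed_circleD(2)[OF ih] continuous_on_subset[OF immersed_circleD(3)[OF ih]]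
          immersed_circleD(4)[OF ih] inj_h pm_in m(1)] m(2) unfolding h_def by auto
  have in0: "t1 - \<delta> + 2 * \<delta> * x \<in> {?a..?b}" if "x \<in> {0..1}" for x
    using Q.affine_in[OF that] by auto
  have d2: "sgn (2 * \<delta>) = 1" "2 * \<delta> \<noteq> 0" using \<delta> by auto
  note E0 = embedded_affine[OF immersed_circleD(2)[OF ih] continuous_on_subset[OF immersed_circleD(3)[OF ih]]
          immersed_circleD(4)[OF ih] inj_h in0 d2(2), folded h0_def]
  have Eh0: "embedded_path h0" using E0(1) by (simp add: h0_def[abs_def])
  have dh0: "dir h0 x = dir (R.\<gamma>2 i) (t1 - \<delta> + 2 * \<delta> * x)" if "x \<in> {0..1}" for x
    using E0(2)[OF subset_UNIV _ that] d2(1) by simp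
  have pi0: "path_image h0 = path_image h"
  proof -
    have "(\<lambda>x. t1 - \<delta> + 2 * \<delta> * x) ` {0..1} = (\<lambda>y. t1 + y) ` ((\<lambda>x. - \<delta> + 2 * \<delta> * x) ` {0..1})"
      unfolding image_image by (simp add: algebra_simps)
    also have "\<dots> = {?a..?b}" unfolding Q.affine_image by (simp add: image_add_atLeastAtMost)
    finally show ?thesis unfolding pih' unfolding path_image_def h0_def by (metis image_image)
  qed
  define Zs where "Zs = pos \<gamma> ` R.rest"
  have e: "{pathstart g, pathfinish g} = {\<gamma> i ?a, \<gamma> i ?b}"
  proof -
    have "g 0 = \<gamma> i (t1 - s * \<delta>)" "g 1 = \<gamma> i (t1 + s * \<delta>)"
      by (simp_all add: g_def p0_def m_def algebra_simps)
    then show ?thesis using s(1) by (auto simp: pathstart_def pathfinish_def)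
  qed
  have same: "same_ends g h"
    unfolding same_ends_def pathstart_def pathfinish_def using gs[of 0] gs[of 1] hs[of 0] hs[of 1] Q.ends_paths
    by (simp add: pathstart_def pathfinish_def)
  have shD: "shadow D = Zs \<union> path_image g"
    unfolding parametrizesD(2)[OF R.P] R.image1 pig' Zs_def ..
  have shD2: "shadow R.D2 = Zs \<union> path_image h"
  proof -
    have "\<nu> ` {?a..?b} = R.\<gamma>2 i ` {?a..?b}" using R.arc_pos by (intro image_cong) auto
    then show ?thesis unfolding R.D2_def pih' Zs_def by (simp add: R.image2)
  qed
  have "(i, ?a) \<in> R.rest" "(i, ?b) \<in> R.rest"
    using R.arc_params[of ?a] R.arc_params[of ?b] \<delta> by (auto simp: R.rest_def)
  then have ends_Zs: "\<gamma> i ?a \<in> Zs" "\<gamma> i ?b \<in> Zs" unfolding Zs_def by (force simp: pos_def)+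
  have ab_in: "?a \<in> {?a..?b}" "?b \<in> {?a..?b}" using \<delta> by auto
  have Zg: "Zs \<inter> path_image g = {pathstart g, pathfinish g}"
    unfolding e
  proof
    show "Zs \<inter> path_image g \<subseteq> {\<gamma> i ?a, \<gamma> i ?b}"
    proof
      fix z assume "z \<in> Zs \<inter> path_image g"
      then obtain x t where x: "x \<in> R.rest" "z = pos \<gamma> x" "t \<in> {?a..?b}" "z = \<gamma> i t"
        unfolding Zs_def pig' by blast
      have "x = (i, t)" by (rule simp_i) (use x in \<open>auto simp: R.rest_def\<close>)
      then have "t \<notin> {?a<..<?b}" using x(1) by (auto simp: R.rest_def)
      then have "t = ?a \<or> t = ?b" using x(3) by auto
      then show "z \<in> {\<gamma> i ?a, \<gamma> i ?b}" using x(4) by blast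
    qed
    have "\<gamma> i ?a \<in> path_image g" "\<gamma> i ?b \<in> path_image g" unfolding pig' using ab_in by blast+
    then show "{\<gamma> i ?a, \<gamma> i ?b} \<subseteq> Zs \<inter> path_image g" using ends_Zs by blast
  qed
  have Zh: "Zs \<inter> path_image h = {pathstart g, pathfinish g}"
    unfolding e
  proof
    show "Zs \<inter> path_image h \<subseteq> {\<gamma> i ?a, \<gamma> i ?b}"
    proof
      fix z assume z: "z \<in> Zs \<inter> path_image h"
      then obtain t where t: "t \<in> {?a..?b}" "z = \<nu> t"
        unfolding pih' using R.arc_pos by auto
      have "t \<notin> {?a<..<?b}"
      proof
        assume "t \<in> {?a<..<?b}"
        from R.new[OF this] have "\<nu> t \<notin> Zs" unfolding Zs_def R.rest_def .
        then show False using z t(2) by simp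
      qed
      then have "t = ?a \<or> t = ?b" using t(1) by auto
      then show "z \<in> {\<gamma> i ?a, \<gamma> i ?b}" using t(2) R.ends by auto
    qed
    have "\<nu> ?a \<in> path_image h" "\<nu> ?b \<in> path_image h"
      unfolding pih' using ab_in R.arc_pos[OF ab_in(1)] R.arc_pos[OF ab_in(2)] by (metis imageI)+
    then show "{\<gamma> i ?a, \<gamma> i ?b} \<subseteq> Zs \<inter> path_image h" using ends_Zs R.ends(1,2) by auto
  qed
  have gh: "path_image g \<inter> path_image h = {pathstart g, pathfinish g}"
    unfolding pig pih Q.strand_arch_Int pathstart_def pathfinish_def using gs[of 0] gs[of 1] by simp
  have crg: "path_image g \<inter> crossings D = {}"
    unfolding crossings_eq[OF R.P]
  proof (rule equals0I)
    fix z assume "z \<in> path_image g \<inter> pos \<gamma> ` double_params n \<gamma>"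
    then obtain x t where x: "x \<in> double_params n \<gamma>" "z = pos \<gamma> x" "t \<in> {?a..?b}" "z = \<gamma> i t"
      unfolding pig' by blast
    have "x = (i, t)" by (rule simp_i) (use x in \<open>auto simp: double_params_def\<close>)
    then show False using R.simple[OF x(3)] x(1) by simp
  qed
  have crD2: "crossings R.D2 = crossings D" by (simp add: crossings_def R.D2_def)
  have "crossings D \<subseteq> Zs" unfolding crossings_eq[OF R.P] Zs_def using R.double_rest by blast
  then have crh: "path_image h \<inter> crossings D = {}" using Zh Zg crg by blast
  have ins: "Zs - {pathstart g, pathfinish g} \<subseteq> inside (path_image g \<union> path_image h)"
  proof
    fix z assume z: "z \<in> Zs - {pathstart g, pathfinish g}"
    then obtain x where x: "x \<in> R.rest" "z = pos \<gamma> x" unfolding Zs_def by blast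
    show "z \<in> inside (path_image g \<union> path_image h)"
    \<comment> \<open>The remaining curves consist of the rest of the strand in the wider window,
      enclosed by monotonicity of the angle, and of points of \<open>Z\<close>.\<close>
    proof (cases "x \<in> {i} \<times> {t1 - \<delta>1..t1 + \<delta>1}")
      case True
      then obtain t where t: "x = (i, t)" "t \<in> {t1 - \<delta>1..t1 + \<delta>1}" by auto
      have u: "s * (t - t1) \<in> {-\<delta>1..\<delta>1}" using t(2) s(1) by auto
      have zE: "z = Q.E (L (s * (t - t1)))"
        using lam[OF u] unfolding s_def[symmetric] bk Q.E_def x(2) t(1) pos_def by simp
      have "t \<noteq> ?a" "t \<noteq> ?b" using z unfolding e x(2) t(1) pos_def by auto
      moreover have "t \<notin> {?a<..<?b}" using x(1) t(1) by (auto simp: R.rest_def)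
      ultimately have "s * (t - t1) \<notin> {-\<delta>..\<delta>}" using s(1) by auto
      from Q.arch_encloses(2)[OF u this] show ?thesis unfolding zE pig pih .
    next
      case False
      then have "z \<in> pos \<gamma> ` (params n - {i} \<times> {t1 - \<delta>1..t1 + \<delta>1})" using x unfolding R.rest_def by blast
      then show ?thesis using Z Q.arch_encloses(1) unfolding pig pih by blast
    qed
  qed
  have wind: "\<forall>z \<in> inside (path_image g \<union> path_image h). winding_number (h +++ reversepath g) z = -1"
  proof
    fix z assume "z \<in> inside (path_image g \<union> path_image h)"
    then have "winding_number Q.loop z = -1" unfolding pig pih by (rule Q.arch_encloses(3))
    moreover have "winding_number (h +++ reversepath g) z = winding_number Q.loop z"
      by (rule winding_number_cong) (auto simp: joinpaths_def reversepath_def gs hs)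
    ultimately show "winding_number (h +++ reversepath g) z = -1" by simp
  qed
  obtain T :: "real set" where T: "finite T" "card T = nat \<bar>p\<bar>" "T \<subseteq> {0<..<1}" "sum snd (T \<times> {int_sign p}) = p"
    using signed_of_sum[of "{}" 0 1 p] by auto
  \<comment> \<open>Translates parameters of \<open>h\<close> into parameters of \<open>h0\<close>,
    which run in opposite directions if \<open>\<sigma> = -1\<close>.\<close>
  define fl where "fl x = (if s = 1 then x else 1 - x)" for x :: real
  have fl: "inj_on fl T" "fl ` T \<subseteq> {0<..<1}" using T(3) by (auto simp: fl_def inj_on_def)
  have hfl: "h x = h0 (fl x)" "x \<in> {0..1} \<Longrightarrow> dir h x = of_real s * dir h0 (fl x)" for x
  proof -
    have q: "p0 + m * x = t1 - \<delta> + 2 * \<delta> * fl x"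
      using s(1) unfolding pm fl_def by (auto simp: algebra_simps)
    show "h x = h0 (fl x)" unfolding h_def h0_def q ..
    show "dir h x = of_real s * dir h0 (fl x)" if "x \<in> {0..1}"
    proof -
      have "fl x \<in> {0..1}" using that by (auto simp: fl_def)
      from dh0[OF this] dh[OF that] show ?thesis unfolding q by simp
    qed
  qed
  define S where "S = fl ` T \<times> {\<sigma> * int_sign p}"
  have S1: "signed S" unfolding S_def
    by (rule signed_uniform) (use T(1) fl \<sigma> in \<open>auto simp: int_sign_def\<close>)
  have S2: "sum snd S = \<sigma> * p"
    using T(4) unfolding S_def sum_snd_uniform card_image[OF fl(1)] by (simp add: mult_ac)
  have putS: "put h0 S = (\<lambda>t. (h t, if p \<ge> 0 then dir h t else - dir h t)) ` T"
  proof -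
    have "(h0 (fl t), of_int (\<sigma> * int_sign p) * dir h0 (fl t)) = (h t, if p \<ge> 0 then dir h t else - dir h t)"
      if "t \<in> T" for t
    proof -
      have "t \<in> {0..1}" using that T(3) by auto
      from hfl(2)[OF this] show ?thesis using hfl(1)[of t] by (simp add: int_sign_def s_def)
    qed
    then show ?thesis unfolding S_def put_uniform image_image by (rule image_cong[OF refl])
  qed
  have "Omega_inf p (D\<lparr>arrows := A\<rparr>) (R.D2\<lparr>arrows := A \<union> put h0 S\<rparr>)"
    if A: "arrows_ok n \<gamma> A" and dis: "fst ` A \<inter> \<gamma> i ` {?a..?b} = {}" for A
    unfolding Omega_inf_def
  proof (intro conjI exI)
    have "parametrizes n \<gamma> U (D\<lparr>arrows := A\<rparr>)" by (rule parametrizes_cong[OF R.P]) simp_all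
    then show "arrow_diagram (D\<lparr>arrows := A\<rparr>)" using A arrow_diagram_iff by fastforce
    have P2: "parametrizes n R.\<gamma>2 U (R.D2\<lparr>arrows := A \<union> put h0 S\<rparr>)"
      by (rule parametrizes_cong[OF R.parametrizes2]) simp_all
    have "arrows_ok n R.\<gamma>2 (A \<union> put h0 S)"
    proof (rule arrows_ok_put[OF R.parametrizes2 R.arrows_ok2[OF A dis] Eh0 _ _ S1])
      show "path_image h0 \<subseteq> shadow R.D2" unfolding pi0 shD2 by blast
      show "path_image h0 \<inter> crossings R.D2 = {}" unfolding pi0 crD2 by (rule crh)
      have "fst ` A \<subseteq> shadow D"
        using A unfolding arrows_ok_def parametrizesD(2)[OF R.P] by fastforce
      then have A1: "fst ` A \<subseteq> Zs" "fst ` A \<inter> path_image g = {}" using dis unfolding shD pig' by blast+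
      have "h0 ` fst ` S \<subseteq> path_image h0" using signed_fst[OF S1] unfolding path_image_def by auto
      then have "h0 ` fst ` S \<inter> Zs \<subseteq> {pathstart g, pathfinish g}" using Zh unfolding pi0 by blast
      moreover have "{pathstart g, pathfinish g} \<subseteq> path_image g" using Zg by blast
      ultimately show "h0 ` fst ` S \<inter> fst ` A = {}" using A1 by blast
    qed
    then show "arrow_diagram (R.D2\<lparr>arrows := A \<union> put h0 S\<rparr>)"
      using P2 arrow_diagram_iff by fastforce
    show "overs (R.D2\<lparr>arrows := A \<union> put h0 S\<rparr>) = overs (D\<lparr>arrows := A\<rparr>)" by (simp add: R.D2_def)
    show "shadow (D\<lparr>arrows := A\<rparr>) = Zs \<union> path_image g" using shD by simp
    show "shadow (R.D2\<lparr>arrows := A \<union> put h0 S\<rparr>) = Zs \<union> path_image h" using shD2 by simp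
    show "path_image g \<inter> crossings (D\<lparr>arrows := A\<rparr>) = {}" using crg by (simp add: crossings_def)
    show "path_image g \<inter> arrow_points (D\<lparr>arrows := A\<rparr>) = {}"
      using dis unfolding pig' arrow_points_def by auto
    show "arrows (R.D2\<lparr>arrows := A \<union> put h0 S\<rparr>) = arrows (D\<lparr>arrows := A\<rparr>) \<union>
        (\<lambda>t. (h t, if p \<ge> 0 then dir h t else - dir h t)) ` T"
      using putS by simp
  qed (fact Eg Eh same Zg Zh gh ins wind T)+
  then show ?thesis using S1 S2 unfolding h0_def[abs_def] by blast
qed

text \<open>At the outermost, transverse intersection with the ray all hypotheses of the arch can be
  met. The constants are chosen in the order \<open>\<delta>1\<close>, \<open>Z\<close>,
  \<open>\<kappa>\<close>, \<open>\<delta>\<close>: the sector depends on the rest of the diagram,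
  which depends on how much of the strand is set apart, and the exchanged arc must be short enough
  for the sector.\<close>

theorem outer_arch:
  assumes P: "parametrizes n \<gamma> U D" and i: "i < n" and t1: "0 < t1" "t1 < 1"
    and simple: "(i, t1) \<notin> double_params n \<gamma>"
    and sh: "shadow D \<subseteq> ball q0 R" and RB: "ball q0 R \<subseteq> ball 0 1"
    and p: "\<gamma> i t1 = q0 + exp (Complex a1 \<theta>)"
    and trans: "Im (vector_derivative (\<gamma> i) (at t1) / exp (Complex a1 \<theta>)) \<noteq> 0"
    and ray: "\<And>y a. y \<in> params n \<Longrightarrow> a1 \<le> a \<Longrightarrow> pos \<gamma> y = q0 + exp (Complex a \<theta>) \<Longrightarrow> y = (i, t1)"
    and "0 < \<epsilon>"
  obtains a b \<nu> \<nu>' \<sigma> where "arc_replacement n \<gamma> U D i a b \<nu> \<nu>'" "t1 - \<epsilon> < a" "a < t1" "t1 < b" "b < t1 + \<epsilon>"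
    "\<sigma> = 1 \<or> \<sigma> = (-1 :: int)"
    "\<And>t. t \<in> {a..b} \<Longrightarrow> \<nu> t \<in> ball q0 R" "\<And>t c. t \<in> {a..b} \<Longrightarrow> \<nu> t \<noteq> q0 + exp (Complex c \<theta>)"
    "\<And>p. \<exists>S. signed S \<and> sum snd S = \<sigma> * p \<and>
      (\<forall>A. arrows_ok n \<gamma> A \<longrightarrow> fst ` A \<inter> \<gamma> i ` {a..b} = {} \<longrightarrow>
         Omega_inf p (D\<lparr>arrows := A\<rparr>)
           ((arc_replacement.D2 n \<gamma> D i a b \<nu>)
             \<lparr>arrows := A \<union> put (\<lambda>s. arc_replacement.\<gamma>2 \<gamma> i a b \<nu> i (a + (b - a) * s)) S\<rparr>))"
proof -
  define g g' where "g = \<gamma> i" and "g' t = vector_derivative (\<gamma> i) (at t)" for t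
  have gi: "generic_immersion n \<gamma>" by (rule parametrizesD(1)[OF P])
  have ic: "immersed_circle g" unfolding g_def by (rule generic_immersionD[OF gi i])
  have Dg: "(g has_vector_derivative g' t) (at t)" and Cg': "continuous_on UNIV g'" for t
    using immersed_circleD(2,3)[OF ic] unfolding g_def g'_def by auto
  define w0 where "w0 = exp (Complex a1 \<theta>)"
  have w0: "w0 \<noteq> 0" "g t1 - q0 = w0" using p by (auto simp: w0_def g_def)
  \<comment> \<open>\<open>Im (g' t1 / w0)\<close> is the angular velocity of the circle about
    \<open>q0\<close>; its sign tells whether the ray is crossed counterclockwise.\<close>
  define \<sigma> :: int where "\<sigma> = (if Im (g' t1 / w0) > 0 then 1 else -1)"
  define s where "s = real_of_int \<sigma>"
  have \<sigma>: "\<sigma> = 1 \<or> \<sigma> = -1" and s: "s = 1 \<or> s = -1" "s * s = 1" by (auto simp: \<sigma>_def s_def)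
  have spos: "0 < Im (s *\<^sub>R g' t1 / w0)"
    using trans unfolding s_def \<sigma>_def g'_def w0_def by auto
  define v where "v = exp (Complex 0 \<theta>)"
  have v: "v \<noteq> 0" "norm v = 1" "w0 = of_real (exp a1) * v"
    by (auto simp: v_def w0_def exp_of_real[symmetric] exp_add[symmetric] Complex_eq)
  define \<alpha> \<alpha>' where "\<alpha> u = g (t1 + s * u)" and "\<alpha>' u = s *\<^sub>R g' (t1 + s * u)" for u
  have D\<alpha>: "(\<alpha> has_vector_derivative \<alpha>' u) (at u)" for u
    unfolding \<alpha>_def[abs_def] \<alpha>'_def by (rule has_vector_derivative_affine[OF Dg])
  have C\<alpha>: "continuous_on S \<alpha>" for S
    using D\<alpha> by (meson continuous_at_imp_continuous_on has_vector_derivative_continuous)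
  have C\<alpha>': "continuous_on S \<alpha>'" for S
    unfolding \<alpha>'_def by (intro continuous_intros continuous_on_compose2[OF Cg']) auto
  have \<alpha>0: "\<alpha> 0 - q0 = w0" using w0 by (simp add: \<alpha>_def)
  \<comment> \<open>Division by \<open>v\<close> turns the ray onto the positive real axis, where
    the principal logarithm is smooth.\<close>
  define W where "W u = (\<alpha> u - q0) / v" for u
  have CW: "continuous_on S W" for S unfolding W_def using v by (intro continuous_intros C\<alpha>) auto
  have W0: "W 0 = of_real (exp a1)" unfolding W_def \<alpha>0 using v by simp
  have "isCont W 0" using CW[of UNIV] by (simp add: continuous_on_eq_continuous_at)
  then have c1: "isCont (\<lambda>u. Re (W u)) 0" unfolding isCont_def by (rule tendsto_Re)
  have "0 < Re (W 0)" unfolding W0 by simp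
  from positive_near[OF c1 this]
  obtain da where da: "0 < da" "\<And>u. \<bar>u - 0\<bar> \<le> da \<Longrightarrow> 0 < Re (W u)" by blast
  have "isCont \<alpha> 0" "isCont \<alpha>' 0"
    using C\<alpha>[of UNIV] C\<alpha>'[of UNIV] by (simp_all add: continuous_on_eq_continuous_at)
  moreover have "\<alpha> 0 - q0 \<noteq> 0" unfolding \<alpha>0 by (rule w0(1))
  ultimately have c2: "isCont (\<lambda>u. Im (\<alpha>' u / (\<alpha> u - q0))) 0"
    unfolding isCont_def by (intro tendsto_Im tendsto_divide tendsto_diff tendsto_const)
  have "0 < Im (\<alpha>' 0 / (\<alpha> 0 - q0))" unfolding \<alpha>0 using spos by (simp add: \<alpha>'_def)
  from positive_near[OF c2 this]
  obtain db where db: "0 < db" "\<And>u. \<bar>u - 0\<bar> \<le> db \<Longrightarrow> 0 < Im (\<alpha>' u / (\<alpha> u - q0))" by blast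
  have "finite (double_params n \<gamma>)" using gi by (simp add: generic_immersion_def)
  then have "finite (snd ` double_params n \<gamma>)" by (rule finite_imageI)
  from finite_set_avoid[OF this, of t1]
  obtain dc where dc: "0 < dc" "\<And>t. t \<in> snd ` double_params n \<gamma> \<Longrightarrow> t \<noteq> t1 \<Longrightarrow> dc \<le> dist t1 t" by blast
  \<comment> \<open>Within \<open>\<delta>1\<close> the strand stays in the half plane around the
    ray, turns counterclockwise about \<open>q0\<close>, has no crossing, and its parameters remain
    near \<open>t1\<close> and inside \<open>{0<..<1}\<close>.\<close>
  define \<delta>1 where "\<delta>1 = min (min da db) (min (dc / 2) (min (\<epsilon> / 2) (min (t1 / 2) ((1 - t1) / 2))))"
  have \<delta>1: "0 < \<delta>1" "\<delta>1 \<le> da" "\<delta>1 \<le> db" "\<delta>1 < dc" "\<delta>1 < \<epsilon>" "\<delta>1 < t1" "t1 + \<delta>1 < 1"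
    using da(1) db(1) dc(1) \<open>0 < \<epsilon>\<close> t1 unfolding \<delta>1_def by (auto simp: min_def field_simps)
  have simple1: "(i, t) \<notin> double_params n \<gamma>" if "t \<in> {t1 - \<delta>1..t1 + \<delta>1}" for t
  proof
    assume d: "(i, t) \<in> double_params n \<gamma>"
    then have "t \<noteq> t1" using simple by auto
    moreover have "t \<in> snd ` double_params n \<gamma>" using d by force
    ultimately have "dc \<le> dist t1 t" using dc(2) by blast
    then show False using that \<delta>1(4) by (auto simp: dist_real_def)
  qed
  \<comment> \<open>The logarithm of the strand about \<open>q0\<close>; adding
    \<open>\<theta>\<close> undoes the rotation.\<close>
  define L L' where "L u = Ln (W u) + \<i> * of_real \<theta>" and "L' u = \<alpha>' u / (\<alpha> u - q0)" for u
  have Wpos: "0 < Re (W u)" if "u \<in> {-\<delta>1..\<delta>1}" for u using da(2)[of u] that \<delta>1(2) by auto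
  have \<alpha>nz: "\<alpha> u - q0 \<noteq> 0" "W u \<noteq> 0" if "u \<in> {-\<delta>1..\<delta>1}" for u
    using Wpos[OF that] by (auto simp: W_def)
  have EL: "q0 + exp (L u) = \<alpha> u" if "u \<in> {-\<delta>1..\<delta>1}" for u
  proof -
    have "exp (L u) = W u * v"
      unfolding L_def exp_add using \<alpha>nz(2)[OF that] by (simp add: v_def Complex_eq)
    then show ?thesis using v by (simp add: W_def)
  qed
  have DL: "(L has_vector_derivative L' u) (at u)" if "u \<in> {-\<delta>1..\<delta>1}" for u
  proof -
    have DW: "(W has_vector_derivative \<alpha>' u / v) (at u)"
      unfolding W_def[abs_def] using D\<alpha>[of u]
      by (auto intro!: derivative_eq_intros has_vector_derivative_divide simp: v)
    have "W u \<notin> \<real>\<^sub>\<le>\<^sub>0" using Wpos[OF that] by (auto simp: complex_nonpos_Reals_iff)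
    then have "(Ln has_field_derivative inverse (W u)) (at (W u))" by (rule has_field_derivative_Ln)
    from field_vector_diff_chain_at[OF DW this]
    have "((\<lambda>u. Ln (W u)) has_vector_derivative \<alpha>' u / v * inverse (W u)) (at u)" by (simp add: o_def)
    moreover have "\<alpha>' u / v * inverse (W u) = L' u"
      using v(1) \<alpha>nz(1)[OF that] by (simp add: W_def L'_def field_simps)
    ultimately have "((\<lambda>u. Ln (W u)) has_vector_derivative L' u) (at u)" by simp
    from has_vector_derivative_add[OF this has_vector_derivative_const[of "\<i> * of_real \<theta>"]]
    show ?thesis unfolding L_def[abs_def] by simp
  qed
  have CL': "continuous_on {-\<delta>1..\<delta>1} L'"
    unfolding L'_def by (intro continuous_intros C\<alpha> C\<alpha>') (use \<alpha>nz in auto)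
  have ImL': "0 < Im (L' u)" if "u \<in> {-\<delta>1..\<delta>1}" for u
    unfolding L'_def using db(2)[of u] that \<delta>1(3) by auto
  have L0: "L 0 = Complex a1 \<theta>" unfolding L_def W0 by (simp add: Ln_of_real complex_eq_iff)
  have angle: "\<bar>Im (L u) - \<theta>\<bar> < pi / 2" if "u \<in> {-\<delta>1..\<delta>1}" for u
    unfolding L_def using Wpos[OF that] Re_Ln_pos_lt[OF \<alpha>nz(2)[OF that]] by simp
  have shU: "shadow D = (\<Union>j<n. \<gamma> j ` {0..1})"
  proof
    show "shadow D \<subseteq> (\<Union>j<n. \<gamma> j ` {0..1})"
      unfolding parametrizesD(2)[OF P] by (force simp: params_def pos_def)
    show "(\<Union>j<n. \<gamma> j ` {0..1}) \<subseteq> shadow D"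
    proof clarify
      fix j and t :: real assume "j < n"
      from param_of[OF gi this, of t] show "\<gamma> j t \<in> shadow D"
        unfolding parametrizesD(2)[OF P] by (metis imageI)
    qed
  qed
  have cj: "continuous_on S (\<gamma> j)" if "j < n" for j S
    using immersed_circleD(5) generic_immersionD[OF gi that] by blast
  have "compact (shadow D)" unfolding shU
    by (intro compact_UN compact_continuous_image cj) auto
  moreover have lamsh: "\<alpha> u \<in> shadow D" for u
    unfolding parametrizesD(2)[OF P] \<alpha>_def g_def using param_of[OF gi i, of "t1 + s * u"] by (metis imageI)
  moreover have "shadow D \<noteq> {}" using lamsh by blast
  moreover have "continuous_on (shadow D) (\<lambda>z. norm (z - q0))" by (intro continuous_intros)
  ultimately obtain z0 where z0: "z0 \<in> shadow D" "\<And>z. z \<in> shadow D \<Longrightarrow> norm (z - q0) \<le> norm (z0 - q0)"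
    using continuous_attains_sup[of "shadow D" "\<lambda>z. norm (z - q0)"] by blast
  \<comment> \<open>\<open>exp A\<close> lies halfway between the greatest distance of a diagram
    point from \<open>q0\<close> and \<open>R\<close>, which leaves room for the arc inside the
    ball.\<close>
  define A where "A = ln ((norm (z0 - q0) + R) / 2)"
  have z0R: "norm (z0 - q0) < R" using z0(1) sh by (auto simp: dist_norm norm_minus_commute)
  have expA: "exp A = (norm (z0 - q0) + R) / 2"
  proof -
    have "0 < norm (z0 - q0) + R" using z0R norm_ge_zero[of "z0 - q0"] by linarith
    then show ?thesis unfolding A_def by (intro exp_ln) simp
  qed
  have A: "exp A < R" "\<And>z. z \<in> shadow D \<Longrightarrow> norm (z - q0) < exp A"
  proof -
    show "exp A < R" using z0R expA by simp
    have "norm (z0 - q0) < (norm (z0 - q0) + R) / 2" using z0R by simp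
    then show "norm (z - q0) < exp A" if "z \<in> shadow D" for z
      unfolding expA by (rule le_less_trans[OF z0(2)[OF that]])
  qed
  have ReL: "Re (L u) < A" if "u \<in> {-\<delta>1..\<delta>1}" for u
    using A(2)[OF lamsh[of u]] EL[OF that, symmetric] by simp
  \<comment> \<open>The rest of the diagram, written with closed parameter intervals so that it is
    compact.\<close>
  define Z where "Z = (\<Union>j\<in>{..<n} - {i}. \<gamma> j ` {0..1}) \<union> \<gamma> i ` ({0..t1 - \<delta>1} \<union> {t1 + \<delta>1..1})"
  have cZ: "compact Z" unfolding Z_def
    using i by (intro compact_Un compact_UN compact_continuous_image cj) auto
  have Zpar: "\<exists>y\<in>params n. pos \<gamma> y = z \<and> y \<noteq> (i, t1)" if "z \<in> Z" for z
  proof -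
    have "\<exists>j t. j < n \<and> 0 \<le> t \<and> t \<le> 1 \<and> z = \<gamma> j t \<and> (j \<noteq> i \<or> t \<le> t1 - \<delta>1 \<or> t1 + \<delta>1 \<le> t)"
    proof -
      consider j t where "j < n" "j \<noteq> i" "0 \<le> t" "t \<le> 1" "z = \<gamma> j t"
        | t where "0 \<le> t" "t \<le> t1 - \<delta>1" "z = \<gamma> i t" | t where "t1 + \<delta>1 \<le> t" "t \<le> 1" "z = \<gamma> i t"
      proof -
        have "z \<in> (\<Union>j\<in>{..<n} - {i}. \<gamma> j ` {0..1}) \<or> z \<in> \<gamma> i ` {0..t1 - \<delta>1} \<or> z \<in> \<gamma> i ` {t1 + \<delta>1..1}"
          using \<open>z \<in> Z\<close> unfolding Z_def image_Un by blast
        then show thesis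
        proof (elim disjE UN_E imageE)
          fix j t assume "j \<in> {..<n} - {i}" "z = \<gamma> j t" "t \<in> {0..1}"
          then show thesis using that(1)[of j t] by simp
        next
          fix t assume "z = \<gamma> i t" "t \<in> {0..t1 - \<delta>1}"
          then show thesis using that(2)[of t] by simp
        next
          fix t assume "z = \<gamma> i t" "t \<in> {t1 + \<delta>1..1}"
          then show thesis using that(3)[of t] by simp
        qed
      qed
      then show ?thesis
      proof cases
        case 1 then show ?thesis by blast
      next
        case 2
        then have "t \<le> 1" using t1 \<delta>1(1) by linarith
        then show ?thesis using 2 i by blast
      next
        case 3
        then have "0 \<le> t" using t1 \<delta>1(1) by linarith
        then show ?thesis using 3 i by blast
      qed
    qed
    then obtain j t where jt: "j < n" "0 \<le> t" "t \<le> 1" "z = \<gamma> j t" "j \<noteq> i \<or> t \<le> t1 - \<delta>1 \<or> t1 + \<delta>1 \<le> t"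
      by blast
    \<comment> \<open>The closed intervals contain the parameter 1, which stands for the base point;
      neither it nor any other parameter here represents \<open>t1\<close> on circle
      \<open>i\<close>.\<close>
    have "frac t = t \<or> frac t = 0" using jt(2,3) frac_unit[of t] by (cases "t = 1") auto
    then have "(j, frac t) \<noteq> (i, t1)" using jt(5) \<delta>1(1) t1 by auto
    then show ?thesis using param_of[OF gi jt(1), of t] jt(4) by metis
  qed
  then have Zsh: "Z \<subseteq> shadow D" unfolding parametrizesD(2)[OF P] by blast
  have "q0 + exp (Complex a \<theta>) \<notin> Z" if "a1 \<le> a" for a
    using Zpar ray[OF _ that] by metis
  from sector_free[OF cZ A(2) this] obtain \<kappa> where \<kappa>: "0 < \<kappa>"
    "\<And>p. a1 - \<kappa> \<le> Re p \<Longrightarrow> \<bar>Im p - \<theta>\<bar> \<le> \<kappa> \<Longrightarrow> q0 + exp p \<notin> Z"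
    using Zsh by blast
  have "isCont L 0" using has_vector_derivative_continuous[OF DL[of 0]] \<delta>1(1) by simp
  from this[unfolded continuous_at_eps_delta, rule_format, OF \<kappa>(1)]
  obtain dd where "0 < dd" "\<forall>u. dist u 0 < dd \<longrightarrow> dist (L u) (L 0) < \<kappa>" by (auto simp: dist_real_def)
  then have dd: "0 < dd" "\<And>u. \<bar>u\<bar> < dd \<Longrightarrow> norm (L u - L 0) < \<kappa>" by (auto simp: dist_norm)
  \<comment> \<open>Continuity of \<open>L\<close> at 0 places the shortened strand within
    \<open>\<kappa>\<close> of the start of the ray, hence in the sector.\<close>
  define \<delta> where "\<delta> = min \<delta>1 (dd / 2)"
  have \<delta>: "0 < \<delta>" "\<delta> \<le> \<delta>1" "\<delta> < dd" using \<delta>1(1) dd(1) by (auto simp: \<delta>_def)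
  have low: "a1 - \<kappa> \<le> Re (L u)" "\<bar>Im (L u) - \<theta>\<bar> \<le> \<kappa>" if "u \<in> {-\<delta>..\<delta>}" for u
  proof -
    have "norm (L u - L 0) < \<kappa>" using dd(2)[of u] that \<delta>(3) by auto
    then have "\<bar>Re (L u - L 0)\<bar> < \<kappa>" "\<bar>Im (L u - L 0)\<bar> < \<kappa>"
      using abs_Re_le_cmod[of "L u - L 0"] abs_Im_le_cmod[of "L u - L 0"] by linarith+
    then show "a1 - \<kappa> \<le> Re (L u)" "\<bar>Im (L u) - \<theta>\<bar> \<le> \<kappa>" unfolding L0 by auto
  qed
  have dm: "-\<delta> \<in> {-\<delta>1..\<delta>1}" "\<delta> \<in> {-\<delta>1..\<delta>1}" using \<delta> by auto
  have h: "-\<delta>/2 < \<delta>/2" "Im (L \<delta>) - 2 * pi < Im (L (-\<delta>))" "- Im (L' (-\<delta>)) < 0" "- Im (L' \<delta>) < 0"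
    using \<delta>(1) angle[OF dm(1)] angle[OF dm(2)] ImL'[OF dm(1)] ImL'[OF dm(2)] pi_gt_zero by linarith+
  obtain \<beta> \<beta>' where \<beta>: "\<And>x. (\<beta> has_real_derivative \<beta>' x) (at x)" "continuous_on UNIV \<beta>'"
    "\<And>x. x \<in> {-\<delta>/2..\<delta>/2} \<Longrightarrow> \<beta>' x < 0" "\<beta> (-\<delta>/2) = Im (L (-\<delta>))" "\<beta> (\<delta>/2) = Im (L \<delta>) - 2 * pi"
    "\<beta>' (-\<delta>/2) = - Im (L' (-\<delta>))" "\<beta>' (\<delta>/2) = - Im (L' \<delta>)"
    using monotone_Hermite[OF h] by blast
  have Q: "arch q0 \<theta> A (a1 - \<kappa>) \<kappa> \<delta> \<delta>1 L L' Z \<beta> \<beta>'"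
  proof
    show "0 < Im (L' u)" if "u \<in> {-\<delta>1..\<delta>1}" for u using ImL'[OF that] .
    show "Im (L 0) = \<theta>" unfolding L0 by simp
    show "norm (z - q0) < exp A" if "z \<in> Z" for z using A(2) that Zsh by blast
  qed (fact \<delta> DL CL' angle ReL low \<kappa>(2) \<beta>)+
  interpret Q: arch q0 \<theta> A "a1 - \<kappa>" \<kappa> \<delta> \<delta>1 L L' Z \<beta> \<beta>' by (rule Q)
  have ELam: "Q.E (L u) = \<alpha> u" if "u \<in> {-\<delta>1..\<delta>1}" for u using EL[OF that] by (simp add: Q.E_def)
  \<comment> \<open>The factor \<open>s\<close> leads from the counterclockwise parameter of the
    arch back to the parameter of the circle.\<close>
  define \<nu> \<nu>' where "\<nu> t = Q.mu (s * (t - t1))" and "\<nu>' t = s *\<^sub>R Q.mu' (s * (t - t1))" for t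
  let ?a = "t1 - \<delta>" and ?b = "t1 + \<delta>"
  have rng: "s * (t - t1) \<in> {-\<delta>..\<delta>}" if "t \<in> {?a..?b}" for t using that s(1) by auto
  have bk: "t1 + s * (s * (t - t1)) = t" for t using s(2) by (simp add: mult.assoc[symmetric])
  have ss: "s *\<^sub>R s *\<^sub>R x = x" for x :: complex using s(2) by simp
  have \<alpha>\<gamma>: "\<alpha> (s * (t - t1)) = \<gamma> i t" "s *\<^sub>R \<alpha>' (s * (t - t1)) = g' t" for t
    unfolding \<alpha>_def \<alpha>'_def bk ss g_def by simp_all
  have ends: "s * (t - t1) = -\<delta> \<or> s * (t - t1) = \<delta>" if "t = ?a \<or> t = ?b" for t using that s(1) by auto
  have mus: "Q.mu u = \<alpha> u \<and> Q.mu' u = \<alpha>' u" if "u = -\<delta> \<or> u = \<delta>" for u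
  proof -
    have u: "u \<in> {-\<delta>1..\<delta>1}" using that dm by blast
    have "exp (L u) = \<alpha> u - q0" using EL[OF u] by (metis add_diff_cancel_left')
    then have "L' u * exp (L u) = \<alpha>' u" using \<alpha>nz(1)[OF u] unfolding L'_def by simp
    moreover have "Q.mu u = Q.E (L u)" "Q.mu' u = L' u * exp (L u)" using that Q.mu_ends by auto
    ultimately show ?thesis using ELam[OF u] by simp
  qed
  have endsv: "\<nu> t = \<gamma> i t" "\<nu>' t = g' t" if "t = ?a \<or> t = ?b" for t
    using mus[OF ends[OF that]] \<alpha>\<gamma> unfolding \<nu>_def \<nu>'_def by simp_all
  have img: "(\<lambda>t. s * (t - t1)) ` {?a..?b} \<subseteq> {-\<delta>..\<delta>}" using rng by blast
  have R: "arc_replacement n \<gamma> U D i ?a ?b \<nu> \<nu>'"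
  proof
    show "parametrizes n \<gamma> U D" "i < n" by (fact P i)+
    show "0 < ?a" "?a < ?b" "?b < 1" using \<delta> \<delta>1 by auto
    show "(i, t) \<notin> double_params n \<gamma>" if "t \<in> {?a..?b}" for t by (rule simple1) (use that \<delta>(2) in auto)
    show "(\<nu> has_vector_derivative \<nu>' t) (at t within {?a..?b})" if t: "t \<in> {?a..?b}" for t
    proof -
      have d1: "((\<lambda>t. s * (t - t1)) has_vector_derivative s) (at t within {?a..?b})"
        by (auto intro!: derivative_eq_intros simp flip: has_real_derivative_iff_has_vector_derivative)
      have d2: "(Q.mu has_vector_derivative Q.mu' (s * (t - t1))) (at (s * (t - t1)) within (\<lambda>t. s * (t - t1)) ` {?a..?b})"
        by (rule has_vector_derivative_within_subset[OF Q.mu_D(1)[OF rng[OF t]] img])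
      from vector_diff_chain_within[OF d1 d2] show ?thesis
        unfolding \<nu>_def[abs_def] \<nu>'_def by (simp add: o_def)
    qed
    show "continuous_on {?a..?b} \<nu>'"
      unfolding \<nu>'_def by (intro continuous_intros continuous_on_compose2[OF Q.mu_D(2) _ img])
    show "\<nu>' t \<noteq> 0" if "t \<in> {?a..?b}" for t using Q.mu'_nz[OF rng[OF that]] s(1) by (auto simp: \<nu>'_def)
    show "\<nu> ?a = \<gamma> i ?a" "\<nu> ?b = \<gamma> i ?b" by (rule endsv(1), simp)+
    show "\<nu>' ?a = vector_derivative (\<gamma> i) (at ?a)" "\<nu>' ?b = vector_derivative (\<gamma> i) (at ?b)"
      using endsv(2)[of ?a] endsv(2)[of ?b] by (simp_all add: g'_def)
    show "inj_on \<nu> {?a..?b}"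
    proof (rule inj_onI)
      fix t t' assume t: "t \<in> {?a..?b}" "t' \<in> {?a..?b}" "\<nu> t = \<nu> t'"
      then have "s * (t - t1) = s * (t' - t1)"
        unfolding \<nu>_def using inj_onD[OF Q.mu_inj _ rng[OF t(1)] rng[OF t(2)]] by blast
      then show "t = t'" using s(1) by auto
    qed
    show "\<nu> t \<notin> pos \<gamma> ` (params n - {i} \<times> {?a<..<?b})" if t: "t \<in> {?a<..<?b}" for t
    proof
      assume "\<nu> t \<in> pos \<gamma> ` (params n - {i} \<times> {?a<..<?b})"
      then obtain x where x: "x \<in> params n" "x \<notin> {i} \<times> {?a<..<?b}" "\<nu> t = pos \<gamma> x" by blast
      obtain j r where "x = (j, r)" by (cases x) auto
      with x have jr: "(j, r) \<in> params n" "(j, r) \<notin> {i} \<times> {?a<..<?b}" "\<nu> t = \<gamma> j r"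
        by (simp_all add: pos_def)
      have t': "t \<in> {?a..?b}" using t by auto
      show False
      proof (cases "j = i \<and> r \<in> {t1 - \<delta>1..t1 + \<delta>1}")
        case True
        then have w: "s * (r - t1) \<in> {-\<delta>1..\<delta>1}" using s(1) by auto
        have "Q.mu (s * (t - t1)) = Q.E (L (s * (r - t1)))"
          using jr(3) True unfolding ELam[OF w] \<alpha>\<gamma>(1) \<nu>_def by simp
        from Q.mu_strand[OF rng[OF t'] w this] have "s * (t - t1) = -\<delta> \<or> s * (t - t1) = \<delta>" by auto
        then show False using t s(1) by auto
      next
        case False
        then have "\<gamma> j r \<in> Z" using jr(1) unfolding Z_def params_def by force
        then show False using Q.mu_Z[OF rng[OF t']] jr(3) unfolding \<nu>_def by simp
      qed
    qed
    show "\<nu> t \<in> ball 0 1" if "t \<in> {?a..?b}" for t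
    proof -
      have "\<nu> t \<in> ball q0 R"
        using Q.mu_norm[OF rng[OF that]] A(1) unfolding \<nu>_def by (simp add: dist_norm norm_minus_commute)
      then show ?thesis using RB by blast
    qed
  qed
  have "\<exists>S. signed S \<and> sum snd S = \<sigma> * p \<and>
    (\<forall>A. arrows_ok n \<gamma> A \<longrightarrow> fst ` A \<inter> \<gamma> i ` {?a..?b} = {} \<longrightarrow>
       Omega_inf p (D\<lparr>arrows := A\<rparr>)
         ((arc_replacement.D2 n \<gamma> D i ?a ?b \<nu>)
           \<lparr>arrows := A \<union> put (\<lambda>s. arc_replacement.\<gamma>2 \<gamma> i ?a ?b \<nu> i (?a + 2 * \<delta> * s)) S\<rparr>))" for p
  proof (rule Omega_inf_arch[OF R Q \<sigma>])
    show "\<gamma> i (t1 + of_int \<sigma> * u) = q0 + exp (L u)" if "u \<in> {-\<delta>1..\<delta>1}" for u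
      using EL[OF that] by (simp add: \<alpha>_def g_def s_def)
    show "\<nu> t = Q.mu (of_int \<sigma> * (t - t1))" for t by (simp add: \<nu>_def s_def)
    show "pos \<gamma> ` (params n - {i} \<times> {t1 - \<delta>1..t1 + \<delta>1}) \<subseteq> Z"
      unfolding Z_def by (fastforce simp: params_def pos_def)
  qed
  moreover have "2 * \<delta> = ?b - ?a" by simp
  ultimately have Om: "\<exists>S. signed S \<and> sum snd S = \<sigma> * p \<and>
    (\<forall>A. arrows_ok n \<gamma> A \<longrightarrow> fst ` A \<inter> \<gamma> i ` {?a..?b} = {} \<longrightarrow>
       Omega_inf p (D\<lparr>arrows := A\<rparr>)
         ((arc_replacement.D2 n \<gamma> D i ?a ?b \<nu>)
           \<lparr>arrows := A \<union> put (\<lambda>s. arc_replacement.\<gamma>2 \<gamma> i ?a ?b \<nu> i (?a + (?b - ?a) * s)) S\<rparr>))" for p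
    by (simp only:)
  show ?thesis
  proof (rule that[OF R _ _ _ _ \<sigma> _ _ Om])
    show "t1 - \<epsilon> < ?a" "?a < t1" "t1 < ?b" "?b < t1 + \<epsilon>" using \<delta> \<delta>1 by auto
    show "\<nu> t \<in> ball q0 R" if "t \<in> {?a..?b}" for t
      using Q.mu_norm[OF rng[OF that]] A(1) unfolding \<nu>_def by (simp add: dist_norm norm_minus_commute)
    show "\<nu> t \<noteq> q0 + exp (Complex c \<theta>)" if "t \<in> {?a..?b}" for t c
      using Q.mu_ray[OF rng[OF that], of c] unfolding \<nu>_def Q.E_def .
  qed
qed

section \<open>Arrows on a strand seen from the boundary along a ray\<close>

text \<open>\<open>arrow_diagram\<close> vouches for the arrows with respect to some
  parametrization. Arrow points are simple points of the shadow, and there tangency identifies the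
  directions given by any two parametrizations.\<close>

lemma arrows_ok_of_diagram:
  assumes P: "parametrizes n \<gamma> U D" and D: "arrow_diagram D"
  shows "arrows_ok n \<gamma> (arrows D)"
proof -
  obtain n' \<gamma>' U' where P': "parametrizes n' \<gamma>' U' D" and A': "arrows_ok n' \<gamma>' (arrows D)"
    using D arrow_diagram_iff by blast
  have "\<exists>x\<in>params n - double_params n \<gamma>. q = pos \<gamma> x \<and> u \<in> {pdir \<gamma> x, - pdir \<gamma> x}"
    if qu: "(q, u) \<in> arrows D" for q u
  proof -
    obtain x' where x': "x' \<in> params n' - double_params n' \<gamma>'" "q = pos \<gamma>' x'" "u \<in> {pdir \<gamma>' x', - pdir \<gamma>' x'}"
      using A' qu unfolding arrows_ok_def by blast
    have "q \<in> shadow D" using x' unfolding parametrizesD(2)[OF P'] by blast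
    then obtain x where x: "x \<in> params n" "q = pos \<gamma> x" unfolding parametrizesD(2)[OF P] by blast
    have "q \<notin> crossings D"
    proof
      assume "q \<in> crossings D"
      then obtain y where y: "y \<in> double_params n' \<gamma>'" "pos \<gamma>' y = pos \<gamma>' x'"
        unfolding crossings_eq[OF P'] x'(2) by auto
      then have "y \<noteq> x'" "y \<in> params n'" using x'(1) by (auto simp: double_params_def)
      then show False using x'(1) y(2) unfolding double_params_def by blast
    qed
    then have xd: "x \<in> params n - double_params n \<gamma>" using x unfolding crossings_eq[OF P] by blast
    have j: "fst x' < n'" using x'(1) by (auto simp: params_def)
    have ic: "immersed_circle (\<gamma>' (fst x'))"
      by (rule generic_immersionD[OF parametrizesD(1)[OF P'] j])
    have in_sh: "\<gamma>' (fst x') r \<in> shadow D" for r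
      using param_of[OF parametrizesD(1)[OF P'] j, of r] unfolding parametrizesD(2)[OF P'] by (metis imageI)
    have "sgn (vector_derivative (\<gamma>' (fst x')) (at (snd x'))) = pdir \<gamma> x \<or>
       sgn (vector_derivative (\<gamma>' (fst x')) (at (snd x'))) = - pdir \<gamma> x"
    proof (rule tangent_to_strand[OF P xd immersed_circleD(2)[OF ic] immersed_circleD(4)[OF ic]])
      show "\<gamma>' (fst x') (snd x') = pos \<gamma> x" using x'(2) x(2) by (simp add: pos_def)
      show "\<forall>\<^sub>F r in at (snd x'). \<gamma>' (fst x') r \<in> shadow D" using in_sh by simp
    qed
    then have "u \<in> {pdir \<gamma> x, - pdir \<gamma> x}" using x'(3) by (auto simp: pdir_def dir_def)
    then show ?thesis using xd x(2) by blast
  qed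
  then show ?thesis using A' unfolding arrows_ok_def by (simp add: case_prod_beta)
qed

lemma simple_param:
  assumes "(i, t) \<notin> double_params n \<gamma>" "(i, t) \<in> params n" "y \<in> params n" "pos \<gamma> y = \<gamma> i t"
  shows "y = (i, t)"
  using assms unfolding double_params_def by (auto simp: pos_def)

lemma unit_param: "i < n \<Longrightarrow> 0 < t \<Longrightarrow> t < 1 \<Longrightarrow> (i, t) \<in> params n"
  by (simp add: params_def)

lemma disjoint_images: "(\<And>x y. x \<in> S \<Longrightarrow> y \<in> T \<Longrightarrow> f x \<noteq> g y) \<Longrightarrow> f ` S \<inter> g ` T = {}"
  by blast

lemma clear_near:
  assumes P: "parametrizes n \<gamma> U D" and i: "i < n" and t0: "0 < t0" "t0 < 1" and "(i, t0) \<notin> double_params n \<gamma>"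
    and F: "finite F" "\<gamma> i t0 \<notin> F" and "0 < \<epsilon>"
  obtains \<epsilon>' where "0 < \<epsilon>'" "\<epsilon>' \<le> \<epsilon>" "0 < t0 - \<epsilon>'" "t0 + \<epsilon>' < 1"
    "\<And>t. \<bar>t - t0\<bar> < \<epsilon>' \<Longrightarrow> (i, t) \<notin> double_params n \<gamma>" "\<And>t. \<bar>t - t0\<bar> < \<epsilon>' \<Longrightarrow> \<gamma> i t \<notin> F"
proof -
  have gi: "generic_immersion n \<gamma>" by (rule parametrizesD(1)[OF P])
  have "finite (double_params n \<gamma>)" using gi by (simp add: generic_immersion_def)
  then have "finite (Pair i -` double_params n \<gamma>)" by (rule finite_vimageI) (simp add: inj_on_def)
  from finite_set_avoid[OF this, of t0]
  obtain d1 where d1: "0 < d1" "\<And>t. (i, t) \<in> double_params n \<gamma> \<Longrightarrow> t \<noteq> t0 \<Longrightarrow> d1 \<le> dist t0 t" by auto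
  have "isCont (\<gamma> i) t0"
    using immersed_circleD(5)[OF generic_immersionD[OF gi i], of UNIV] by (simp add: continuous_on_eq_continuous_at)
  moreover from finite_set_avoid[OF F(1), of "\<gamma> i t0"]
  obtain d0 where d0: "0 < d0" "\<And>z. z \<in> F \<Longrightarrow> d0 \<le> dist (\<gamma> i t0) z" using F(2) by metis
  ultimately obtain d2 where d2: "0 < d2" "\<And>t. dist t t0 < d2 \<Longrightarrow> dist (\<gamma> i t) (\<gamma> i t0) < d0"
    unfolding continuous_at_eps_delta by blast
  define e where "e = min \<epsilon> (min (min d1 d2) (min (t0 / 2) ((1 - t0) / 2)))"
  show ?thesis
  proof
    have "e \<le> t0 / 2" "e \<le> (1 - t0) / 2" unfolding e_def by linarith+
    moreover have "t0 / 2 < t0" "t0 + (1 - t0) / 2 < 1" using t0 by (simp_all add: field_simps)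
    ultimately show "0 < t0 - e" "t0 + e < 1" by linarith+
    show "0 < e" "e \<le> \<epsilon>" using d1(1) d2(1) \<open>0 < \<epsilon>\<close> t0 by (simp_all add: e_def)
    show "(i, t) \<notin> double_params n \<gamma>" if "\<bar>t - t0\<bar> < e" for t
    proof
      assume "(i, t) \<in> double_params n \<gamma>"
      then have "d1 \<le> dist t0 t" using d1(2) assms(5) by metis
      then show False using that by (auto simp: e_def dist_real_def)
    qed
    show "\<gamma> i t \<notin> F" if "\<bar>t - t0\<bar> < e" for t
    proof
      assume "\<gamma> i t \<in> F"
      from d0(2)[OF this] d2(2)[of t] that show False by (auto simp: e_def dist_real_def dist_commute)
    qed
  qed
qed

section \<open>Arcs of circles and the claim to be proved along a ray\<close>

definition subarc :: "(real \<Rightarrow> complex) \<Rightarrow> real \<Rightarrow> real \<Rightarrow> real \<Rightarrow> complex" where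
  "subarc g a b s = g (a + (b - a) * s)"

lemma subarc:
  assumes g: "immersed_circle g" and ab: "a < b" and inj: "inj_on g {a..b}"
  shows "embedded_path (subarc g a b)" "path_image (subarc g a b) = g ` {a..b}"
    "dir (subarc g a b) s = dir g (a + (b - a) * s)"
proof -
  have im: "(\<lambda>x. a + (b - a) * x) ` {0..1} = {a..b}"
    using ab image_affinity_atLeastAtMost[of "b - a" a 0 1] by (simp add: add.commute)
  then have S: "x \<in> {0..1} \<Longrightarrow> a + (b - a) * x \<in> {a..b}" for x by blast
  have ne: "b - a \<noteq> 0" using ab by simp
  show "embedded_path (subarc g a b)"
    unfolding subarc_def[abs_def]
    by (rule embedded_affine(1)[OF immersed_circleD(2)[OF g] continuous_on_subset[OF immersed_circleD(3)[OF g]]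
          immersed_circleD(4)[OF g] inj S ne]) simp
  show "path_image (subarc g a b) = g ` {a..b}"
    unfolding path_image_def subarc_def[abs_def] im[symmetric] image_image ..
  have "((\<lambda>x. g (a + (b - a) * x)) has_vector_derivative (b - a) *\<^sub>R vector_derivative g (at (a + (b - a) * s))) (at s)"
    by (rule has_vector_derivative_affine[OF immersed_circleD(2)[OF g]])
  then show "dir (subarc g a b) s = dir g (a + (b - a) * s)"
    unfolding dir_def subarc_def[abs_def] using ab by (simp add: vector_derivative_at sgn_scaleR)
qed

lemma put_subarc:
  assumes g: "immersed_circle g" and ab: "a < b" and inj: "inj_on g {a..b}"
    and S: "S = (\<lambda>(s, e). ((s - a) / (b - a), e)) ` S'"
  shows "put (subarc g a b) S = put g S'"
proof -
  have "a + (b - a) * ((s - a) / (b - a)) = s" for s using ab by simp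
  then show ?thesis
    unfolding put_def S image_image subarc(3)[OF g ab inj] subarc_def case_prod_beta by simp
qed

text \<open>Intersections strictly farther out than the strand itself, at logarithmic radius
  \<open>a0\<close>. Their number is the induction measure.\<close>

definition hits :: "nat \<Rightarrow> (nat \<Rightarrow> real \<Rightarrow> complex) \<Rightarrow> complex \<Rightarrow> real \<Rightarrow> real \<Rightarrow> (nat \<times> real) set" where
  "hits n \<gamma> q0 \<theta> a0 = {x \<in> params n. \<exists>a>a0. pos \<gamma> x = q0 + exp (Complex a \<theta>)}"

text \<open>The starting point is included, since the strand there is treated like every other
  intersection. Positive parameters keep intersections off base points, where no arc can be
  exchanged.\<close>

definition good_ray :: "nat \<Rightarrow> (nat \<Rightarrow> real \<Rightarrow> complex) \<Rightarrow> diagram \<Rightarrow> complex \<Rightarrow> real \<Rightarrow> real \<Rightarrow> bool" where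
  "good_ray n \<gamma> D q0 \<theta> a0 \<longleftrightarrow> (\<forall>x \<in> params n. \<forall>a \<ge> a0. pos \<gamma> x = q0 + exp (Complex a \<theta>) \<longrightarrow>
     x \<notin> double_params n \<gamma> \<and> 0 < snd x \<and> pos \<gamma> x \<notin> arrow_points D \<and>
     Im (vector_derivative (\<gamma> (fst x)) (at (snd x)) / exp (Complex a \<theta>)) \<noteq> 0)"

text \<open>The positions of the new arrows are left open, as arrows can slide; only their closeness
  to \<open>t0\<close> matters, so that they are disjoint from arcs exchanged elsewhere. The sign
  \<open>e\<close> is relative to circle \<open>i\<close>.\<close>

definition creates ::
  "move set \<Rightarrow> nat \<Rightarrow> int \<Rightarrow> nat \<Rightarrow> (nat \<Rightarrow> real \<Rightarrow> complex) \<Rightarrow> diagram \<Rightarrow> nat \<Rightarrow> real \<Rightarrow> real \<Rightarrow> bool" where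
  "creates M k e n \<gamma> D i t0 \<epsilon> \<longleftrightarrow> (\<exists>T. finite T \<and> card T = k \<and> T \<subseteq> {0<..<1} \<and> (\<forall>t\<in>T. \<bar>t - t0\<bar> < \<epsilon>) \<and>
     (\<forall>t\<in>T. (i, t) \<notin> double_params n \<gamma>) \<and> \<gamma> i ` T \<inter> arrow_points D = {} \<and>
     equivclp (step M) D (D\<lparr>arrows := arrows D \<union> put (\<gamma> i) (T \<times> {e})\<rparr>))"

text \<open>Counterpart of \<open>arrows_ok_put\<close> on a whole circle: simplicity of the points
  takes the place of an embedded path.\<close>

lemma arrows_ok_add:
  assumes P: "parametrizes n \<gamma> U D" and A: "arrows_ok n \<gamma> A" and i: "i < n"
    and T: "finite T" "T \<subseteq> {0<..<1}" "\<And>t. t \<in> T \<Longrightarrow> (i, t) \<notin> double_params n \<gamma>"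
    and dis: "\<gamma> i ` T \<inter> fst ` A = {}" and e: "e = 1 \<or> e = (-1::int)"
  shows "arrows_ok n \<gamma> (A \<union> put (\<gamma> i) (T \<times> {e}))"
  unfolding arrows_ok_def
proof (intro conjI)
  show "finite (A \<union> put (\<gamma> i) (T \<times> {e}))" using A T(1) by (simp add: arrows_ok_def put_def)
  have inj: "t = t'" if "t \<in> T" "t' \<in> T" "\<gamma> i t = \<gamma> i t'" for t t'
  proof -
    have "(i, t) \<in> params n" "(i, t') \<in> params n" using that T(2) i by (auto simp: params_def)
    then have "(i, t') = (i, t)" using that(3) by (intro simple_param[OF T(3)[OF that(1)]]) (simp_all add: pos_def)
    then show ?thesis by simp
  qed
  have "inj_on fst (put (\<gamma> i) (T \<times> {e}))"
    unfolding put_uniform using inj by (auto simp: inj_on_def)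
  moreover have "fst ` put (\<gamma> i) (T \<times> {e}) = \<gamma> i ` T" unfolding put_uniform by force
  ultimately show "inj_on fst (A \<union> put (\<gamma> i) (T \<times> {e}))"
    using A dis unfolding inj_on_Un arrows_ok_def by blast
  show "\<forall>(q, u)\<in>A \<union> put (\<gamma> i) (T \<times> {e}). \<exists>x\<in>params n - double_params n \<gamma>.
           q = pos \<gamma> x \<and> u \<in> {pdir \<gamma> x, - pdir \<gamma> x}"
  proof (intro ballI, clarify)
    fix q u assume qu: "(q, u) \<in> A \<union> put (\<gamma> i) (T \<times> {e})"
    show "\<exists>x\<in>params n - double_params n \<gamma>. q = pos \<gamma> x \<and> u \<in> {pdir \<gamma> x, - pdir \<gamma> x}"
    proof (cases "(q, u) \<in> A")
      case True
      then show ?thesis using A unfolding arrows_ok_def by blast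
    next
      case False
      then obtain t where t: "t \<in> T" "q = \<gamma> i t" "u = of_int e * dir (\<gamma> i) t"
        using qu unfolding put_uniform by auto
      then have "(i, t) \<in> params n - double_params n \<gamma>" using T i by (auto simp: params_def)
      moreover have "q = pos \<gamma> (i, t)" using t by (simp add: pos_def)
      moreover have "u \<in> {pdir \<gamma> (i, t), - pdir \<gamma> (i, t)}" using t(3) e by (auto simp: pdir_def)
      ultimately show ?thesis by blast
    qed
  qed
qed

lemma signed_scale:
  assumes S: "signed S" and \<rho>: "0 < \<rho>" "\<rho> \<le> 1"
  defines "S' \<equiv> (\<lambda>(s, e). (\<rho> * s, e)) ` S"
  shows "signed S'" "sum snd S' = sum snd S" "fst ` S' \<subseteq> {0<..<\<rho>}"
proof -
  have inj: "inj_on (\<lambda>(s, e). (\<rho> * s, e)) S" using \<rho>(1) by (auto simp: inj_on_def)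
  show f: "fst ` S' \<subseteq> {0<..<\<rho>}"
  proof -
    have "\<rho> * s \<in> {0<..<\<rho>}" if "(s, e) \<in> S" for s e
    proof -
      have "0 < s" "s < 1" using signed_fst[OF S] that by force+
      then show ?thesis using \<rho>(1) by simp
    qed
    then show ?thesis unfolding S'_def by force
  qed
  show "sum snd S' = sum snd S"
    unfolding S'_def by (subst sum.reindex[OF inj]) (simp add: case_prod_beta o_def)
  have "inj_on fst S'"
  proof (rule inj_onI)
    fix x y assume "x \<in> S'" "y \<in> S'" "fst x = fst y"
    then obtain s e s' e' where "(s, e) \<in> S" "(s', e') \<in> S" "x = (\<rho> * s, e)" "y = (\<rho> * s', e')" "\<rho> * s = \<rho> * s'"
      unfolding S'_def by auto
    moreover from this have "s = s'" using \<rho>(1) by simp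
    moreover have "inj_on fst S" using S unfolding signed_def by blast
    ultimately have "(s, e) = (s', e')" by (intro inj_onD[of fst S]) simp_all
    then show "x = y" using \<open>x = (\<rho> * s, e)\<close> \<open>y = (\<rho> * s', e')\<close> by simp
  qed
  moreover have "snd ` S' \<subseteq> {1, -1}" using S unfolding S'_def signed_def by force
  moreover have "finite S'" using S unfolding S'_def signed_def by simp
  moreover have "S' \<subseteq> {0<..<1} \<times> {1, -1}"
  proof
    fix x assume "x \<in> S'"
    then have "fst x \<in> {0<..<\<rho>}" "snd x \<in> {1, -1}" using f \<open>snd ` S' \<subseteq> {1, -1}\<close> by blast+
    then show "x \<in> {0<..<1} \<times> {1, -1}" using \<rho>(2) by (simp add: mem_Times_iff)
  qed
  ultimately show "signed S'" unfolding signed_def by blast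
qed

lemma signed_Un:
  assumes "signed S" "signed S'" "fst ` S \<inter> fst ` S' = {}"
  shows "signed (S \<union> S')" "sum snd (S \<union> S') = sum snd S + sum snd S'"
proof -
  have "inj_on fst (S \<union> S')"
    using assms unfolding signed_def by (subst inj_on_Un) blast
  then show "signed (S \<union> S')" using assms unfolding signed_def by blast
  have "S \<inter> S' = {}" using assms(3) by blast
  then show "sum snd (S \<union> S') = sum snd S + sum snd S'"
    using assms unfolding signed_def by (intro sum.union_disjoint) auto
qed

text \<open>The arrows stay where they are; their parameters shrink when the strand is prolonged
  beyond the exchanged arc.\<close>

lemma put_rescale:
  assumes g: "immersed_circle g" and ab: "a < b" "b \<le> b'" and inj: "inj_on g {a..b'}"
  shows "put (subarc g a b) S = put (subarc g a b') ((\<lambda>(s, e). ((b - a) / (b' - a) * s, e)) ` S)"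
proof -
  have inj': "inj_on g {a..b}" using inj by (rule inj_on_subset) (use ab in auto)
  have ab': "a < b'" using ab by simp
  have "a + (b' - a) * ((b - a) / (b' - a) * s) = a + (b - a) * s" for s using ab' by simp
  then show ?thesis
    unfolding put_def image_image case_prod_beta fst_conv snd_conv
      subarc(3)[OF g ab(1) inj'] subarc(3)[OF g ab' inj] subarc_def by simp
qed

text \<open>Compare the diagram after \<open>Omega_inf p1\<close> with the one obtained from
  \<open>Omega_inf p2\<close> when \<open>k\<close> arrows already sit just beyond the arc. Both are
  decorations of one free strand, the new arc prolonged along the old curve, and the numbers are
  chosen so that their signed sums agree.\<close>

lemma creates_outermost:
  assumes M: "Omega4 \<in> M" "Omega_inf p \<in> M" "Omega_inf (p + int k) \<in> M"
    and P: "parametrizes n \<gamma> U D" and D: "arrow_diagram D" and i: "i < n"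
    and sh: "shadow D \<subseteq> ball q0 R" and RB: "ball q0 R \<subseteq> ball 0 1"
    and t0: "0 < t0" "t0 < 1" and pt: "\<gamma> i t0 = q0 + exp (Complex a0 \<theta>)"
    and good: "good_ray n \<gamma> D q0 \<theta> a0" and hits: "hits n \<gamma> q0 \<theta> a0 = {}"
    and e: "e = 1 \<or> e = (-1 :: int)" and "0 < \<epsilon>"
  shows "creates M k e n \<gamma> D i t0 \<epsilon>"
proof -
  have A: "arrows_ok n \<gamma> (arrows D)" by (rule arrows_ok_of_diagram[OF P D])
  have x0: "(i, t0) \<in> params n" by (rule unit_param[OF i t0])
  have pos0: "pos \<gamma> (i, t0) = q0 + exp (Complex a0 \<theta>)" using pt by (simp add: pos_def)
  have g0: "(i, t0) \<notin> double_params n \<gamma>" "\<gamma> i t0 \<notin> arrow_points D"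
    "Im (vector_derivative (\<gamma> i) (at t0) / exp (Complex a0 \<theta>)) \<noteq> 0"
    using good[unfolded good_ray_def, rule_format, OF x0 order_refl pos0] by (simp_all add: pos_def)
  have finA: "finite (arrow_points D)" using A by (simp add: arrow_points_def arrows_ok_def)
  obtain \<epsilon>' where \<epsilon>': "0 < \<epsilon>'" "\<epsilon>' \<le> \<epsilon>" "0 < t0 - \<epsilon>'" "t0 + \<epsilon>' < 1"
    "\<And>t. \<bar>t - t0\<bar> < \<epsilon>' \<Longrightarrow> (i, t) \<notin> double_params n \<gamma>" "\<And>t. \<bar>t - t0\<bar> < \<epsilon>' \<Longrightarrow> \<gamma> i t \<notin> arrow_points D"
    using clear_near[OF P i t0 g0(1) finA g0(2) \<open>0 < \<epsilon>\<close>] by blast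
  have ray: "y = (i, t0)" if y: "y \<in> params n" "a0 \<le> a" "pos \<gamma> y = q0 + exp (Complex a \<theta>)" for y a
  proof -
    have "\<not> a0 < a" using hits y unfolding hits_def by blast
    then have "a = a0" using y(2) by simp
    then have "pos \<gamma> y = \<gamma> i t0" using y(3) pt by simp
    then show ?thesis by (rule simple_param[OF g0(1) x0 y(1)])
  qed
  obtain a b \<nu> \<nu>' \<sigma> where AR: "arc_replacement n \<gamma> U D i a b \<nu> \<nu>'"
    and ab: "t0 - \<epsilon>' < a" "a < t0" "t0 < b" "b < t0 + \<epsilon>'" and \<sigma>: "\<sigma> = 1 \<or> \<sigma> = (-1 :: int)"
    and "\<And>t. t \<in> {a..b} \<Longrightarrow> \<nu> t \<in> ball q0 R" "\<And>t c. t \<in> {a..b} \<Longrightarrow> \<nu> t \<noteq> q0 + exp (Complex c \<theta>)"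
    and Om: "\<And>p. \<exists>S. signed S \<and> sum snd S = \<sigma> * p \<and>
      (\<forall>A. arrows_ok n \<gamma> A \<longrightarrow> fst ` A \<inter> \<gamma> i ` {a..b} = {} \<longrightarrow>
         Omega_inf p (D\<lparr>arrows := A\<rparr>)
           ((arc_replacement.D2 n \<gamma> D i a b \<nu>)
             \<lparr>arrows := A \<union> put (\<lambda>s. arc_replacement.\<gamma>2 \<gamma> i a b \<nu> i (a + (b - a) * s)) S\<rparr>))"
    by (rule outer_arch[OF P i t0 g0(1) sh RB pt g0(3) ray \<epsilon>'(1)]) (assumption | (rule that; assumption))+
  interpret R: arc_replacement n \<gamma> U D i a b \<nu> \<nu>' by (rule AR)
  \<comment> \<open>Past the end of the new arc but inside the clear window: the piece from
    \<open>b\<close> to \<open>b'\<close> belongs to the old curve and is the place where the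
    \<open>k\<close> arrows are left.\<close>
  define b' where "b' = (b + (t0 + \<epsilon>')) / 2"
  have b': "b < b'" "b' < t0 + \<epsilon>'" "a < b'" "a < b" using ab by (auto simp: b'_def)
  have near: "\<bar>t - t0\<bar> < \<epsilon>'" "(i, t) \<in> params n" if "t \<in> {a..b'}" for t
  proof -
    show *: "\<bar>t - t0\<bar> < \<epsilon>'" using that ab b' by auto
    show "(i, t) \<in> params n" using that ab b' \<epsilon>'(3,4) by (intro unit_param[OF i]) auto
  qed
  define g2 where "g2 = R.\<gamma>2 i"
  have ig2: "immersed_circle g2" unfolding g2_def by (rule generic_immersionD[OF R.generic2 i])
  have nd2: "(i, t) \<notin> double_params n R.\<gamma>2" if "t \<in> {a..b'}" for t
    unfolding R.double_eq by (rule \<epsilon>'(5)[OF near(1)[OF that]])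
  have simp2: "y = (i, t)" if "t \<in> {a..b'}" "y \<in> params n" "pos R.\<gamma>2 y = g2 t" for t y
    using simple_param[OF nd2[OF that(1)] near(2)[OF that(1)] that(2)] that(3) unfolding g2_def by blast
  have inj2: "inj_on g2 {a..b'}"
  proof (rule inj_onI)
    fix t t' assume t: "t \<in> {a..b'}" "t' \<in> {a..b'}" "g2 t = g2 t'"
    have "(i, t') = (i, t)" by (rule simp2[OF t(1) near(2)[OF t(2)]]) (use t(3) in \<open>simp add: pos_def g2_def\<close>)
    then show "t = t'" by simp
  qed
  define C where "C = subarc g2 a b'"
  note SA = subarc[OF ig2 b'(3) inj2, folded C_def]
  define D2A where "D2A = R.D2\<lparr>arrows := arrows D\<rparr>"
  have clear_ab: "\<gamma> i t \<notin> arrow_points D" if "t \<in> {a..b'}" for t by (rule \<epsilon>'(6)[OF near(1)[OF that]])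
  have dis: "fst ` arrows D \<inter> \<gamma> i ` {a..b} = {}"
    using clear_ab b' unfolding arrow_points_def by force
  have P2: "parametrizes n R.\<gamma>2 U D2A" unfolding D2A_def
    by (rule parametrizes_cong[OF R.parametrizes2]) simp_all
  have A2: "arrows_ok n R.\<gamma>2 (arrows D)" by (rule R.arrows_ok2[OF A dis])
  have rest_b: "(i, t) \<in> R.rest" if "t \<in> {a..b'}" "t \<notin> {a<..<b}" for t
    using near(2)[OF that(1)] that(2) by (auto simp: R.rest_def)
  have F: "free_strand D2A C"
    unfolding free_strand_def SA(2)
  proof (intro conjI)
    show "arrow_diagram D2A" using P2 A2 arrow_diagram_iff unfolding D2A_def by fastforce
    show "embedded_path C" by (rule SA(1))
    show "g2 ` {a..b'} \<subseteq> shadow D2A"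
    proof
      fix z assume "z \<in> g2 ` {a..b'}"
      then obtain t where "t \<in> {a..b'}" "z = pos R.\<gamma>2 (i, t)" by (auto simp: pos_def g2_def)
      then show "z \<in> shadow D2A" unfolding parametrizesD(2)[OF P2] using near(2) by blast
    qed
    show "g2 ` {a..b'} \<inter> crossings D2A = {}"
      unfolding crossings_eq[OF P2]
    proof (rule equals0I)
      fix z assume "z \<in> g2 ` {a..b'} \<inter> pos R.\<gamma>2 ` double_params n R.\<gamma>2"
      then obtain t y where ty: "t \<in> {a..b'}" "z = g2 t" "y \<in> double_params n R.\<gamma>2" "z = pos R.\<gamma>2 y" by blast
      then have "y = (i, t)" by (intro simp2) (auto simp: double_params_def)
      then show False using nd2[OF ty(1)] ty(3) by simp
    qed
    show "C ` {0<..<1} \<inter> arrow_points D2A = {}"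
    proof (rule equals0I)
      fix z assume z: "z \<in> C ` {0<..<1} \<inter> arrow_points D2A"
      then have "z \<in> path_image C" unfolding path_image_def by auto
      then obtain t where t: "t \<in> {a..b'}" "z = g2 t" unfolding SA(2) by blast
      have zA: "z \<in> fst ` arrows D" using z by (simp add: arrow_points_def D2A_def)
      then obtain y where y: "y \<in> params n" "z = pos \<gamma> y" using A unfolding arrows_ok_def by fastforce
      show False
      proof (cases "t \<in> {a<..<b}")
        case True
        have "y \<in> R.rest"
        proof (rule ccontr)
          assume "y \<notin> R.rest"
          then obtain r where "y = (i, r)" "r \<in> {a<..<b}" using R.params_split[OF y(1)] by blast
          then have "z \<in> \<gamma> i ` {a..b}" using y(2) by (auto simp: pos_def)
          then show False using zA dis by blast
        qed
        then have "z \<in> pos \<gamma> ` R.rest" using y(2) by blast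
        moreover have "z = \<nu> t" using t(2) R.arc_pos[of t] True by (simp add: g2_def)
        ultimately show False using R.new[OF True] by (simp add: R.rest_def)
      next
        case False
        then have "z = \<gamma> i t" using R.rest_pos(1)[OF rest_b[OF t(1) False]] t(2) by (simp add: pos_def g2_def)
        then show False using clear_ab[OF t(1)] zA by (simp add: arrow_points_def)
      qed
    qed
  qed
  define \<rho> where "\<rho> = (b - a) / (b' - a)"
  have \<rho>: "0 < \<rho>" "\<rho> < 1" using b' by (auto simp: \<rho>_def)
  have Om': "\<exists>X. signed X \<and> sum snd X = \<sigma> * p1 \<and> fst ` X \<subseteq> {0<..<\<rho>} \<and>
    (\<forall>A. arrows_ok n \<gamma> A \<longrightarrow> fst ` A \<inter> \<gamma> i ` {a..b} = {} \<longrightarrow>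
       Omega_inf p1 (D\<lparr>arrows := A\<rparr>) (R.D2\<lparr>arrows := A \<union> put C X\<rparr>))" for p1
  proof -
    obtain S where S: "signed S" "sum snd S = \<sigma> * p1"
      "\<And>A. arrows_ok n \<gamma> A \<Longrightarrow> fst ` A \<inter> \<gamma> i ` {a..b} = {} \<Longrightarrow>
         Omega_inf p1 (D\<lparr>arrows := A\<rparr>) (R.D2\<lparr>arrows := A \<union> put (\<lambda>s. R.\<gamma>2 i (a + (b - a) * s)) S\<rparr>)"
      using Om[of p1] by blast
    have eq: "put (\<lambda>s. R.\<gamma>2 i (a + (b - a) * s)) S = put C ((\<lambda>(s, e). (\<rho> * s, e)) ` S)"
      using put_rescale[OF ig2 b'(4) less_imp_le[OF b'(1)] inj2, of S]
      unfolding C_def \<rho>_def g2_def subarc_def[of "R.\<gamma>2 i" a b, abs_def] .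
    note sc = signed_scale[OF S(1) \<rho>(1) less_imp_le[OF \<rho>(2)]]
    show ?thesis
      by (rule exI[of _ "(\<lambda>(s, e). (\<rho> * s, e)) ` S"]) (use sc S(2) S(3)[unfolded eq] in simp)
  qed
  obtain T where T: "finite T" "card T = k" "T \<subseteq> {b<..<b'} - {}"
    using many_points[OF finite.emptyI b'(1)] by blast
  have Tin: "t \<in> {a..b'}" "t \<notin> {a..b}" "t \<notin> {a<..<b}" if "t \<in> T" for t
    using T(3) that b' by auto
  define T' where "T' = (\<lambda>t. (t - a) / (b' - a)) ` T"
  have T': "finite T'" "card T' = k" "T' \<subseteq> {\<rho><..<1}"
  proof -
    show "finite T'" using T(1) by (simp add: T'_def)
    have "inj_on (\<lambda>t. (t - a) / (b' - a)) T" using b' by (auto simp: inj_on_def)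
    then show "card T' = k" unfolding T'_def using T(2) by (simp add: card_image)
    show "T' \<subseteq> {\<rho><..<1}" using T(3) b' unfolding T'_def \<rho>_def by (auto simp: divide_strict_right_mono)
  qed
  have sT: "signed (T' \<times> {e})" "sum snd (T' \<times> {e}) = int k * e" "fst ` (T' \<times> {e}) \<subseteq> {\<rho><..<1}"
    using T' \<rho> e by (auto intro!: signed_uniform simp: sum_snd_uniform)
  \<comment> \<open>The same arrows are read along the circle and along \<open>C\<close>, which
    agree beyond \<open>b\<close>, where nothing was exchanged.\<close>
  define AT where "AT = put (\<gamma> i) (T \<times> {e})"
  have AT: "AT = put C (T' \<times> {e})"
  proof -
    have "g2 t = \<gamma> i t \<and> dir g2 t = dir (\<gamma> i) t" if "t \<in> T" for t
      using R.rest_pos(1)[OF rest_b[OF Tin(1,3)[OF that]]] R.rest_pdir[OF rest_b[OF Tin(1,3)[OF that]]]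
      by (simp add: g2_def pos_def pdir_def)
    then have "AT = put g2 (T \<times> {e})" unfolding AT_def put_uniform by auto
    also have "\<dots> = put C (T' \<times> {e})" unfolding C_def
      by (rule put_subarc[OF ig2 b'(3) inj2, symmetric]) (force simp: T'_def)
    finally show ?thesis .
  qed
  have T01: "T \<subseteq> {0<..<1}" using near(1)[OF Tin(1)] \<epsilon>'(3,4) by fastforce
  have Tnd: "(i, t) \<notin> double_params n \<gamma>" if "t \<in> T" for t by (rule \<epsilon>'(5)[OF near(1)[OF Tin(1)[OF that]]])
  have Tarr: "\<gamma> i ` T \<inter> arrow_points D = {}" using clear_ab Tin(1) by blast
  have okT: "arrows_ok n \<gamma> (arrows D \<union> AT)" unfolding AT_def
    by (rule arrows_ok_add[OF P A i T(1) T01 Tnd _ e]) (use Tarr in \<open>simp_all add: arrow_points_def\<close>)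
  have disT: "fst ` (arrows D \<union> AT) \<inter> \<gamma> i ` {a..b} = {}"
  proof -
    have "\<gamma> i t \<noteq> \<gamma> i r" if "t \<in> T" "r \<in> {a..b}" for t r
    proof
      assume eq: "\<gamma> i t = \<gamma> i r"
      have r: "r \<in> {a..b'}" using that(2) b' by auto
      have "(i, r) = (i, t)"
        by (rule simple_param[OF Tnd[OF that(1)] near(2)[OF Tin(1)[OF that(1)]] near(2)[OF r]])
          (use eq in \<open>simp add: pos_def\<close>)
      then show False using Tin(2)[OF that(1)] that(2) by simp
    qed
    then have "\<gamma> i ` T \<inter> \<gamma> i ` {a..b} = {}" by (intro disjoint_images)
    moreover have "fst ` AT = \<gamma> i ` T" unfolding AT_def put_uniform by force
    ultimately show ?thesis using dis unfolding image_Un by (simp add: Int_Un_distrib2)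
  qed
  have plain: "\<exists>X. signed X \<and> sum snd X = \<sigma> * p1 \<and> Omega_inf p1 D (decorate D2A C X)" for p1
  proof -
    obtain X where X: "signed X" "sum snd X = \<sigma> * p1" "Omega_inf p1 (D\<lparr>arrows := arrows D\<rparr>) (R.D2\<lparr>arrows := arrows D \<union> put C X\<rparr>)"
      using Om'[of p1] A dis by blast
    then show ?thesis by (intro exI[of _ X]) (simp add: decorate_def D2A_def)
  qed
  \<comment> \<open>The move to be undone starts from the diagram that already carries the
    \<open>k\<close> arrows; its target decorates the same free strand.\<close>
  have extra: "\<exists>X. signed X \<and> sum snd X = \<sigma> * p1 + int k * e \<and>
    Omega_inf p1 (D\<lparr>arrows := arrows D \<union> AT\<rparr>) (decorate D2A C X)" for p1
  proof -
    obtain X where X: "signed X" "sum snd X = \<sigma> * p1" "fst ` X \<subseteq> {0<..<\<rho>}"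
      "Omega_inf p1 (D\<lparr>arrows := arrows D \<union> AT\<rparr>) (R.D2\<lparr>arrows := (arrows D \<union> AT) \<union> put C X\<rparr>)"
      using Om'[of p1] okT disT by blast
    have "fst ` X \<inter> fst ` (T' \<times> {e}) = {}"
    proof (rule equals0I)
      fix r assume "r \<in> fst ` X \<inter> fst ` (T' \<times> {e})"
      then have "r < \<rho>" "\<rho> < r" using X(3) sT(3) by auto
      then show False by simp
    qed
    note U = signed_Un[OF X(1) sT(1) this]
    have "R.D2\<lparr>arrows := (arrows D \<union> AT) \<union> put C X\<rparr> = decorate D2A C (X \<union> T' \<times> {e})"
      unfolding AT by (simp add: decorate_def D2A_def put_Un Un_ac)
    then show ?thesis using U X(2,4) sT(2) by (intro exI[of _ "X \<union> T' \<times> {e}"]) simp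
  qed
  \<comment> \<open>Arrows on the arc count \<open>\<sigma>\<close> times along the circle, so the
    larger number is used on the way out if \<open>e = \<sigma>\<close> and on the way back
    otherwise.\<close>
  obtain p1 p2 where pp: "Omega_inf p1 \<in> M" "Omega_inf p2 \<in> M" "\<sigma> * p1 = \<sigma> * p2 + int k * e"
  proof (cases "e = \<sigma>")
    case True
    then show thesis using that[of "p + int k" p] M(2,3) by (simp add: algebra_simps)
  next
    case False
    then have "e = - \<sigma>" using e \<sigma> by auto
    then show thesis using that[of p "p + int k"] M(2,3) by (simp add: algebra_simps)
  qed
  obtain X1 where X1: "signed X1" "sum snd X1 = \<sigma> * p1" "Omega_inf p1 D (decorate D2A C X1)"
    using plain by blast
  obtain X2 where X2: "signed X2" "sum snd X2 = \<sigma> * p2 + int k * e"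
    "Omega_inf p2 (D\<lparr>arrows := arrows D \<union> AT\<rparr>) (decorate D2A C X2)"
    using extra by blast
  have "equivclp (step M) (decorate D2A C X1) (decorate D2A C X2)"
    by (rule decorate_equiv[OF M(1) F X1(1) X2(1)]) (use X1(2) X2(2) pp(3) in simp)
  then have eqv: "equivclp (step M) D (D\<lparr>arrows := arrows D \<union> AT\<rparr>)"
    by (rule equivclp_trans[OF equivclp_trans[OF equiv_move[OF pp(1) X1(3)]] equivclp_sym[OF equiv_move[OF pp(2) X2(3)]]])
  have "\<forall>t\<in>T. \<bar>t - t0\<bar> < \<epsilon>" using near(1)[OF Tin(1)] \<epsilon>'(2) by fastforce
  then show ?thesis
    unfolding creates_def using T(1,2) T01 Tnd Tarr eqv[unfolded AT_def] by blast
qed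

text \<open>
  If the strand is not outermost along the ray, an \<open>Omega_inf\<close> move at the outermost point of the
  ray removes this point from the ray; it is undone after the arrows have been created.
\<close>

lemma creates_on_ray:
  assumes M: "Omega4 \<in> M" "Omega_inf p \<in> M" "Omega_inf (p + int k) \<in> M"
    and i: "i < n" and RB: "ball q0 R \<subseteq> ball 0 1" and t0: "0 < t0" "t0 < 1"
    and e: "e = 1 \<or> e = (-1 :: int)"
  shows "parametrizes n \<gamma> U D \<Longrightarrow> arrow_diagram D \<Longrightarrow> shadow D \<subseteq> ball q0 R \<Longrightarrow>
    \<gamma> i t0 = q0 + exp (Complex a0 \<theta>) \<Longrightarrow> good_ray n \<gamma> D q0 \<theta> a0 \<Longrightarrow> finite (hits n \<gamma> q0 \<theta> a0) \<Longrightarrow>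
    0 < \<epsilon> \<Longrightarrow> creates M k e n \<gamma> D i t0 \<epsilon>"
proof (induction "card (hits n \<gamma> q0 \<theta> a0)" arbitrary: \<gamma> D \<epsilon> rule: less_induct)
  case less
  note P = less.prems(1) and D = less.prems(2) and sh = less.prems(3) and pt = less.prems(4)
    and good = less.prems(5) and fin = less.prems(6) and eps = less.prems(7)
  show ?case
  proof (cases "hits n \<gamma> q0 \<theta> a0 = {}")
    case True
    show ?thesis by (rule creates_outermost[OF M P D i sh RB t0 pt good True e eps])
  next
    case False
    have A: "arrows_ok n \<gamma> (arrows D)" by (rule arrows_ok_of_diagram[OF P D])
    have finA: "finite (arrow_points D)" using A by (simp add: arrow_points_def arrows_ok_def)
    define d where "d x = norm (pos \<gamma> x - q0)" for x
    \<comment> \<open>The outermost hit: nothing else meets the ray from there on, as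
      \<open>outer_arch\<close> requires.\<close>
    have "Max (d ` hits n \<gamma> q0 \<theta> a0) \<in> d ` hits n \<gamma> q0 \<theta> a0" using fin False by (intro Max_in) auto
    then obtain x where x: "x \<in> hits n \<gamma> q0 \<theta> a0" "d x = Max (d ` hits n \<gamma> q0 \<theta> a0)" by (metis imageE)
    then have xmax: "d y \<le> d x" if "y \<in> hits n \<gamma> q0 \<theta> a0" for y using that fin by simp
    obtain j t1 where xj: "x = (j, t1)" by (cases x)
    obtain a1 where a1: "a0 < a1" "pos \<gamma> x = q0 + exp (Complex a1 \<theta>)" and xp: "x \<in> params n"
      using x(1) unfolding hits_def by blast
    have gx: "(j, t1) \<notin> double_params n \<gamma>" "0 < t1" "\<gamma> j t1 \<notin> arrow_points D"
      "Im (vector_derivative (\<gamma> j) (at t1) / exp (Complex a1 \<theta>)) \<noteq> 0"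
      using good[unfolded good_ray_def, rule_format, OF xp less_imp_le[OF a1(1)] a1(2)] by (simp_all add: xj pos_def)
    have j: "j < n" and t1: "0 < t1" "t1 < 1" using xp gx(2) by (auto simp: xj params_def)
    have pj: "\<gamma> j t1 = q0 + exp (Complex a1 \<theta>)" using a1(2) by (simp add: xj pos_def)
    have expne: "exp (Complex c \<theta>) \<noteq> exp (Complex c' \<theta>)" if "c \<noteq> c'" for c c'
    proof
      assume "exp (Complex c \<theta>) = exp (Complex c' \<theta>)"
      then have "norm (exp (Complex c \<theta>)) = norm (exp (Complex c' \<theta>))" by simp
      then show False using that by simp
    qed
    have ne: "j \<noteq> i \<or> t1 \<noteq> t0"
    proof (rule ccontr)
      assume "\<not> (j \<noteq> i \<or> t1 \<noteq> t0)"
      then have "exp (Complex a1 \<theta>) = exp (Complex a0 \<theta>)" using pj pt by simp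
      then show False using expne[of a1 a0] a1(1) by simp
    qed
    \<comment> \<open>Half the distance of the parameters separates the exchanged arc from the
      strand at \<open>t0\<close> if both are on one circle. If the parameters coincide the circles
      differ, and any positive value will do.\<close>
    define \<mu> where "\<mu> = (if t1 = t0 then 1 else \<bar>t1 - t0\<bar> / 2)"
    have \<mu>: "0 < \<mu>" by (simp add: \<mu>_def)
    obtain \<epsilon>1 where \<epsilon>1: "0 < \<epsilon>1" "\<epsilon>1 \<le> \<mu>" "0 < t1 - \<epsilon>1" "t1 + \<epsilon>1 < 1"
      "\<And>t. \<bar>t - t1\<bar> < \<epsilon>1 \<Longrightarrow> (j, t) \<notin> double_params n \<gamma>" "\<And>t. \<bar>t - t1\<bar> < \<epsilon>1 \<Longrightarrow> \<gamma> j t \<notin> arrow_points D"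
      using clear_near[OF P j t1 gx(1) finA gx(3) \<mu>] by blast
    have ray: "y = (j, t1)" if y: "y \<in> params n" "a1 \<le> a" "pos \<gamma> y = q0 + exp (Complex a \<theta>)" for y a
    proof -
      have "y \<in> hits n \<gamma> q0 \<theta> a0" using y a1(1) unfolding hits_def by (auto intro!: exI[of _ a])
      then have "norm (exp (Complex a \<theta>)) \<le> norm (exp (Complex a1 \<theta>))"
        using xmax[of y] y(3) a1(2) by (simp add: d_def)
      then have "a = a1" using y(2) by simp
      then have "pos \<gamma> y = \<gamma> j t1" using y(3) pj by simp
      then show ?thesis using xp unfolding xj by (intro simple_param[OF gx(1) _ y(1)])
    qed
    obtain a b \<nu> \<nu>' \<sigma> where AR: "arc_replacement n \<gamma> U D j a b \<nu> \<nu>'"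
      and ab: "t1 - \<epsilon>1 < a" "a < t1" "t1 < b" "b < t1 + \<epsilon>1" and \<sigma>: "\<sigma> = 1 \<or> \<sigma> = (-1 :: int)"
      and \<nu>R: "\<And>t. t \<in> {a..b} \<Longrightarrow> \<nu> t \<in> ball q0 R" and off: "\<And>t c. t \<in> {a..b} \<Longrightarrow> \<nu> t \<noteq> q0 + exp (Complex c \<theta>)"
      and Om: "\<And>p. \<exists>S. signed S \<and> sum snd S = \<sigma> * p \<and>
        (\<forall>A. arrows_ok n \<gamma> A \<longrightarrow> fst ` A \<inter> \<gamma> j ` {a..b} = {} \<longrightarrow>
           Omega_inf p (D\<lparr>arrows := A\<rparr>)
             ((arc_replacement.D2 n \<gamma> D j a b \<nu>)
               \<lparr>arrows := A \<union> put (\<lambda>s. arc_replacement.\<gamma>2 \<gamma> j a b \<nu> j (a + (b - a) * s)) S\<rparr>))"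
      by (rule outer_arch[OF P j t1 gx(1) sh RB pj gx(4) ray \<epsilon>1(1)]) (assumption | (rule that; assumption))+
    interpret R: arc_replacement n \<gamma> U D j a b \<nu> \<nu>' by (rule AR)
    have near: "\<bar>t - t1\<bar> < \<epsilon>1" if "t \<in> {a..b}" for t using that ab by auto
    have dis: "fst ` arrows D \<inter> \<gamma> j ` {a..b} = {}"
    proof (rule equals0I)
      fix z assume "z \<in> fst ` arrows D \<inter> \<gamma> j ` {a..b}"
      then obtain t where "t \<in> {a..b}" "z = \<gamma> j t" "z \<in> arrow_points D" unfolding arrow_points_def by blast
      then show False using \<epsilon>1(6)[OF near] by blast
    qed
    define h0 where "h0 s = R.\<gamma>2 j (a + (b - a) * s)" for s
    obtain S where S: "signed S"
      "\<And>A. arrows_ok n \<gamma> A \<Longrightarrow> fst ` A \<inter> \<gamma> j ` {a..b} = {} \<Longrightarrow>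
         Omega_inf p (D\<lparr>arrows := A\<rparr>) (R.D2\<lparr>arrows := A \<union> put h0 S\<rparr>)"
      using Om[of p] unfolding h0_def[abs_def] by blast
    define D1 where "D1 = R.D2\<lparr>arrows := arrows D \<union> put h0 S\<rparr>"
    have Om1: "Omega_inf p D D1" using S(2)[OF A dis] by (simp add: D1_def)
    then have D1: "arrow_diagram D1" by (simp add: Omega_inf_def)
    have P1: "parametrizes n R.\<gamma>2 U D1" unfolding D1_def
      by (rule parametrizes_cong[OF R.parametrizes2]) simp_all
    have h0_arc: "h0 s \<in> \<nu> ` {a..b}" if "s \<in> {0<..<1}" for s
    proof -
      have "(b - a) * s \<le> (b - a) * 1" "0 \<le> (b - a) * s" using that ab by (auto intro!: mult_left_mono)
      then have "a + (b - a) * s \<in> {a..b}" by auto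
      then show ?thesis using R.arc_pos unfolding h0_def by auto
    qed
    have ap1: "arrow_points D1 \<subseteq> arrow_points D \<union> \<nu> ` {a..b}"
    proof -
      have "arrow_points D1 = arrow_points D \<union> h0 ` fst ` S"
        unfolding D1_def arrow_points_def by (simp add: image_Un fst_put)
      moreover have "h0 ` fst ` S \<subseteq> \<nu> ` {a..b}" using signed_fst[OF S(1)] h0_arc by blast
      ultimately show ?thesis by blast
    qed
    have rest_of: "y \<in> R.rest" if y: "y \<in> params n" "pos R.\<gamma>2 y = q0 + exp (Complex c \<theta>)" for y c
    proof (rule ccontr)
      assume "y \<notin> R.rest"
      then obtain t where "y = (j, t)" "t \<in> {a<..<b}" using R.params_split[OF y(1)] by blast
      then show False using off[of t c] y(2) R.arc_pos[of t] by (simp add: pos_def)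
    qed
    have i_rest: "(i, t) \<in> R.rest \<and> (j = i \<longrightarrow> t \<notin> {a..b})" if "\<bar>t - t0\<bar> < \<mu>" "t \<in> {0<..<1}" for t
    proof -
      have "t \<notin> {a..b}" if "j = i"
      proof
        assume "t \<in> {a..b}"
        then have "\<bar>t - t1\<bar> < \<epsilon>1" by (rule near)
        moreover have "t1 \<noteq> t0" using ne that by simp
        then have "2 * \<mu> = \<bar>t1 - t0\<bar>" by (simp add: \<mu>_def)
        ultimately show False using \<open>\<bar>t - t0\<bar> < \<mu>\<close> \<epsilon>1(2) by linarith
      qed
      moreover have "(i, t) \<in> params n" using that(2) by (intro unit_param[OF i]) auto
      ultimately show ?thesis unfolding R.rest_def by auto
    qed
    have r0: "(i, t0) \<in> R.rest" using i_rest[of t0] \<mu> t0 by simp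
    have pt2: "R.\<gamma>2 i t0 = q0 + exp (Complex a0 \<theta>)" using R.rest_pos(1)[OF r0] pt by (simp add: pos_def)
    have sh1: "shadow D1 \<subseteq> ball q0 R"
    proof -
      have "pos \<gamma> ` R.rest \<subseteq> shadow D" unfolding parametrizesD(2)[OF P] R.rest_def by blast
      then show ?thesis using sh \<nu>R unfolding parametrizesD(2)[OF P1] R.image2 by blast
    qed
    have good1: "good_ray n R.\<gamma>2 D1 q0 \<theta> a0"
      unfolding good_ray_def
    proof (intro ballI allI impI)
      fix y c assume y: "y \<in> params n" "a0 \<le> c" "pos R.\<gamma>2 y = q0 + exp (Complex c \<theta>)"
      have yr: "y \<in> R.rest" by (rule rest_of[OF y(1,3)])
      have py: "pos \<gamma> y = q0 + exp (Complex c \<theta>)" using R.rest_pos(1)[OF yr] y(3) by simp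
      note G = good[unfolded good_ray_def, rule_format, OF y(1,2) py]
      have "pos R.\<gamma>2 y \<notin> arrow_points D1"
      proof -
        have "q0 + exp (Complex c \<theta>) \<notin> arrow_points D" using G py by simp
        moreover have "q0 + exp (Complex c \<theta>) \<notin> \<nu> ` {a..b}" using off[of _ c] by (metis imageE)
        ultimately show ?thesis unfolding y(3) using ap1 by blast
      qed
      then show "y \<notin> double_params n R.\<gamma>2 \<and> 0 < snd y \<and> pos R.\<gamma>2 y \<notin> arrow_points D1 \<and>
        Im (vector_derivative (R.\<gamma>2 (fst y)) (at (snd y)) / exp (Complex c \<theta>)) \<noteq> 0"
        using G R.rest_pos(2)[OF yr] unfolding R.double_eq by simp
    qed
    \<comment> \<open>The new arc is off the ray, so hits of the changed diagram have their
      parameters in \<open>rest\<close>, where nothing moved, and \<open>x\<close> is not among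
      these.\<close>
    have sub: "hits n R.\<gamma>2 q0 \<theta> a0 \<subseteq> hits n \<gamma> q0 \<theta> a0 - {x}"
    proof
      fix y assume "y \<in> hits n R.\<gamma>2 q0 \<theta> a0"
      then obtain c where y: "y \<in> params n" "a0 < c" "pos R.\<gamma>2 y = q0 + exp (Complex c \<theta>)"
        unfolding hits_def by blast
      have yr: "y \<in> R.rest" by (rule rest_of[OF y(1,3)])
      then have "pos \<gamma> y = q0 + exp (Complex c \<theta>)" using R.rest_pos(1)[OF yr] y(3) by simp
      moreover have "y \<noteq> x" using yr ab unfolding xj R.rest_def by auto
      ultimately show "y \<in> hits n \<gamma> q0 \<theta> a0 - {x}" using y(1,2) unfolding hits_def by blast
    qed
    then have fin1: "finite (hits n R.\<gamma>2 q0 \<theta> a0)" using fin by (meson finite_Diff finite_subset)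
    have lt: "card (hits n R.\<gamma>2 q0 \<theta> a0) < card (hits n \<gamma> q0 \<theta> a0)"
      using sub x(1) fin by (intro psubset_card_mono) auto
    \<comment> \<open>The bound \<open>\<mu>\<close> keeps the arrows to be created away from the
      exchanged arc, which is put back afterwards.\<close>
    have "0 < min \<epsilon> \<mu>" using eps \<mu> by simp
    from less.hyps[OF lt P1 D1 sh1 pt2 good1 fin1 this]
    obtain T where T: "finite T" "card T = k" "T \<subseteq> {0<..<1}" "\<forall>t\<in>T. \<bar>t - t0\<bar> < min \<epsilon> \<mu>"
      "\<forall>t\<in>T. (i, t) \<notin> double_params n R.\<gamma>2" "R.\<gamma>2 i ` T \<inter> arrow_points D1 = {}"
      "equivclp (step M) D1 (D1\<lparr>arrows := arrows D1 \<union> put (R.\<gamma>2 i) (T \<times> {e})\<rparr>)"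
      unfolding creates_def by blast
    have Tr: "(i, t) \<in> R.rest" "j = i \<Longrightarrow> t \<notin> {a..b}" if "t \<in> T" for t
      using i_rest[of t] T(3,4) that by auto
    have same: "R.\<gamma>2 i t = \<gamma> i t" "dir (R.\<gamma>2 i) t = dir (\<gamma> i) t" if "t \<in> T" for t
      using R.rest_pos(1)[OF Tr(1)[OF that]] R.rest_pdir[OF Tr(1)[OF that]] by (simp_all add: pos_def pdir_def)
    have Tnd: "(i, t) \<notin> double_params n \<gamma>" if "t \<in> T" for t using T(5) that unfolding R.double_eq by blast
    define AT where "AT = put (\<gamma> i) (T \<times> {e})"
    have AT2: "put (R.\<gamma>2 i) (T \<times> {e}) = AT" unfolding AT_def put_uniform using same by auto
    have apD: "arrow_points D \<subseteq> arrow_points D1" unfolding D1_def arrow_points_def by auto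
    have "R.\<gamma>2 i ` T = \<gamma> i ` T" using same(1) by (intro image_cong) auto
    then have Tarr: "\<gamma> i ` T \<inter> arrow_points D = {}" using T(6) apD by auto
    have okT: "arrows_ok n \<gamma> (arrows D \<union> AT)" unfolding AT_def
      by (rule arrows_ok_add[OF P A i T(1,3) Tnd _ e]) (use Tarr in \<open>simp_all add: arrow_points_def\<close>)
    have disT: "fst ` (arrows D \<union> AT) \<inter> \<gamma> j ` {a..b} = {}"
    proof -
      have "\<gamma> i t \<noteq> \<gamma> j r" if "t \<in> T" "r \<in> {a..b}" for t r
      proof
        assume eq: "\<gamma> i t = \<gamma> j r"
        have "(j, r) = (i, t)"
          by (rule simple_param[OF Tnd[OF that(1)] unit_param[OF i] R.arc_params[OF that(2)]])
            (use eq T(3) that(1) in \<open>auto simp: pos_def\<close>)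
        then show False using Tr(2)[OF that(1)] that(2) by simp
      qed
      then have "\<gamma> i ` T \<inter> \<gamma> j ` {a..b} = {}" by (intro disjoint_images)
      moreover have "fst ` AT = \<gamma> i ` T" unfolding AT_def put_uniform by force
      ultimately show ?thesis using dis unfolding image_Un by (simp add: Int_Un_distrib2)
    qed
    \<comment> \<open>The decoration \<open>S\<close> was fixed before \<open>T\<close> was known
      and serves the enlarged arrow set as well; this is what makes the arc removable.\<close>
    have "Omega_inf p (D\<lparr>arrows := arrows D \<union> AT\<rparr>) (R.D2\<lparr>arrows := (arrows D \<union> AT) \<union> put h0 S\<rparr>)"
      by (rule S(2)[OF okT disT])
    moreover have "R.D2\<lparr>arrows := (arrows D \<union> AT) \<union> put h0 S\<rparr> = D1\<lparr>arrows := arrows D1 \<union> AT\<rparr>"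
      by (simp add: D1_def Un_ac)
    ultimately have Om2: "Omega_inf p (D\<lparr>arrows := arrows D \<union> AT\<rparr>) (D1\<lparr>arrows := arrows D1 \<union> AT\<rparr>)" by simp
    have "equivclp (step M) D (D\<lparr>arrows := arrows D \<union> AT\<rparr>)"
      by (rule equivclp_trans[OF equivclp_trans[OF equiv_move[OF M(2) Om1] T(7)[unfolded AT2]]
            equivclp_sym[OF equiv_move[OF M(2) Om2]]])
    moreover have "\<forall>t\<in>T. \<bar>t - t0\<bar> < \<epsilon>" using T(4) by simp
    ultimately show ?thesis
      unfolding creates_def AT_def using T(1-3) Tnd Tarr by blast
  qed
qed

section \<open>Generic rays\<close>

text \<open>The function is transported to one-dimensional vectors; a vanishing derivative has rank
  0, so its critical values are negligible.\<close>

lemma Sard_real: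
  fixes f :: "real \<Rightarrow> real"
  assumes "\<And>s. s \<in> S \<Longrightarrow> (f has_real_derivative 0) (at s within S)"
  shows "negligible ((vec :: real \<Rightarrow> real^1) ` f ` S)"
proof -
  have "negligible ((\<lambda>x::real^1. vec (f (x $ 1))) ` (vec ` S) :: (real^1) set)"
  proof (rule baby_Sard[where f' = "\<lambda>_. (*\<^sub>R) 0"])
    fix x :: "real^1" assume "x \<in> vec ` S"
    then obtain s where s: "s \<in> S" "x = vec s" by blast
    have "(f has_derivative (\<lambda>x. x * (\<lambda>_. 0) s)) (at s within S)"
    proof -
      have "((*) (0::real)) = (\<lambda>x. 0)" by (simp add: fun_eq_iff)
      then show ?thesis using assms[OF s(1)] by (simp add: has_field_derivative_def)
    qed
    from has_derivative_vector_1[OF this]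
    show "((\<lambda>x::real^1. vec (f (x $ 1)) :: real^1) has_derivative (*\<^sub>R) 0) (at x within vec ` S)"
      unfolding s(2) by simp
    have "matrix ((*\<^sub>R) 0 :: real^1 \<Rightarrow> real^1) = 0"
      by (simp add: matrix_def vec_eq_iff)
    then show "rank (matrix ((*\<^sub>R) 0 :: real^1 \<Rightarrow> real^1)) < CARD(1)" by simp
  qed simp
  then show ?thesis by (simp add: image_image)
qed

lemma interval_not_negligible:
  assumes "u < v"
  shows "\<not> negligible ((vec :: real \<Rightarrow> real^1) ` {u..v})"
proof -
  have "(vec ((u + v) / 2) :: real^1) \<in> box (vec u) (vec v)"
    using assms by (simp add: mem_box_cart)
  moreover have "(vec :: real \<Rightarrow> real^1) ` {u..v} = cbox (vec u) (vec v)"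
    by (simp add: vec_cbox_1_eq)
  ultimately show ?thesis using negligible_interval(1) by auto
qed

text \<open>Names the line through \<open>q0\<close> by a real number, so that the choice of a
  direction becomes the choice of a noncritical value of a real function. Points on the vertical
  line through \<open>q0\<close> are kept out by conditions on \<open>Re\<close>.\<close>

definition slope :: "complex \<Rightarrow> real" where "slope w = Im w / Re w"

text \<open>The numerator is the determinant of the radius vector and the velocity: critical points
  of the slope are tangencies to lines through \<open>q0\<close>.\<close>

lemma slope_derivative:
  assumes "(c has_vector_derivative c') (at t)" "Re (c t - q0) \<noteq> 0"
  shows "((\<lambda>t. slope (c t - q0)) has_real_derivative Im (cnj (c t - q0) * c') / (Re (c t - q0))\<^sup>2) (at t)"
proof -
  have "((\<lambda>t. Re (c t)) has_real_derivative Re c') (at t)" "((\<lambda>t. Im (c t)) has_real_derivative Im c') (at t)"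
    using assms(1) unfolding has_vector_derivative_complex_iff by auto
  note D = DERIV_diff[OF this(1) DERIV_const[of "Re q0"]] DERIV_diff[OF this(2) DERIV_const[of "Im q0"]]
  from DERIV_divide[OF D(2,1)] assms(2) show ?thesis
    unfolding slope_def by (simp add: power2_eq_square algebra_simps)
qed

lemma eventually_ne_of_derivative:
  fixes f :: "real \<Rightarrow> real"
  assumes "(f has_real_derivative d) (at x)" "d \<noteq> 0"
  shows "\<forall>\<^sub>F y in at x. f y \<noteq> f x"
proof -
  have "((\<lambda>y. (f y - f x) / (y - x)) \<longlongrightarrow> d) (at x)"
    using assms(1) unfolding has_field_derivative_iff .
  from tendsto_imp_eventually_ne[OF this assms(2)] show ?thesis
    by eventually_elim auto
qed

text \<open>Near \<open>s0\<close> the slope along \<open>c\<close> is not constant, so it takes all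
  values of some interval. The values excluded, critical ones of finitely many circles and those of
  finitely many points, are negligible and cannot fill it.\<close>

lemma generic_ray:
  assumes P: "parametrizes n \<gamma> U D" and F: "finite F"
    and c: "embedded_path c" and s0: "0 < s0" "s0 < 1"
    and gen: "Re (c s0 - q0) \<noteq> 0" "Im (cnj (c s0 - q0) * vector_derivative c (at s0)) \<noteq> 0"
  obtains s where "0 < s" "s < 1" "Re (c s - q0) \<noteq> 0"
    "\<And>z. z \<in> F \<Longrightarrow> Re (z - q0) \<noteq> 0 \<Longrightarrow> slope (z - q0) \<noteq> slope (c s - q0)"
    "\<And>j t. j < n \<Longrightarrow> Re (\<gamma> j t - q0) \<noteq> 0 \<Longrightarrow> slope (\<gamma> j t - q0) = slope (c s - q0) \<Longrightarrow>
       Im (cnj (\<gamma> j t - q0) * vector_derivative (\<gamma> j) (at t)) \<noteq> 0"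
proof -
  have gi: "generic_immersion n \<gamma>" by (rule parametrizesD(1)[OF P])
  define f where "f t = slope (c t - q0)" for t
  have cont: "isCont c t" if "t \<in> {0..1}" for t
    using embedded_pathD(1)[OF c that] has_vector_derivative_continuous by blast
  have s01: "s0 \<in> {0..1}" using s0 by simp
  have c1: "isCont (\<lambda>t. (Re (c t - q0))\<^sup>2) s0"
    using cont[OF s01] unfolding isCont_def by (intro tendsto_intros)
  have "0 < (Re (c s0 - q0))\<^sup>2" using gen(1) by simp
  from positive_near[OF c1 this]
  obtain d1 where d1: "0 < d1" "\<And>t. \<bar>t - s0\<bar> \<le> d1 \<Longrightarrow> 0 < (Re (c t - q0))\<^sup>2" by blast
  define d where "d = min d1 (min (s0 / 2) ((1 - s0) / 2))"
  have d: "0 < d" "d \<le> d1" "0 < s0 - d" "s0 + d < 1"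
  proof -
    show "0 < d" "d \<le> d1" using d1(1) s0 by (simp_all add: d_def)
    have "d \<le> s0 / 2" "d \<le> (1 - s0) / 2" unfolding d_def by linarith+
    moreover have "s0 / 2 < s0" "s0 + (1 - s0) / 2 < 1" using s0 by (simp_all add: field_simps)
    ultimately show "0 < s0 - d" "s0 + d < 1" by linarith+
  qed
  define J where "J = {s0 - d..s0 + d}"
  have J: "t \<in> {0..1}" "0 < t" "t < 1" "Re (c t - q0) \<noteq> 0" if "t \<in> J" for t
  proof -
    show "t \<in> {0..1}" "0 < t" "t < 1" using that d unfolding J_def by auto
    have "\<bar>t - s0\<bar> \<le> d1" using that d(2) unfolding J_def by auto
    then show "Re (c t - q0) \<noteq> 0" using d1(2)[of t] by auto
  qed
  have Df: "(f has_real_derivative Im (cnj (c t - q0) * vector_derivative c (at t)) / (Re (c t - q0))\<^sup>2) (at t)"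
    if "t \<in> J" for t
    unfolding f_def[abs_def] by (rule slope_derivative[OF embedded_pathD(1)[OF c J(1)[OF that]] J(4)[OF that]])
  have "continuous_on J f"
    using Df by (intro continuous_at_imp_continuous_on) (auto intro: DERIV_isCont)
  then have con: "connected (f ` J)" unfolding J_def by (intro connected_continuous_image) auto
  have s0J: "s0 \<in> J" using d by (simp add: J_def)
  have "\<forall>\<^sub>F y in at s0. f y \<noteq> f s0"
    by (rule eventually_ne_of_derivative[OF Df[OF s0J]]) (use gen in simp)
  moreover have "\<forall>\<^sub>F y in at s0. y \<in> {s0 - d<..<s0 + d}"
    by (rule eventually_at_in_open') (use d in auto)
  ultimately have "\<forall>\<^sub>F y in at s0. f y \<noteq> f s0 \<and> y \<in> J"
    by eventually_elim (auto simp: J_def)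
  then obtain s1 where s1: "f s1 \<noteq> f s0" "s1 \<in> J"
    using eventually_happens'[of "at s0"] by auto
  define u v where "u = min (f s0) (f s1)" and "v = max (f s0) (f s1)"
  have uv: "u < v" using s1(1) by (auto simp: u_def v_def)
  have "u \<in> f ` J" "v \<in> f ` J" using s0J s1(2) by (auto simp: u_def v_def min_def max_def)
  then have sub: "{u..v} \<subseteq> f ` J" using connected_contains_Icc[OF con] by blast
  define G where "G j t = slope (\<gamma> j t - q0)" for j t
  define Cr where "Cr j = {t. Re (\<gamma> j t - q0) \<noteq> 0 \<and> Im (cnj (\<gamma> j t - q0) * vector_derivative (\<gamma> j) (at t)) = 0}" for j
  \<comment> \<open>Slopes of lines tangent to one of the circles, and slopes of lines through a
    point of \<open>F\<close>.\<close>
  define bad where "bad = (\<Union>j\<in>{..<n}. G j ` Cr j) \<union> (\<lambda>z. slope (z - q0)) ` F"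
  have "negligible ((vec :: real \<Rightarrow> real^1) ` G j ` Cr j)" if "j < n" for j
  proof (rule Sard_real)
    fix t assume t: "t \<in> Cr j"
    have "(G j has_real_derivative Im (cnj (\<gamma> j t - q0) * vector_derivative (\<gamma> j) (at t)) / (Re (\<gamma> j t - q0))\<^sup>2) (at t)"
      unfolding G_def[abs_def]
      by (rule slope_derivative[OF immersed_circleD(2)[OF generic_immersionD[OF gi that]]]) (use t in \<open>simp add: Cr_def\<close>)
    then show "(G j has_real_derivative 0) (at t within Cr j)"
      using t by (simp add: Cr_def has_field_derivative_at_within)
  qed
  then have "negligible (\<Union>j\<in>{..<n}. (vec :: real \<Rightarrow> real^1) ` G j ` Cr j)"
    by (intro negligible_Union) auto
  moreover have "negligible ((vec :: real \<Rightarrow> real^1) ` (\<lambda>z. slope (z - q0)) ` F)"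
    using F by (intro negligible_finite) simp
  ultimately have "negligible ((vec :: real \<Rightarrow> real^1) ` bad)"
    unfolding bad_def image_Un image_UN by (rule negligible_Un)
  then have neg: "negligible ((vec :: real \<Rightarrow> real^1) ` bad)" .
  have "\<not> {u..v} \<subseteq> bad"
  proof
    assume "{u..v} \<subseteq> bad"
    from negligible_subset[OF neg image_mono[OF this]] interval_not_negligible[OF uv] show False by simp
  qed
  then obtain m where m: "m \<in> {u..v}" "m \<notin> bad" by blast
  then obtain s where s: "s \<in> J" "f s = m" using sub by blast
  show ?thesis
  proof
    show "0 < s" "s < 1" "Re (c s - q0) \<noteq> 0" using J[OF s(1)] by auto
    show "slope (z - q0) \<noteq> slope (c s - q0)" if "z \<in> F" for z
    proof
      assume "slope (z - q0) = slope (c s - q0)"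
      then have "m = slope (z - q0)" using s(2) by (simp add: f_def)
      then have "m \<in> (\<lambda>z. slope (z - q0)) ` F" using that by (rule image_eqI)
      then show False using m(2) unfolding bad_def by simp
    qed
    show "Im (cnj (\<gamma> j t - q0) * vector_derivative (\<gamma> j) (at t)) \<noteq> 0"
      if "j < n" "Re (\<gamma> j t - q0) \<noteq> 0" "slope (\<gamma> j t - q0) = slope (c s - q0)" for j t
    proof
      assume "Im (cnj (\<gamma> j t - q0) * vector_derivative (\<gamma> j) (at t)) = 0"
      then have "t \<in> Cr j" using that(2) by (simp add: Cr_def)
      moreover have "G j t = m" using that(3) s(2) by (simp add: G_def f_def)
      ultimately show False using m(2) that(1) unfolding bad_def by blast
    qed
  qed
qed

text \<open>Infinitely many hits on a circle would accumulate. The limit is again on the ray, and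
  transversality there makes intersections isolated.\<close>

lemma finite_hits:
  assumes P: "parametrizes n \<gamma> U D" and good: "good_ray n \<gamma> D q0 \<theta> a0"
  shows "finite (hits n \<gamma> q0 \<theta> a0)"
proof -
  have gi: "generic_immersion n \<gamma>" by (rule parametrizesD(1)[OF P])
  define v where "v = exp (Complex 0 \<theta>)"
  have v: "norm v = 1" "v \<noteq> 0" by (simp_all add: v_def)
  have vv: "cnj v * v = 1" using complex_norm_square[of v] v(1) by (simp add: mult.commute)
  have ev: "exp (Complex a \<theta>) = of_real (exp a) * v" for a
    by (simp add: v_def exp_of_real[symmetric] exp_add[symmetric] Complex_eq)
  \<comment> \<open>Turns the ray onto the positive real axis: lying on the line of the ray means
    \<open>Im (K z) = 0\<close>.\<close>
  define K where "K z = cnj v * (z - q0)" for z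
  have Kray: "K (q0 + exp (Complex a \<theta>)) = of_real (exp a)" for a
    unfolding K_def ev using vv by (simp add: mult.left_commute)
  have Kback: "z = q0 + exp (Complex (ln r) \<theta>)" if "K z = of_real r" "0 < r" for z r
  proof -
    have "v * K z = z - q0" unfolding K_def using vv by (simp add: mult.assoc[symmetric] mult.commute)
    then show ?thesis using that by (simp add: ev algebra_simps)
  qed
  \<comment> \<open>With \<open>a \<ge> a0\<close> and the closed unit interval, limits of hits are
    still subject to \<open>good_ray\<close>.\<close>
  define H where "H j = {t \<in> {0..1}. \<exists>a\<ge>a0. \<gamma> j t = q0 + exp (Complex a \<theta>)}" for j
  have finH: "finite (H j)" if j: "j < n" for j
  proof (rule ccontr)
    assume inf: "infinite (H j)"
    have ic: "immersed_circle (\<gamma> j)" by (rule generic_immersionD[OF gi j])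
    have "H j \<subseteq> {0..1}" by (auto simp: H_def)
    then obtain l where l: "l \<in> {0..1}" "l islimpt H j"
      using inf compact_Icc[of "0::real" 1] unfolding compact_eq_Bolzano_Weierstrass by blast
    have cK: "continuous_on UNIV (\<lambda>t. K (\<gamma> j t))"
      unfolding K_def by (intro continuous_intros immersed_circleD(5)[OF ic])
    define S where "S = {t. Im (K (\<gamma> j t)) = 0 \<and> exp a0 \<le> Re (K (\<gamma> j t))}"
    have "closed S"
      unfolding S_def by (intro closed_Collect_conj closed_Collect_eq closed_Collect_le continuous_intros cK)
    moreover have HS: "H j \<subseteq> S" unfolding H_def S_def by (auto simp: Kray)
    ultimately have "l \<in> S" using l(2) by (meson closed_limpt islimpt_subset)
    then have "K (\<gamma> j l) = of_real (Re (K (\<gamma> j l)))" "exp a0 \<le> Re (K (\<gamma> j l))"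
      by (auto simp: S_def complex_eq_iff)
    moreover define a where "a = ln (Re (K (\<gamma> j l)))"
    moreover have "0 < Re (K (\<gamma> j l))" using calculation(2) exp_gt_zero[of a0] by linarith
    ultimately have a: "\<gamma> j l = q0 + exp (Complex a \<theta>)" "a0 \<le> a"
      using Kback by (simp_all add: ln_ge_iff)
    have fl: "(j, frac l) \<in> params n" "pos \<gamma> (j, frac l) = q0 + exp (Complex a \<theta>)"
      using param_of[OF gi j, of l] a(1) by auto
    note G = good[unfolded good_ray_def, rule_format, OF fl(1) a(2) fl(2)]
    then have "0 < frac l" by simp
    then have lf: "frac l = l" using l(1) by (cases "l = 1") (auto simp: frac_eq)
    have "Im (vector_derivative (\<gamma> j) (at l) / exp (Complex a \<theta>)) \<noteq> 0" using G lf by simp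
    moreover have "vector_derivative (\<gamma> j) (at l) / exp (Complex a \<theta>) = of_real (exp (- a)) * (cnj v * vector_derivative (\<gamma> j) (at l))"
    proof -
      have "inverse v = cnj v" using vv v(2) by (metis inverse_unique mult.commute)
      then show ?thesis unfolding ev by (simp add: divide_inverse exp_minus mult_ac)
    qed
    moreover have "Im (of_real r * w) = r * Im w" for r w by simp
    ultimately have nz: "Im (cnj v * vector_derivative (\<gamma> j) (at l)) \<noteq> 0"
      by (metis mult_zero_right)
    have "((\<lambda>t. K (\<gamma> j t)) has_vector_derivative cnj v * (vector_derivative (\<gamma> j) (at l) - 0)) (at l)"
      unfolding K_def by (intro has_vector_derivative_mult_right has_vector_derivative_diff
          immersed_circleD(2)[OF ic] has_vector_derivative_const)
    then have "((\<lambda>t. Im (K (\<gamma> j t))) has_real_derivative Im (cnj v * vector_derivative (\<gamma> j) (at l))) (at l)"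
      unfolding has_vector_derivative_complex_iff by simp
    from eventually_ne_of_derivative[OF this nz]
    have "\<forall>\<^sub>F t in at l. t \<notin> H j"
    proof eventually_elim
      case (elim t)
      then show ?case using \<open>l \<in> S\<close> HS unfolding S_def by auto
    qed
    then show False using l(2) by (simp add: islimpt_iff_eventually)
  qed
  have "hits n \<gamma> q0 \<theta> a0 \<subseteq> (SIGMA j:{..<n}. H j)"
    unfolding hits_def H_def params_def pos_def by (auto intro: less_imp_le)
  then show ?thesis using finH by (meson finite_SigmaI finite_lessThan finite_subset lessThan_iff)
qed

section \<open>Generation of the \<open>k\<close>-move\<close>

text \<open>Moves the centre slightly so that the strand at \<open>c\<close> is neither vertically
  above or below it nor directed along the line through it, which is what \<open>generic_ray\<close>
  needs to start.\<close>

lemma generic_centre: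
  fixes c c' :: complex and h :: real
  assumes "c' \<noteq> 0" "0 < h"
  obtains q0 where "norm q0 < h" "Re (c - q0) \<noteq> 0" "Im (cnj (c - q0) * c') \<noteq> 0"
proof -
  \<comment> \<open>The direction has real part 1 and is not parallel to \<open>c'\<close>, so each
    of the two conditions excludes a single distance \<open>t\<close> along it.\<close>
  define d where "d = (if Im c' \<noteq> 0 then 1 else 1 + \<i>)"
  have d: "Re d = 1" "Im (cnj d * c') \<noteq> 0" "norm d \<le> 2"
  proof -
    show "Re d = 1" by (simp add: d_def)
    show "Im (cnj d * c') \<noteq> 0" using assms(1) by (auto simp: d_def complex_eq_iff)
    show "norm d \<le> 2" unfolding d_def using norm_triangle_ineq[of 1 \<i>] by simp
  qed
  have "0 < h / 2" using assms(2) by simp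
  from many_points[OF _ this, of "{Re c, Im (cnj c * c') / Im (cnj d * c')}" 1]
  obtain T where T: "card T = 1" "T \<subseteq> {0<..<h / 2} - {Re c, Im (cnj c * c') / Im (cnj d * c')}" by auto
  then obtain t where "t \<in> T" by (metis card.empty equals0I zero_neq_one)
  then have t: "0 < t" "t < h / 2" "t \<noteq> Re c" "t \<noteq> Im (cnj c * c') / Im (cnj d * c')" using T(2) by auto
  show ?thesis
  proof
    have "norm (of_real t * d) \<le> t * 2" using t(1) d(3) by (simp add: norm_mult)
    then show "norm (of_real t * d) < h" using t(2) by linarith
    show "Re (c - of_real t * d) \<noteq> 0" using t(3) d(1) by simp
    have "Im (cnj (c - of_real t * d) * c') = Im (cnj c * c') - t * Im (cnj d * c')"
      by (simp add: algebra_simps)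
    moreover have "Im (cnj c * c') \<noteq> t * Im (cnj d * c')" using t(4) d(2) by (auto simp: field_simps)
    ultimately show "Im (cnj (c - of_real t * d) * c') \<noteq> 0" by linarith
  qed
qed

lemma shadow_bound:
  assumes P: "parametrizes n \<gamma> U D"
  obtains r where "r < 1" "\<And>z. z \<in> shadow D \<Longrightarrow> norm z \<le> r"
proof (cases "shadow D = {}")
  case True
  then show ?thesis using that[of 0] by simp
next
  case False
  have gi: "generic_immersion n \<gamma>" by (rule parametrizesD(1)[OF P])
  have "shadow D = (\<Union>j<n. \<gamma> j ` {0..1})"
  proof
    show "shadow D \<subseteq> (\<Union>j<n. \<gamma> j ` {0..1})"
      unfolding parametrizesD(2)[OF P] by (force simp: params_def pos_def)
    show "(\<Union>j<n. \<gamma> j ` {0..1}) \<subseteq> shadow D"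
    proof clarify
      fix j and t :: real assume "j < n"
      from param_of[OF gi this, of t] show "\<gamma> j t \<in> shadow D"
        unfolding parametrizesD(2)[OF P] by (metis imageI)
    qed
  qed
  then have "compact (shadow D)"
    using immersed_circleD(5)[OF generic_immersionD[OF gi]]
    by (auto intro!: compact_UN compact_continuous_image)
  from continuous_attains_sup[OF this False continuous_on_norm_id]
  obtain z0 where z0: "z0 \<in> shadow D" "\<forall>z\<in>shadow D. norm z \<le> norm z0" by blast
  have "norm z0 < 1" using parametrizesD(3)[OF P] z0(1) by auto
  then show ?thesis using that z0(2) by blast
qed

section \<open>Comparing a path in the shadow with the circle that carries it\<close>

lemma isCont_dir:
  assumes "immersed_circle g"
  shows "isCont (dir g) t"
proof -
  have "isCont (\<lambda>t. vector_derivative g (at t)) t"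
    using immersed_circleD(3)[OF assms] by (simp add: continuous_on_eq_continuous_at)
  then show ?thesis
    unfolding isCont_def dir_def[abs_def] by (rule tendsto_sgn) (rule immersed_circleD(4)[OF assms])
qed

lemma norm_dir: "embedded_path c \<Longrightarrow> s \<in> {0..1} \<Longrightarrow> norm (dir c s) = 1"
  unfolding dir_def using embedded_pathD(2) by (simp add: norm_sgn)

text \<open>Positions follow the circle because the shadow near a simple point is one branch.
  Directions agree up to a sign, and by continuity of both unit tangents the sign cannot switch near
  \<open>sg\<close>.\<close>

lemma path_follows_strand:
  assumes P: "parametrizes n \<gamma> U D" and c: "embedded_path c" "path_image c \<subseteq> shadow D"
    "path_image c \<inter> crossings D = {}" and sg: "0 < sg" "sg < 1"
    and x: "(i, t0) \<in> params n - double_params n \<gamma>" "c sg = \<gamma> i t0" and t0: "0 < t0" "t0 < 1"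
    and e: "e = 1 \<or> e = (-1::int)" "dir c sg = of_int e * dir (\<gamma> i) t0" and "0 < \<epsilon>"
  obtains \<eta> where "0 < \<eta>" "\<And>s. \<bar>s - sg\<bar> < \<eta> \<Longrightarrow> 0 < s \<and> s < 1 \<and>
    (\<exists>\<tau>. \<bar>\<tau> - t0\<bar> < \<epsilon> \<and> c s = \<gamma> i \<tau> \<and> dir c s = of_int e * dir (\<gamma> i) \<tau>)"
proof -
  have gi: "generic_immersion n \<gamma>" by (rule parametrizesD(1)[OF P])
  have i: "i < n" using x(1) by (auto simp: params_def)
  have ic: "immersed_circle (\<gamma> i)" by (rule generic_immersionD[OF gi i])
  from isCont_dir[OF ic, of t0, unfolded continuous_at_eps_delta, rule_format, of 1]
  obtain d1 where d1: "0 < d1" "\<And>t. dist t t0 < d1 \<Longrightarrow> dist (dir (\<gamma> i) t) (dir (\<gamma> i) t0) < 1" by auto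
  define d where "d = min (min \<epsilon> d1) (min t0 (1 - t0))"
  have d: "0 < d" "d \<le> \<epsilon>" "d \<le> d1" "d \<le> t0" "d \<le> 1 - t0"
    using \<open>0 < \<epsilon>\<close> d1(1) t0 by (auto simp: d_def)
  obtain \<eta>1 where \<eta>1: "0 < \<eta>1" "\<And>z. z \<in> shadow D \<Longrightarrow> dist z (c sg) < \<eta>1 \<Longrightarrow> \<exists>\<tau>. \<bar>\<tau> - t0\<bar> < d \<and> z = \<gamma> i \<tau>"
    using local_strand[OF P x(1) d(1)] unfolding x(2) pos_def by auto
  have sg01: "sg \<in> {0..1}" using sg by simp
  have "isCont c sg" using embedded_pathD(1)[OF c(1) sg01] has_vector_derivative_continuous by blast
  from this[unfolded continuous_at_eps_delta, rule_format, OF \<eta>1(1)]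
  obtain d2 where d2: "0 < d2" "\<And>s. dist s sg < d2 \<Longrightarrow> dist (c s) (c sg) < \<eta>1" by blast
  have "isCont (dir c) sg"
  proof -
    have "continuous_on {0<..<1} (\<lambda>t. vector_derivative c (at t))"
      by (rule continuous_on_subset[OF embedded_pathD(5)[OF c(1)]]) auto
    then have "isCont (\<lambda>t. vector_derivative c (at t)) sg" using sg by (simp add: continuous_on_eq_continuous_at)
    then show ?thesis
      unfolding isCont_def dir_def[abs_def] by (rule tendsto_sgn) (rule embedded_pathD(2)[OF c(1) sg01])
  qed
  from this[unfolded continuous_at_eps_delta, rule_format, of 1]
  obtain d3 where d3: "0 < d3" "\<And>s. dist s sg < d3 \<Longrightarrow> dist (dir c s) (dir c sg) < 1" by auto
  define \<eta> where "\<eta> = min (min d2 d3) (min sg (1 - sg))"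
  show ?thesis
  proof
    show "0 < \<eta>" using d2(1) d3(1) sg by (simp add: \<eta>_def)
    fix s assume s: "\<bar>s - sg\<bar> < \<eta>"
    then have s01: "0 < s" "s < 1" and ds: "dist s sg < d2" "dist s sg < d3"
      by (auto simp: \<eta>_def dist_real_def)
    have im: "c s \<in> path_image c" using s01 unfolding path_image_def by simp
    then have cs: "c s \<in> shadow D" "c s \<notin> crossings D" using c(2,3) by blast+
    obtain \<tau> where \<tau>: "\<bar>\<tau> - t0\<bar> < d" "c s = \<gamma> i \<tau>" using \<eta>1(2)[OF cs(1) d2(2)[OF ds(1)]] by blast
    have \<tau>01: "0 < \<tau>" "\<tau> < 1" using \<tau>(1) d(4,5) by linarith+
    have ip: "(i, \<tau>) \<in> params n" by (rule unit_param[OF i \<tau>01])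
    have nd: "(i, \<tau>) \<notin> double_params n \<gamma>"
    proof
      assume "(i, \<tau>) \<in> double_params n \<gamma>"
      then have "pos \<gamma> (i, \<tau>) \<in> crossings D" unfolding crossings_eq[OF P] by (rule imageI)
      then show False using cs(2) \<tau>(2) by (simp add: pos_def)
    qed
    obtain y where y: "y \<in> params n" "c s = pos \<gamma> y" "dir c s = pdir \<gamma> y \<or> dir c s = - pdir \<gamma> y"
      using arrow_on_strand[OF P c(1,2) s01 cs(2)] by blast
    have "y = (i, \<tau>)" by (rule simple_param[OF nd ip y(1)]) (use y(2) \<tau>(2) in simp)
    then have pm: "dir c s = dir (\<gamma> i) \<tau> \<or> dir c s = - dir (\<gamma> i) \<tau>" using y(3) by (simp add: pdir_def)
    have "dir c s = of_int e * dir (\<gamma> i) \<tau>"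
    proof (rule ccontr)
      assume "dir c s \<noteq> of_int e * dir (\<gamma> i) \<tau>"
      then have "dir c s = - (of_int e * dir (\<gamma> i) \<tau>)" using pm e(1) by auto
      then have "dist (dir c s) (dir c sg) = norm (of_int e * (dir (\<gamma> i) \<tau> + dir (\<gamma> i) t0))"
        unfolding e(2) dist_norm by (metis (no_types, opaque_lifting) distrib_left minus_add_distrib norm_minus_cancel uminus_add_conv_diff add.commute)
      also have "\<dots> = norm (dir (\<gamma> i) \<tau> + dir (\<gamma> i) t0)" using e(1) by (auto simp: norm_mult)
      finally have A: "norm (dir (\<gamma> i) \<tau> + dir (\<gamma> i) t0) < 1" using d3(2)[OF ds(2)] by simp
      have B: "norm (dir (\<gamma> i) \<tau> - dir (\<gamma> i) t0) < 1"
        using d1(2)[of \<tau>] \<tau>(1) d(3) by (simp add: dist_real_def dist_norm)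
      have "norm (dir (\<gamma> i) t0) = 1" using immersed_circleD(4)[OF ic] by (simp add: dir_def norm_sgn)
      \<comment> \<open>If the sign switched, sum and difference of two unit vectors would both have
        norm below 1, although they differ by twice a unit vector.\<close>
      then have "2 = norm ((dir (\<gamma> i) \<tau> + dir (\<gamma> i) t0) - (dir (\<gamma> i) \<tau> - dir (\<gamma> i) t0))"
        by (simp add: norm_mult flip: mult_2)
      also have "\<dots> \<le> norm (dir (\<gamma> i) \<tau> + dir (\<gamma> i) t0) + norm (dir (\<gamma> i) \<tau> - dir (\<gamma> i) t0)"
        by (rule norm_triangle_ineq4)
      finally show False using A B by linarith
    qed
    then show "0 < s \<and> s < 1 \<and> (\<exists>\<tau>. \<bar>\<tau> - t0\<bar> < \<epsilon> \<and> c s = \<gamma> i \<tau> \<and> dir c s = of_int e * dir (\<gamma> i) \<tau>)"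
      using s01 \<tau> d(2) by (intro conjI exI[of _ \<tau>]) auto
  qed
qed

text \<open>The path of a k-move may already carry arrows. Those in its interior are rewritten as a
  decoration, after which sliding along \<open>g\<close> applies in their presence.\<close>

lemma strip_path:
  assumes D: "arrow_diagram D" and g: "embedded_path g" "path_image g \<subseteq> shadow D" "path_image g \<inter> crossings D = {}"
  obtains Db S where "free_strand Db g" "signed S" "D = decorate Db g S"
    "\<And>s. s \<in> fst ` S \<Longrightarrow> g s \<in> arrow_points D"
proof -
  obtain n \<gamma> U where P: "parametrizes n \<gamma> U D" and A: "arrows_ok n \<gamma> (arrows D)"
    using D arrow_diagram_iff by blast
  define Db where "Db = D\<lparr>arrows := {x \<in> arrows D. fst x \<notin> g ` {0<..<1}}\<rparr>"
  define S where "S = {(s, f). s \<in> {0<..<1} \<and> f \<in> {1, -1::int} \<and> (g s, of_int f * dir g s) \<in> arrows D}"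
  have nz: "dir g s \<noteq> 0" if "s \<in> {0<..<1}" for s
  proof -
    have "norm (dir g s) = 1" by (rule norm_dir[OF g(1)]) (use that in auto)
    then show ?thesis by auto
  qed
  have ui: "x = y" if "x \<in> arrows D" "y \<in> arrows D" "fst x = fst y" for x y
    using A that unfolding arrows_ok_def by (auto dest: inj_onD)
  have gi: "s = s'" if "s \<in> {0<..<1}" "s' \<in> {0<..<1}" "g s = g s'" for s s'
    using inj_onD[OF embedded_pathD(3)[OF g(1)], of s s'] that by auto
  have injS: "inj_on fst S"
  proof (rule inj_onI)
    fix x y assume xy: "x \<in> S" "y \<in> S" "fst x = fst y"
    then have "(g (fst x), of_int (snd x) * dir g (fst x)) = (g (fst y), of_int (snd y) * dir g (fst y))"
      by (intro ui) (auto simp: S_def)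
    then have "of_int (snd x) * dir g (fst x) = of_int (snd y) * dir g (fst x)" using xy(3) by simp
    moreover have "dir g (fst x) \<noteq> 0" using xy(1) nz by (auto simp: S_def)
    ultimately show "x = y" using xy(3) by (simp add: prod_eq_iff)
  qed
  have "inj_on (\<lambda>x. g (fst x)) S"
  proof (rule inj_onI)
    fix x y assume xy: "x \<in> S" "y \<in> S" "g (fst x) = g (fst y)"
    then have "fst x = fst y" by (intro gi) (auto simp: S_def)
    then show "x = y" using injS xy(1,2) by (meson inj_onD)
  qed
  moreover have "(\<lambda>x. g (fst x)) ` S \<subseteq> fst ` arrows D" unfolding S_def by force
  moreover have "finite (fst ` arrows D)" using A by (simp add: arrows_ok_def)
  ultimately have "finite S" by (meson finite_subset finite_imageD)
  then have sgn: "signed S" using injS unfolding signed_def S_def by auto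
  show ?thesis
  proof
    show "signed S" by (rule sgn)
    have "arrow_diagram Db" unfolding Db_def by (rule arrow_diagram_subset[OF D]) auto
    moreover have "crossings Db = crossings D" by (simp add: Db_def crossings_def)
    ultimately show "free_strand Db g"
      using g unfolding free_strand_def by (auto simp: Db_def arrow_points_def)
    have "x \<in> put g S" if x: "x \<in> arrows D" "fst x \<in> g ` {0<..<1}" for x
    proof -
      obtain q u where qu: "x = (q, u)" by (cases x)
      obtain s where s: "s \<in> {0<..<1}" "q = g s" using x(2) qu by auto
      have "g s \<in> path_image g" using s unfolding path_image_def by auto
      then have "g s \<notin> crossings D" using g(3) by blast
      then obtain y where y: "y \<in> params n - double_params n \<gamma>" "g s = pos \<gamma> y" "dir g s = pdir \<gamma> y \<or> dir g s = - pdir \<gamma> y"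
        using arrow_on_strand[OF P g(1,2)] s(1) by (metis greaterThanLessThan_iff)
      obtain z where z: "z \<in> params n - double_params n \<gamma>" "q = pos \<gamma> z" "u \<in> {pdir \<gamma> z, - pdir \<gamma> z}"
        using A x(1) unfolding qu arrows_ok_def by blast
      have "z = y" using y(1,2) z(1,2) s(2) unfolding double_params_def by auto
      then have "u = dir g s \<or> u = - dir g s" using y(3) z(3) by auto
      then obtain f :: int where f: "f \<in> {1, -1}" "u = of_int f * dir g s"
        by (metis insertI1 insertI2 mult_1 mult_minus1 of_int_1 of_int_minus)
      then have "(s, f) \<in> S" using s x(1) unfolding S_def qu by auto
      then show ?thesis unfolding put_def qu using f s(2) by force
    qed
    moreover have "put g S \<subseteq> arrows D" unfolding put_def S_def by auto
    ultimately have "arrows D = {x \<in> arrows D. fst x \<notin> g ` {0<..<1}} \<union> put g S" by blast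
    then show "D = decorate Db g S" by (simp add: decorate_def Db_def)
    show "g s \<in> arrow_points D" if "s \<in> fst ` S" for s
      using that unfolding S_def arrow_points_def by force
  qed
qed

text \<open>The arrows are created near a generically chosen point of \<open>g\<close> instead of at
  \<open>T0\<close>. The positions delivered by \<open>creates_on_ray\<close> are on the circle but
  not known to be on \<open>g\<close>; they slide along an arc \<open>c\<close> of the circle to
  positions \<open>T1\<close> on \<open>g\<close>, and from there along \<open>g\<close>, in the
  presence of its other arrows, to \<open>T0\<close>.\<close>

lemma generates_k_move:
  assumes M: "Omega4 \<in> M" "Omega_inf p \<in> M" "Omega_inf (p + int k) \<in> M"
  shows "generates M (k_move k)"
  unfolding generates_def
proof (intro allI impI)
  fix D D' assume km: "k_move k D D'"
  then obtain g T0 where D: "arrow_diagram D" and DD: "shadow D' = shadow D" "overs D' = overs D"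
    and g: "embedded_path g" "path_image g \<subseteq> shadow D" "path_image g \<inter> crossings D = {}"
    and T0: "T0 \<subseteq> {0<..<1}" "finite T0" "card T0 = k" "g ` T0 \<inter> arrow_points D = {}"
      "arrows D' = arrows D \<union> (\<lambda>t. (g t, dir g t)) ` T0"
    unfolding k_move_def by blast
  obtain n \<gamma> U where P: "parametrizes n \<gamma> U D" and A: "arrows_ok n \<gamma> (arrows D)"
    using D arrow_diagram_iff by blast
  have gi: "generic_immersion n \<gamma>" by (rule parametrizesD(1)[OF P])
  obtain Db S0 where Db: "free_strand Db g" "signed S0" "D = decorate Db g S0"
    and S0: "\<And>s. s \<in> fst ` S0 \<Longrightarrow> g s \<in> arrow_points D"
    by (rule strip_path[OF D g]) blast
  have add: "signed (S0 \<union> T \<times> {1})" "sum snd (S0 \<union> T \<times> {1}) = sum snd S0 + int k"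
    "decorate Db g (S0 \<union> T \<times> {1}) = D\<lparr>arrows := arrows D \<union> put g (T \<times> {1})\<rparr>"
    if T: "T \<subseteq> {0<..<1}" "finite T" "card T = k" "g ` T \<inter> arrow_points D = {}" for T
  proof -
    have "fst ` S0 \<inter> fst ` (T \<times> {1::int}) = {}" using S0 T(4) by fastforce
    note U = signed_Un[OF Db(2) signed_uniform[OF T(2,1)] this]
    show "signed (S0 \<union> T \<times> {1})" "sum snd (S0 \<union> T \<times> {1}) = sum snd S0 + int k"
      using U T(3) by (simp_all add: sum_snd_uniform)
    show "decorate Db g (S0 \<union> T \<times> {1}) = D\<lparr>arrows := arrows D \<union> put g (T \<times> {1})\<rparr>"
      unfolding arg_cong[OF Db(3), of "\<lambda>D. D\<lparr>arrows := arrows D \<union> put g (T \<times> {1})\<rparr>"]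
      by (simp add: decorate_def put_Un Un_assoc)
  qed
  have D': "D' = decorate Db g (S0 \<union> T0 \<times> {1})"
    unfolding add(3)[OF T0(1-4)] put_uniform using DD T0(5) by simp
  obtain r where r: "r < 1" "\<And>z. z \<in> shadow D \<Longrightarrow> norm z \<le> r" using shadow_bound[OF P] by blast
  have half: "(1/2::real) \<in> {0..1}" by simp
  have "0 < (1 - r) / 2" using r(1) by simp
  from generic_centre[OF embedded_pathD(2)[OF g(1) half] this]
  obtain q0 where q0: "norm q0 < (1 - r) / 2" "Re (g (1/2) - q0) \<noteq> 0"
    "Im (cnj (g (1/2) - q0) * vector_derivative g (at (1/2))) \<noteq> 0" by metis
  \<comment> \<open>The largest open disk about \<open>q0\<close> inside the unit disk. It contains
    the diagram because \<open>r + norm q0 < 1 - norm q0\<close>.\<close>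
  define R where "R = 1 - norm q0"
  have RB: "ball q0 R \<subseteq> ball 0 1"
  proof
    fix z assume "z \<in> ball q0 R"
    then show "z \<in> ball 0 1"
      using norm_triangle_ineq[of q0 "z - q0"] by (simp add: R_def dist_norm norm_minus_commute)
  qed
  have sh: "shadow D \<subseteq> ball q0 R"
  proof
    fix z assume "z \<in> shadow D"
    then have "norm z \<le> r" by (rule r(2))
    moreover have "norm (q0 - z) \<le> norm q0 + norm z" by (rule norm_triangle_ineq4)
    moreover have "2 * norm q0 < 1 - r" using q0(1) by simp
    ultimately show "z \<in> ball q0 R" by (simp add: R_def dist_norm)
  qed
  \<comment> \<open>Base points of the circles are avoided as well, since \<open>good_ray\<close>
    asks for positive parameters.\<close>
  define F where "F = crossings D \<union> arrow_points D \<union> (\<lambda>j. \<gamma> j 0) ` {..<n}"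
  have finF: "finite F"
    using A gi unfolding F_def crossings_eq[OF P] arrow_points_def arrows_ok_def generic_immersion_def by simp
  have h: "0 < (1/2::real)" "(1/2::real) < 1" by simp_all
  obtain sg where sg: "0 < sg" "sg < 1" "Re (g sg - q0) \<noteq> 0"
    and avoid: "\<And>z. z \<in> F \<Longrightarrow> Re (z - q0) \<noteq> 0 \<Longrightarrow> slope (z - q0) \<noteq> slope (g sg - q0)"
    and trans: "\<And>j t. j < n \<Longrightarrow> Re (\<gamma> j t - q0) \<noteq> 0 \<Longrightarrow> slope (\<gamma> j t - q0) = slope (g sg - q0) \<Longrightarrow>
       Im (cnj (\<gamma> j t - q0) * vector_derivative (\<gamma> j) (at t)) \<noteq> 0"
    by (rule generic_ray[OF P finF g(1) h q0(2,3)]) (rule that)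
  define w where "w = g sg - q0"
  have w: "w \<noteq> 0" "Re w \<noteq> 0" using sg(3) by (auto simp: w_def)
  define a0 \<theta> where "a0 = Re (Ln w)" and "\<theta> = Im (Ln w)"
  have wexp: "exp (Complex a0 \<theta>) = w"
    unfolding a0_def \<theta>_def complex.collapse by (rule exp_Ln[OF w(1)])
  have on_ray: "exp (Complex a \<theta>) = of_real (exp (a - a0)) * w" for a
  proof -
    have "Complex a \<theta> = of_real (a - a0) + Complex a0 \<theta>" by (simp add: complex_eq_iff)
    then show ?thesis by (simp only: exp_add exp_of_real wexp)
  qed
  have slope_ray: "Re (exp (Complex a \<theta>)) \<noteq> 0" "slope (exp (Complex a \<theta>)) = slope w" for a
    unfolding on_ray slope_def using w(2) by simp_all
  have notF: "z \<notin> F" if "z = q0 + exp (Complex a \<theta>)" for z a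
    using avoid[of z] slope_ray[of a] that by (auto simp: w_def)
  have good: "good_ray n \<gamma> D q0 \<theta> a0"
    unfolding good_ray_def
  proof (intro ballI allI impI)
    fix x a assume x: "x \<in> params n" "a0 \<le> a" "pos \<gamma> x = q0 + exp (Complex a \<theta>)"
    obtain j t where jt: "x = (j, t)" "j < n" "0 \<le> t" "t < 1" using x(1) by (auto simp: params_def)
    have nF: "pos \<gamma> x \<notin> F" by (rule notF[OF x(3)])
    then have nd: "x \<notin> double_params n \<gamma>" unfolding F_def crossings_eq[OF P] by blast
    have "t \<noteq> 0" using nF jt unfolding F_def by (auto simp: pos_def)
    then have "0 < snd x" using jt by simp
    moreover have "Im (vector_derivative (\<gamma> (fst x)) (at (snd x)) / exp (Complex a \<theta>)) \<noteq> 0"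
    proof -
      define E where "E = exp (Complex a \<theta>)"
      have E: "\<gamma> j t - q0 = E" "E \<noteq> 0" using x(3) jt(1) by (simp_all add: E_def pos_def)
      have "Im (cnj E * vector_derivative (\<gamma> j) (at t)) \<noteq> 0"
        using trans[OF jt(2), of t] slope_ray[of a] unfolding E(1) w_def[symmetric] unfolding E_def by simp
      moreover have "vector_derivative (\<gamma> j) (at t) / E = cnj E * vector_derivative (\<gamma> j) (at t) / of_real ((norm E)\<^sup>2)"
        using E(2) unfolding complex_norm_square by (simp add: field_simps)
      ultimately show ?thesis using E(2) jt(1) unfolding E_def[symmetric] by (simp add: Im_divide_of_real)
    qed
    ultimately show "x \<notin> double_params n \<gamma> \<and> 0 < snd x \<and> pos \<gamma> x \<notin> arrow_points D \<and>
       Im (vector_derivative (\<gamma> (fst x)) (at (snd x)) / exp (Complex a \<theta>)) \<noteq> 0"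
      using nd nF unfolding F_def by blast
  qed
  have "g sg \<notin> F" using notF[of "g sg" a0] wexp by (simp add: w_def)
  then have gF: "g sg \<notin> crossings D" by (simp add: F_def)
  obtain x0 where x0: "x0 \<in> params n - double_params n \<gamma>" "g sg = pos \<gamma> x0" "dir g sg = pdir \<gamma> x0 \<or> dir g sg = - pdir \<gamma> x0"
    using arrow_on_strand[OF P g(1,2) sg(1,2) gF] by blast
  obtain i t0 where it: "x0 = (i, t0)" by (cases x0)
  have i: "i < n" "0 \<le> t0" "t0 < 1" using x0(1) it by (auto simp: params_def)
  have gt: "g sg = \<gamma> i t0" using x0(2) it by (simp add: pos_def)
  have "t0 \<noteq> 0" using \<open>g sg \<notin> F\<close> gt i(1) unfolding F_def by auto
  then have t0: "0 < t0" "t0 < 1" using i by auto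
  obtain e :: int where e: "e = 1 \<or> e = -1" "dir g sg = of_int e * dir (\<gamma> i) t0"
    using x0(3) it by (metis mult_1 mult_minus1 of_int_1 of_int_minus pdir_def fst_conv snd_conv)
  have pt: "\<gamma> i t0 = q0 + exp (Complex a0 \<theta>)" using gt wexp by (simp add: w_def)
  have nd: "(i, t0) \<notin> double_params n \<gamma>" using x0(1) it by simp
  have "\<gamma> i t0 \<notin> arrow_points D" using \<open>g sg \<notin> F\<close> gt by (simp add: F_def)
  moreover have "finite (arrow_points D)" using A by (simp add: arrow_points_def arrows_ok_def)
  ultimately obtain \<epsilon> where \<epsilon>: "0 < \<epsilon>" "\<epsilon> \<le> 1" "0 < t0 - \<epsilon>" "t0 + \<epsilon> < 1"
    "\<And>t. \<bar>t - t0\<bar> < \<epsilon> \<Longrightarrow> (i, t) \<notin> double_params n \<gamma>" "\<And>t. \<bar>t - t0\<bar> < \<epsilon> \<Longrightarrow> \<gamma> i t \<notin> arrow_points D"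
    using clear_near[OF P i(1) t0 nd _ _ zero_less_one] by blast
  define a b where "a = t0 - \<epsilon> / 2" and "b = t0 + \<epsilon> / 2"
  have ab: "a < b" using \<epsilon>(1) by (simp add: a_def b_def)
  have near: "\<bar>t - t0\<bar> < \<epsilon>" "(i, t) \<in> params n" if "t \<in> {a..b}" for t
  proof -
    show "\<bar>t - t0\<bar> < \<epsilon>" using that \<epsilon>(1) by (auto simp: a_def b_def abs_if)
    then show "(i, t) \<in> params n" using \<epsilon>(3,4) by (intro unit_param[OF i(1)]) linarith+
  qed
  have ic: "immersed_circle (\<gamma> i)" by (rule generic_immersionD[OF gi i(1)])
  have simp_i: "y = (i, t)" if "t \<in> {a..b}" "y \<in> params n" "pos \<gamma> y = \<gamma> i t" for t y
    by (rule simple_param[OF \<epsilon>(5)[OF near(1)[OF that(1)]] near(2)[OF that(1)] that(2,3)])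
  have inj: "inj_on (\<gamma> i) {a..b}"
  proof (rule inj_onI)
    fix t t' assume t: "t \<in> {a..b}" "t' \<in> {a..b}" "\<gamma> i t = \<gamma> i t'"
    have "(i, t') = (i, t)" by (rule simp_i[OF t(1) near(2)[OF t(2)]]) (use t(3) in \<open>simp add: pos_def\<close>)
    then show "t = t'" by simp
  qed
  define c where "c = subarc (\<gamma> i) a b"
  note SA = subarc[OF ic ab inj, folded c_def]
  have Fc: "free_strand D c"
    unfolding free_strand_def SA(2)
  proof (intro conjI)
    show "arrow_diagram D" "embedded_path c" by (fact D SA(1))+
    show "\<gamma> i ` {a..b} \<subseteq> shadow D"
    proof
      fix z assume "z \<in> \<gamma> i ` {a..b}"
      then obtain t where "t \<in> {a..b}" "z = pos \<gamma> (i, t)" by (auto simp: pos_def)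
      then show "z \<in> shadow D" unfolding parametrizesD(2)[OF P] using near(2) by blast
    qed
    show "\<gamma> i ` {a..b} \<inter> crossings D = {}"
      unfolding crossings_eq[OF P]
    proof (rule equals0I)
      fix z assume "z \<in> \<gamma> i ` {a..b} \<inter> pos \<gamma> ` double_params n \<gamma>"
      then obtain t y where ty: "t \<in> {a..b}" "z = \<gamma> i t" "y \<in> double_params n \<gamma>" "z = pos \<gamma> y" by blast
      then have "y = (i, t)" by (intro simp_i) (auto simp: double_params_def)
      then show False using \<epsilon>(5)[OF near(1)[OF ty(1)]] ty(3) by simp
    qed
    have "c ` {0<..<1} \<subseteq> path_image c" unfolding path_image_def by auto
    moreover have "path_image c \<inter> arrow_points D = {}"
      unfolding SA(2) using \<epsilon>(6)[OF near(1)] by (auto dest: spec)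
    ultimately show "c ` {0<..<1} \<inter> arrow_points D = {}" by blast
  qed
  have dec: "\<exists>X. signed X \<and> sum snd X = int k * e \<and>
    D\<lparr>arrows := arrows D \<union> put (\<gamma> i) (T \<times> {e})\<rparr> = decorate D c X"
    if T: "finite T" "card T = k" "\<And>t. t \<in> T \<Longrightarrow> \<bar>t - t0\<bar> < \<epsilon> / 2" for T
  proof -
    define T' where "T' = (\<lambda>t. (t - a) / (b - a)) ` T"
    have "inj_on (\<lambda>t. (t - a) / (b - a)) T" using ab by (auto simp: inj_on_def)
    then have T'1: "finite T'" "card T' = k" unfolding T'_def using T(1,2) by (simp_all add: card_image)
    have "(t - a) / (b - a) \<in> {0<..<1}" if "t \<in> T" for t
    proof -
      have "a < t \<and> t < b"
        using T(3)[OF that] unfolding a_def b_def abs_less_iff by linarith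
      then show ?thesis using ab by (simp add: field_simps)
    qed
    then have T'2: "T' \<subseteq> {0<..<1}" unfolding T'_def by blast
    have "put c (T' \<times> {e}) = put (\<gamma> i) (T \<times> {e})"
      unfolding c_def by (rule put_subarc[OF ic ab inj]) (force simp: T'_def)
    then show ?thesis
      using signed_uniform[OF T'1(1) T'2] e(1) T'1(2)
      by (intro exI[of _ "T' \<times> {e}"]) (auto simp: decorate_def sum_snd_uniform)
  qed
  have "0 < \<epsilon> / 2" using \<epsilon>(1) by simp
  from creates_on_ray[OF M i(1) RB t0 e(1) P D sh pt good finite_hits[OF P good] this]
  obtain T where T: "finite T" "card T = k" "\<forall>t\<in>T. \<bar>t - t0\<bar> < \<epsilon> / 2"
    "equivclp (step M) D (D\<lparr>arrows := arrows D \<union> put (\<gamma> i) (T \<times> {e})\<rparr>)"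
    unfolding creates_def by blast
  obtain X where X: "signed X" "sum snd X = int k * e"
    "D\<lparr>arrows := arrows D \<union> put (\<gamma> i) (T \<times> {e})\<rparr> = decorate D c X"
    using dec[OF T(1,2)] T(3) by blast
  obtain \<eta> where \<eta>: "0 < \<eta>" "\<And>s. \<bar>s - sg\<bar> < \<eta> \<Longrightarrow> 0 < s \<and> s < 1 \<and>
    (\<exists>\<tau>. \<bar>\<tau> - t0\<bar> < \<epsilon> / 2 \<and> g s = \<gamma> i \<tau> \<and> dir g s = of_int e * dir (\<gamma> i) \<tau>)"
    using path_follows_strand[OF P g sg(1,2) _ gt t0 e \<open>0 < \<epsilon> / 2\<close>] x0(1) unfolding it by blast
  have "sg < sg + \<eta>" using \<eta>(1) by simp
  from many_points[OF finite.emptyI this]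
  obtain T1 where T1: "finite T1" "card T1 = k" "T1 \<subseteq> {sg<..<sg + \<eta>} - {}" by blast
  have \<eta>': "0 < s \<and> s < 1 \<and> (\<exists>\<tau>. \<bar>\<tau> - t0\<bar> < \<epsilon> / 2 \<and> g s = \<gamma> i \<tau> \<and> dir g s = of_int e * dir (\<gamma> i) \<tau>)"
    if "s \<in> T1" for s
    by (rule \<eta>(2)) (use T1(3) that in auto)
  then obtain \<tau> where \<tau>: "\<And>s. s \<in> T1 \<Longrightarrow> \<bar>\<tau> s - t0\<bar> < \<epsilon> / 2 \<and> g s = \<gamma> i (\<tau> s) \<and> dir g s = of_int e * dir (\<gamma> i) (\<tau> s)"
    by metis
  have T1': "T1 \<subseteq> {0<..<1}" using \<eta>' by auto
  have "inj_on \<tau> T1"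
  proof (rule inj_onI)
    fix s s' assume s: "s \<in> T1" "s' \<in> T1" "\<tau> s = \<tau> s'"
    have "g s = g s'" using \<tau>[OF s(1)] \<tau>[OF s(2)] s(3) by simp
    moreover have "s \<in> {0<..<1}" "s' \<in> {0<..<1}" using T1' s(1,2) by blast+
    then have "s \<in> {0..1}" "s' \<in> {0..1}" by simp_all
    ultimately show "s = s'" by (rule inj_onD[OF embedded_pathD(3)[OF g(1)]])
  qed
  then have c\<tau>: "finite (\<tau> ` T1)" "card (\<tau> ` T1) = k" using T1(1,2) by (simp_all add: card_image)
  have gT1: "g ` T1 \<inter> arrow_points D = {}"
  proof -
    have "g s \<notin> arrow_points D" if "s \<in> T1" for s
      using \<epsilon>(6)[of "\<tau> s"] \<tau>[OF that] \<epsilon>(1) by auto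
    then show ?thesis by blast
  qed
  have "put g (T1 \<times> {1}) = put (\<gamma> i) (\<tau> ` T1 \<times> {e})"
    unfolding put_uniform image_image using \<tau> by (intro image_cong) auto
  moreover obtain Y where Y: "signed Y" "sum snd Y = int k * e"
    "D\<lparr>arrows := arrows D \<union> put (\<gamma> i) (\<tau> ` T1 \<times> {e})\<rparr> = decorate D c Y"
    using dec[OF c\<tau>] \<tau> by blast
  \<comment> \<open>One diagram, read as a decoration of \<open>g\<close> and as a decoration of
    \<open>c\<close>, links the two slides.\<close>
  ultimately have 1: "decorate Db g (S0 \<union> T1 \<times> {1}) = decorate D c Y"
    unfolding add(3)[OF T1' T1(1,2) gT1] by simp
  have 2: "equivclp (step M) (decorate D c X) (decorate D c Y)"
    by (rule decorate_equiv[OF M(1) Fc X(1) Y(1)]) (simp add: X(2) Y(2))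
  have 3: "equivclp (step M) (decorate Db g (S0 \<union> T1 \<times> {1})) D'"
    unfolding D' by (rule decorate_equiv[OF M(1) Db(1) add(1)[OF T1' T1(1,2) gT1] add(1)[OF T0(1-4)]])
      (simp add: add(2)[OF T1' T1(1,2) gT1] add(2)[OF T0(1-4)])
  show "equivclp (step M) D D'"
    by (rule equivclp_trans[OF equivclp_trans[OF T(4)[unfolded X(3)] 2] 3[unfolded 1]])
qed

theorem mainTheorem8:
  fixes a :: int and k :: nat
  assumes "k \<ge> 1"
  shows "generates (Omega_finite \<union> {Omega_inf a, Omega_inf (a + int k)}) (k_move k) \<and>
         generates (Omega_finite \<union> {Omega_inf a, k_move k}) (Omega_inf (a + int k)) \<and>
         generates (Omega_finite \<union> {Omega_inf (a + int k), k_move k}) (Omega_inf a) \<and>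
         (\<forall>b :: int. generates (Omega_finite \<union> {Omega_inf a, k_move k})
                                (Omega_inf (a + int k * b)))"
proof (intro conjI allI)
  have O4: "Omega4 \<in> Omega_finite \<union> X" for X by (simp add: Omega_finite_def)
  show "generates (Omega_finite \<union> {Omega_inf a, Omega_inf (a + int k)}) (k_move k)"
    by (rule generates_k_move[where p = a]) (use O4 in auto)
  show any: "generates (Omega_finite \<union> {Omega_inf a, k_move k}) (Omega_inf (a + int k * b))" for b
    by (rule generates_Omega_inf) (use O4 in auto)
  show "generates (Omega_finite \<union> {Omega_inf a, k_move k}) (Omega_inf (a + int k))"
    using any[of 1] by simp
  \<comment> \<open>Starting from \<open>a + k\<close>, the factor \<open>b = -1\<close> leads back
    to \<open>a\<close>.\<close>
  have "generates (Omega_finite \<union> {Omega_inf (a + int k), k_move k}) (Omega_inf (a + int k + int k * (-1)))"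
    by (rule generates_Omega_inf) (use O4 in auto)
  then show "generates (Omega_finite \<union> {Omega_inf (a + int k), k_move k}) (Omega_inf a)" by simp
qed

end
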